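(* (Thorin--Bondesson representation.) (Direct part.) Let $\mu\in T(\mathbb R^d)$ have Lévy triplet $(a,\Sigma,\nu)$, where $\nu$ has polar coordinate representation $(\lambda,\{m_u,\ u\in S^{d-1}\})$, with $m_u(dr)=\frac{k(u,r)}{r}dr$ and $k(u,r)=\int_0^\infty e^{-sr}\tau_u(ds)$, $r>0$, and let $\tau$ be the measure given by $$\tau(B)=\int_{S^{d-1}}\lambda(du)\int_0^\infty\mathbf 1_B(su)\,\tau_u(ds),\qquad B\in\mathcal B(\mathbb R^d\setminus\{0\}).\qquad(\dagger)$$ Then $\tau$ satisfies $$\int_{\mathbb R^d}\bigl(|\log|x||\wedge|x|^{-2}\bigr)\,\tau(dx)<\infty\qquad(\ast)$$ and, for all $z\in\mathbb R^d$, $$\psi_\mu(z)=i\langle z,b\rangle-\frac12\langle\Sigma z,z\rangle-\int_{\mathbb R^d}\left(\log\left(1-\frac{i\langle z,x\rangle}{|x|^2}\right)+\frac{i\langle z,x\rangle}{|x|^2}\mathbf 1_{\{|x|\ge1\}}\right)\tau(dx),\qquad(\ast\ast)$$ with $b=(b_1,\dots,b_d)$ given by $$b_j=a_j-\int_{\mathbb R^d}x_j\left(\frac{1-e^{-|x|}}{|x|^2}-\frac{1}{|x|^2}\mathbf 1_{\{|x|\ge1\}}\right)\tau(dx),\qquad j=1,\dots,d.\qquad(\ast\!\ast\!\ast)$$ (Converse part.) Let $b\in\mathbb R^d$, let $\Sigma$ be a $d\times d$ nonnegative definite symmetric matrix, and let $\tau$ be a measure on $\mathbb R^d$ given by $(\dagger)$,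 where $\lambda$ is a finite measure on $S^{d-1}$ and $\{\tau_u,\ u\in S^{d-1}\}$ is a family of $\sigma$-finite measures on $[0,\infty)$ such that $u\mapsto\tau_u(B)$ is measurable for all $B\in\mathcal B([0,\infty))$, and further satisfying $\mathscr L(\tau_u,r)=\int_0^\infty e^{-rs}\tau_u(ds)<\infty$ for all $r>0$, $u\in S^{d-1}$. Moreover, assume that the integrability condition $(\ast)$ holds. Then $(\ast\ast)$ is the characteristic exponent of some $\mu\in T(\mathbb R^d)$ whose Lévy triplet is $(a,\Sigma,\nu)$, where $a$ is the solution of $(\ast\!\ast\!\ast)$ and $\nu$ has polar coordinates $\bigl(\lambda,\{\mathscr L(\tau_u,r)\,r^{-1}dr,\ u\in S^{d-1}\}\bigr)$.
   Context: $\hat\mu(z)=\int e^{i\langle z,x\rangle}\mu(dx)$ is the characteristic function of a law $\mu$ on $\mathbb R^d$. $\mu$ is infinitely divisible with Lévy triplet $(a,\Sigma,\nu)$ if its characteristic exponent $\psi_\mu=\log\hat\mu$ is $\psi_\mu(z)=i\langle z,a\rangle-\frac12\langle\Sigma z,z\rangle+\int_{\mathbb R^d}(e^{i\langle z,x\rangle}-1-i\langle z,x\rangle\mathbf 1_{\{|x|\le1\}})\nu(dx)$, where $a\in\mathbb R^d$, $\Sigma$ is symmetric nonnegative definite, $\nu(\{0\})=0$ and $\int(|x|^2\wedge1)\nu(dx)<\infty$. The complex logarithm is the principal branch. $S^{d-1}$ is the unit sphere of $\mathbb R^d$. $\nu$ has polar coordinate representation $(\lambda,\{m_u\})$ if $\lambda$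 is a finite measure on $S^{d-1}$, the $m_u$ are $\sigma$-finite measures with $u\mapsto m_u(B)$ measurable for every Borel $B\subseteq(0,\infty)$, and $\nu(B)=\int_{S^{d-1}}\lambda(du)\int_0^\infty\mathbf 1_B(ru)\,m_u(dr)$ for all Borel $B\subseteq\mathbb R^d\setminus\{0\}$. The Thorin class $T(\mathbb R^d)$ is the set of weak limits of finite convolutions of elementary gamma laws, i.e. laws of $Vx$ with $V$ a (positive) gamma random variable and $x\in\mathbb R^d\setminus\{0\}$. Known characterization: $\mu\in T(\mathbb R^d)$ if and only if $\mu$ is infinitely divisible and self-decomposable, i.e. $m_u(dr)=\frac{k(u,r)}{r}dr$ with the canonical function $k\ge0$ decreasing and right-continuous in $r$ and measurable in $u$, and moreover $k(u,\cdot)$ is completely monotone for all $u\in S^{d-1}$, i.e. $k(u,r)=\int_0^\infty e^{-sr}\tau_u(ds)$, $r>0$, for a family of positive measures $\{\tau_u,\ u\in S^{d-1}\}$ on $[0,\infty)$ with $u\mapsto\tau_u(B)$ measurable for all Borel $B\subseteq[0,\infty)$.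
   Formalization: In the converse, τ is also assumed finite on compact sets avoiding 0 (else false for d≥2: τ_u=f(u)δ_1, ∫f dλ=∞); τ counts mass of τ_u at 0, where the weight in (∗) is ∞; ψ_μ is the continuous logarithm of the characteristic function vanishing at 0, not the principal branch. *)

theory Defs
  imports "HOL-Probability.Probability"
begin

section \<open>The Thorin class\<close>

definition gamma_density :: "real \<Rightarrow> real \<Rightarrow> real \<Rightarrow> real" where
  "gamma_density \<alpha> \<beta> v =
     (if v > 0 then \<beta> powr \<alpha> * v powr (\<alpha> - 1) * exp (- (\<beta> * v)) / Gamma \<alpha> else 0)"

definition elementary_gamma_law :: "real \<Rightarrow> real \<Rightarrow> real ^ 'n \<Rightarrow> (real ^ 'n) measure" where
  "elementary_gamma_law \<alpha> \<beta> x =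
     distr (density lborel (\<lambda>v. ennreal (gamma_density \<alpha> \<beta> v))) borel (\<lambda>v. v *\<^sub>R x)"

inductive_set gamma_convolutions :: "(real ^ 'n) measure set" where
  single: "\<alpha> > 0 \<Longrightarrow> \<beta> > 0 \<Longrightarrow> x \<noteq> 0 \<Longrightarrow> elementary_gamma_law \<alpha> \<beta> x \<in> gamma_convolutions"
| conv: "\<mu> \<in> gamma_convolutions \<Longrightarrow> \<alpha> > 0 \<Longrightarrow> \<beta> > 0 \<Longrightarrow> x \<noteq> 0 \<Longrightarrow>
     (\<mu> \<star> elementary_gamma_law \<alpha> \<beta> x) \<in> gamma_convolutions"

definition weakly_converges :: "(nat \<Rightarrow> (real ^ 'n) measure) \<Rightarrow> (real ^ 'n) measure \<Rightarrow> bool" where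
  "weakly_converges M \<mu> \<longleftrightarrow>
     (\<forall>f :: real ^ 'n \<Rightarrow> real. continuous_on UNIV f \<longrightarrow> bounded (range f) \<longrightarrow>
        (\<lambda>k. \<integral>x. f x \<partial>M k) \<longlonglongrightarrow> (\<integral>x. f x \<partial>\<mu>))"

definition law :: "(real ^ 'n) measure \<Rightarrow> bool" where
  "law \<mu> \<longleftrightarrow> prob_space \<mu> \<and> sets \<mu> = sets borel"

definition thorin_class :: "(real ^ 'n) measure set" where
  "thorin_class =
     {\<mu>. law \<mu> \<and> (\<exists>M. (\<forall>k. M k \<in> gamma_convolutions) \<and> weakly_converges M \<mu>)}"

section \<open>Characteristic exponents and Levy triplets\<close>

definition char_fun :: "(real ^ 'n) measure \<Rightarrow> real ^ 'n \<Rightarrow> complex" where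
  "char_fun \<mu> z = (\<integral>x. exp (\<i> * complex_of_real (z \<bullet> x)) \<partial>\<mu>)"

text \<open>
  The exponent is the continuous (``distinguished'') logarithm of the characteristic function
  vanishing at the origin.  The principal branch of the logarithm of the characteristic function
  would not do here: it differs from the Levy--Khintchine formula as soon as the imaginary part of
  the latter leaves the interval from \<open>-pi\<close> to \<open>pi\<close>, e.g. for a point mass.
\<close>

definition is_char_exponent :: "(real ^ 'n) measure \<Rightarrow> (real ^ 'n \<Rightarrow> complex) \<Rightarrow> bool" where
  "is_char_exponent \<mu> \<psi> \<longleftrightarrow>
     continuous_on UNIV \<psi> \<and> \<psi> 0 = 0 \<and> (\<forall>z. exp (\<psi> z) = char_fun \<mu> z)"

lemma is_char_exponent_unique:
  fixes \<mu> :: "(real ^ 'n) measure"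
  assumes "is_char_exponent \<mu> \<psi>" and "is_char_exponent \<mu> \<phi>"
  shows "\<psi> = \<phi>"
proof -
  have "(\<lambda>z. \<psi> z - \<phi> z) constant_on UNIV"
  proof (rule continuous_discrete_range_constant)
    show "connected (UNIV :: (real ^ 'n) set)" by (rule connected_UNIV)
    show "continuous_on UNIV (\<lambda>z. \<psi> z - \<phi> z)"
      using assms by (auto simp: is_char_exponent_def intro: continuous_intros)
    fix x :: "real ^ 'n"
    have "2 * pi \<le> cmod (\<psi> y - \<phi> y - (\<psi> x - \<phi> x))" if "\<psi> y - \<phi> y \<noteq> \<psi> x - \<phi> x" for y
    proof (rule ccontr)
      assume *: "\<not> ?thesis"
      have "\<psi> y - \<phi> y = \<psi> x - \<phi> x"
      proof (rule exp_complex_eqI)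
        show "\<bar>Im (\<psi> y - \<phi> y) - Im (\<psi> x - \<phi> x)\<bar> < 2 * pi"
          using * abs_Im_le_cmod[of "\<psi> y - \<phi> y - (\<psi> x - \<phi> x)"] by simp
        show "exp (\<psi> y - \<phi> y) = exp (\<psi> x - \<phi> x)"
          using assms unfolding is_char_exponent_def exp_diff
          by (metis divide_self exp_not_eq_zero)
      qed
      with that show False by simp
    qed
    then show "\<exists>e>0. \<forall>y. y \<in> UNIV \<and> \<psi> y - \<phi> y \<noteq> \<psi> x - \<phi> x \<longrightarrow>
        e \<le> cmod (\<psi> y - \<phi> y - (\<psi> x - \<phi> x))"
      by (intro exI[of _ "2 * pi"]) auto
  qed
  then obtain c where c: "\<And>z. \<psi> z - \<phi> z = c"
    by (auto simp: constant_on_def)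
  have "c = 0"
    using c[of 0] assms by (simp add: is_char_exponent_def)
  with c show ?thesis by (intro ext) simp
qed

definition symmetric_nonneg_def :: "real ^ 'n ^ 'n \<Rightarrow> bool" where
  "symmetric_nonneg_def S \<longleftrightarrow> transpose S = S \<and> (\<forall>z. 0 \<le> (S *v z) \<bullet> z)"

definition levy_measure :: "(real ^ 'n) measure \<Rightarrow> bool" where
  "levy_measure \<nu> \<longleftrightarrow> sets \<nu> = sets borel \<and> emeasure \<nu> {0} = 0 \<and>
     (\<integral>\<^sup>+x. ennreal (min ((norm x)\<^sup>2) 1) \<partial>\<nu>) < \<infinity>"

definition levy_khintchine ::
  "real ^ 'n \<Rightarrow> real ^ 'n ^ 'n \<Rightarrow> (real ^ 'n) measure \<Rightarrow> real ^ 'n \<Rightarrow> complex" where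
  "levy_khintchine a S \<nu> z =
     \<i> * complex_of_real (z \<bullet> a) - complex_of_real ((S *v z) \<bullet> z) / 2
     + (\<integral>x. exp (\<i> * complex_of_real (z \<bullet> x)) - 1
            - \<i> * complex_of_real ((z \<bullet> x) * indicator {x. norm x \<le> 1} x) \<partial>\<nu>)"

definition has_levy_triplet ::
  "(real ^ 'n) measure \<Rightarrow> real ^ 'n \<Rightarrow> real ^ 'n ^ 'n \<Rightarrow> (real ^ 'n) measure \<Rightarrow> bool" where
  "has_levy_triplet \<mu> a S \<nu> \<longleftrightarrow>
     law \<mu> \<and> symmetric_nonneg_def S \<and> levy_measure \<nu> \<and>
     is_char_exponent \<mu> (levy_khintchine a S \<nu>)"

section \<open>Polar coordinates\<close>

text \<open>
  Families of measures on a Borel set \<open>I\<close> of reals are indexed by all vectors, but only their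
  members at unit vectors matter.
\<close>

definition finite_sphere_measure :: "(real ^ 'n) measure \<Rightarrow> bool" where
  "finite_sphere_measure lam \<longleftrightarrow>
     finite_measure lam \<and> sets lam = sets (restrict_space borel (sphere 0 1))"

definition measurable_family :: "real set \<Rightarrow> (real ^ 'n \<Rightarrow> real measure) \<Rightarrow> bool" where
  "measurable_family I M \<longleftrightarrow>
     (\<forall>u\<in>sphere 0 1. sets (M u) = sets (restrict_space borel I)) \<and>
     (\<forall>B\<in>sets (restrict_space borel I).
        (\<lambda>u. emeasure (M u) B) \<in> borel_measurable (restrict_space borel (sphere 0 1)))"

definition polar_representation ::
  "(real ^ 'n) measure \<Rightarrow> (real ^ 'n) measure \<Rightarrow> (real ^ 'n \<Rightarrow> real measure) \<Rightarrow> bool" where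
  "polar_representation \<nu> lam m \<longleftrightarrow>
     finite_sphere_measure lam \<and> measurable_family {0<..} m \<and>
     (\<forall>u\<in>sphere 0 1. sigma_finite_measure (m u)) \<and>
     (\<forall>B\<in>sets borel. 0 \<notin> B \<longrightarrow>
        emeasure \<nu> B = (\<integral>\<^sup>+u. \<integral>\<^sup>+r. indicator B (r *\<^sub>R u) \<partial>m u \<partial>lam))"

definition laplace :: "real measure \<Rightarrow> real \<Rightarrow> ennreal" where
  "laplace M r = (\<integral>\<^sup>+s. ennreal (exp (- (r * s))) \<partial>M)"

section \<open>Thorin measures\<close>

text \<open>
  The radial measures live on the closed half line, so the defining formula is used for all Borel
  sets \<open>B\<close>, those containing the origin included; the mass of the origin is then
  \<open>\<integral>\<^sup>+u. emeasure (tau u) {0} \<partial>lam\<close>.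
\<close>

definition thorin_measure ::
  "(real ^ 'n) measure \<Rightarrow> (real ^ 'n) measure \<Rightarrow> (real ^ 'n \<Rightarrow> real measure) \<Rightarrow> bool" where
  "thorin_measure T lam tau \<longleftrightarrow> sets T = sets borel \<and>
     (\<forall>B\<in>sets borel.
        emeasure T B = (\<integral>\<^sup>+u. \<integral>\<^sup>+s. indicator B (s *\<^sub>R u) \<partial>tau u \<partial>lam))"

text \<open>
  At the origin both \<open>\<bar>log \<bar>x\<bar>\<bar>\<close> and \<open>\<bar>x\<bar> ^ (-2)\<close> are infinite, whereas \<open>ln 0 = 0\<close> and
  \<open>1 / 0 = 0\<close> in HOL.  Hence finiteness of the integral forces the origin to be a null set.
\<close>

definition thorin_weight :: "real ^ 'n \<Rightarrow> ennreal" where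
  "thorin_weight x =
     (if x = 0 then \<infinity> else ennreal (min \<bar>ln (norm x)\<bar> (1 / (norm x)\<^sup>2)))"

definition thorin_integrable :: "(real ^ 'n) measure \<Rightarrow> bool" where
  "thorin_integrable T \<longleftrightarrow> (\<integral>\<^sup>+x. thorin_weight x \<partial>T) < \<infinity>"

text \<open>
  The weight vanishes on the unit sphere, so \<open>thorin_integrable\<close> does not bound the mass
  near the sphere; this condition does.
\<close>

definition locally_finite_off_origin :: "(real ^ 'n) measure \<Rightarrow> bool" where
  "locally_finite_off_origin T \<longleftrightarrow> (\<forall>K. compact K \<longrightarrow> 0 \<notin> K \<longrightarrow> emeasure T K < \<infinity>)"

definition thorin_integrand :: "real ^ 'n \<Rightarrow> real ^ 'n \<Rightarrow> complex" where
  "thorin_integrand z x =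
     Ln (1 - \<i> * complex_of_real ((z \<bullet> x) / (norm x)\<^sup>2))
     + \<i> * complex_of_real ((z \<bullet> x) / (norm x)\<^sup>2 * indicator {x. norm x \<ge> 1} x)"

definition thorin_exponent ::
  "real ^ 'n \<Rightarrow> real ^ 'n ^ 'n \<Rightarrow> (real ^ 'n) measure \<Rightarrow> real ^ 'n \<Rightarrow> complex" where
  "thorin_exponent b S T z =
     \<i> * complex_of_real (z \<bullet> b) - complex_of_real ((S *v z) \<bullet> z) / 2
     - (\<integral>x. thorin_integrand z x \<partial>T)"

definition drift_integrand :: "'n \<Rightarrow> real ^ 'n \<Rightarrow> real" where
  "drift_integrand j x =
     x $ j * ((1 - exp (- norm x)) / (norm x)\<^sup>2
              - 1 / (norm x)\<^sup>2 * indicator {x. norm x \<ge> 1} x)"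

end

theory Submission
  imports Defs "HOL-Real_Asymp.Real_Asymp"
begin

text \<open>
  For \<open>s > 0\<close> and real \<open>c\<close>, a Frullani integral gives
  \<open>\<integral> (exp (i c r) - 1 - i c r 1{r \<le> 1}) exp (- s r) / r dr = - Ln (1 - i c / s) - i c (1 - exp (- s)) / s\<close>,
  the integral being over \<open>r > 0\<close>.
  Integrating over the Thorin measure \<open>T\<close>, with \<open>s = \<bar>x\<bar>\<close> and \<open>c = \<langle>z, x / \<bar>x\<bar>\<rangle>\<close>, turns the Levy--Khintchine
  integral into the Thorin--Bondesson integral. The exchange of integrals is justified because
  \<open>\<integral> min (r\<^sup>2) 1 exp (- s r) / r dr\<close> is comparable to \<open>1 - ln s\<close> for \<open>s < 1\<close> and to \<open>s\<^sup>-\<^sup>2\<close> for \<open>s \<ge> 1\<close>,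
  so that the integrability conditions on the two sides agree.

  For the converse, \<open>thorin_exponent b S T\<close> is a locally uniform limit of exponents of gamma convolutions:
  drifts and Gaussian parts arise from gamma laws with large shape parameter, and the integral over \<open>T\<close>
  from approximating \<open>x / \<bar>x\<bar>\<^sup>2\<close> by simple functions on annuli. The limit law exists by the continuity theorem.
  Tightness follows by averaging characteristic functions over Gaussians, and compactness is reduced to the
  one-dimensional selection theorem of Helly by lifting the laws along a space-filling curve.
\<close>

section \<open>Logarithms, gamma integrals and the Frullani integral\<close>

text \<open>The origin is where the polar picture breaks down: \<open>sgn 0\<close> is 0, so an atom
  of \<open>T\<close> there would be lost by the map that builds the Levy measure. Both directions
  therefore begin by showing that the origin is a null set, from the divergence of the integral of 1
  / r at infinity in the direct part and from the infinite weight in the converse. Away from the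
  origin, one function of the norm, \<open>radial_bound\<close>, dominates every integrand. Unlike
  the weight in the integrability condition it does not vanish on the unit sphere; the gap is filled
  by the mass of a compact shell.

  The approximation is carried out among exponents and not among laws. Uniform closeness on balls is
  stable under sums and under iterated approximation, so drift, Gaussian part and Thorin integral
  can be treated separately, and a law is constructed only once. The limit exponent is then
  automatically continuous and zero at 0, which makes it the distinguished logarithm. Inside the
  integrand the principal logarithm is harmless, since 1 - i t has real part 1 and never meets the
  cut.\<close>

lemma vector_differentiable_bound:
  fixes f :: "real \<Rightarrow> 'a::real_normed_vector"
  assumes "convex S" "\<And>x. x \<in> S \<Longrightarrow> (f has_vector_derivative f' x) (at x within S)"
    and "\<And>x. x \<in> S \<Longrightarrow> norm (f' x) \<le> B" and "x \<in> S" "y \<in> S"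
  shows "norm (f x - f y) \<le> B * norm (x - y)"
  using assms by (intro differentiable_bound[of S f "\<lambda>x h. h *\<^sub>R f' x"])
    (auto simp: has_vector_derivative_def onorm_scaleR_left onorm_id)

section \<open>The logarithm along the vertical line through 1\<close>

abbreviation Ln_ii :: "real \<Rightarrow> complex" where
  "Ln_ii t \<equiv> Ln (1 - \<i> * of_real t)"

lemma cmod_one_minus_ii_ge_1: "1 \<le> cmod (1 - \<i> * of_real t)"
  using abs_Re_le_cmod[of "1 - \<i> * of_real t"] by simp

lemma has_vector_derivative_Ln_ii:
  "((\<lambda>t. Ln_ii t) has_vector_derivative (- \<i> / (1 - \<i> * of_real t))) (at t within A)"
proof -
  have "1 - \<i> * complex_of_real t \<notin> \<real>\<^sub>\<le>\<^sub>0"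
    by (auto simp: complex_nonpos_Reals_iff)
  then have "((\<lambda>z. Ln (1 - \<i> * z)) has_field_derivative (- \<i> / (1 - \<i> * of_real t))) (at (of_real t))"
    by (auto intro!: derivative_eq_intros simp: field_simps)
  then show ?thesis
    using has_vector_derivative_real_field has_vector_derivative_at_within by blast
qed

lemma has_vector_derivative_Ln_ii_divide:
  assumes "s \<noteq> 0"
  shows "((\<lambda>t. Ln_ii (t / s)) has_vector_derivative
     (1 / s) *\<^sub>R (- \<i> / (1 - \<i> * of_real (t / s)))) (at t)"
proof -
  have "((\<lambda>t. t / s) has_vector_derivative (1 / s)) (at t)"
    unfolding has_real_derivative_iff_has_vector_derivative[symmetric]
    using assms by (auto intro!: derivative_eq_intros)
  from vector_diff_chain_at[OF this has_vector_derivative_Ln_ii]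
  show ?thesis by (simp add: o_def)
qed

text \<open>The derivative - i / (1 - i t) has modulus at most 1 because |1 - i t| >= 1. The
  Lipschitz bound later turns closeness of vectors into closeness of exponents.\<close>

lemma cmod_Ln_ii_diff_le:
  "cmod (Ln_ii t - Ln_ii s) \<le> \<bar>t - s\<bar>"
proof -
  have "cmod (Ln_ii t - Ln_ii s) \<le> 1 * norm (t - s)"
  proof (rule vector_differentiable_bound[of UNIV])
    fix x :: real
    show "((\<lambda>t. Ln_ii t) has_vector_derivative (- \<i> / (1 - \<i> * of_real x))) (at x within UNIV)"
      by (rule has_vector_derivative_Ln_ii)
    show "cmod (- \<i> / (1 - \<i> * of_real x)) \<le> 1"
      using cmod_one_minus_ii_ge_1[of x] by (simp add: norm_divide)
  qed auto
  then show ?thesis by simp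
qed

lemma cmod_Ln_ii_le: "cmod (Ln_ii t) \<le> \<bar>t\<bar>"
  using cmod_Ln_ii_diff_le[of t 0] by simp

text \<open>The remainder has derivative x / (1 - i x), of modulus at most |t| between - |t| and
  |t|. The quadratic order gives integrability over large |x| and lets gamma laws of large shape
  converge to a drift.\<close>

lemma cmod_Ln_ii_linear:
  "cmod (Ln_ii t + \<i> * of_real t) \<le> t\<^sup>2"
proof -
  let ?f = "\<lambda>t. Ln_ii t + \<i> * of_real t"
  have "cmod (?f t - ?f 0) \<le> \<bar>t\<bar> * norm (t - 0)"
  proof (rule vector_differentiable_bound[of "{- \<bar>t\<bar>..\<bar>t\<bar>}"])
    fix x assume x: "x \<in> {- \<bar>t\<bar>..\<bar>t\<bar>}"
    have nz: "1 - \<i> * complex_of_real x \<noteq> 0"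
      using cmod_one_minus_ii_ge_1[of x] by auto
    show "(?f has_vector_derivative (- \<i> / (1 - \<i> * of_real x) + \<i>)) (at x within {- \<bar>t\<bar>..\<bar>t\<bar>})"
      by (intro has_vector_derivative_add has_vector_derivative_Ln_ii)
         (auto intro!: derivative_eq_intros)
    have "- \<i> / (1 - \<i> * of_real x) + \<i> = of_real x / (1 - \<i> * of_real x)"
      using nz by (simp add: field_simps)
    then show "cmod (- \<i> / (1 - \<i> * of_real x) + \<i>) \<le> \<bar>t\<bar>"
      using cmod_one_minus_ii_ge_1[of x] x nz
      mult_mono[of "\<bar>x\<bar>" "\<bar>t\<bar>" 1 "cmod (1 - \<i> * of_real x)"]
      by (auto simp: norm_divide divide_le_eq)
  qed auto
  then show ?thesis by (simp add: power2_eq_square)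
qed

text \<open>The same argument one order higher. A cubic error is what survives the multiplication by
  n when t is of size 1 / sqrt n, as in the Gaussian limit.\<close>

lemma cmod_Ln_ii_quadratic:
  "cmod (Ln_ii t + \<i> * of_real t - of_real (t\<^sup>2 / 2)) \<le> \<bar>t\<bar> ^ 3"
proof -
  let ?f = "\<lambda>t. Ln_ii t + \<i> * of_real t - of_real (t\<^sup>2 / 2)"
  have "cmod (?f t - ?f 0) \<le> t\<^sup>2 * norm (t - 0)"
  proof (rule vector_differentiable_bound[of "{- \<bar>t\<bar>..\<bar>t\<bar>}"])
    fix x assume x: "x \<in> {- \<bar>t\<bar>..\<bar>t\<bar>}"
    have nz: "1 - \<i> * complex_of_real x \<noteq> 0"
      using cmod_one_minus_ii_ge_1[of x] by auto
    show "(?f has_vector_derivative (- \<i> / (1 - \<i> * of_real x) + \<i> - of_real x)) (at x within {- \<bar>t\<bar>..\<bar>t\<bar>})"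
      by (intro has_vector_derivative_add has_vector_derivative_diff has_vector_derivative_Ln_ii
            has_vector_derivative_of_real)
         (auto intro!: derivative_eq_intros simp: has_real_derivative_iff_has_vector_derivative[symmetric])
    have "- \<i> / (1 - \<i> * of_real x) + \<i> - of_real x = \<i> * (of_real x)\<^sup>2 / (1 - \<i> * of_real x)"
      using nz by (simp add: field_simps power2_eq_square)
    moreover have "x\<^sup>2 \<le> t\<^sup>2" using x by (intro abs_le_square_iff[THEN iffD1]) auto
    ultimately show "cmod (- \<i> / (1 - \<i> * of_real x) + \<i> - of_real x) \<le> t\<^sup>2"
      using cmod_one_minus_ii_ge_1[of x] nz
      mult_mono[of "x\<^sup>2" "t\<^sup>2" 1 "cmod (1 - \<i> * of_real x)"]
      by (auto simp: norm_divide norm_mult norm_power divide_le_eq)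
  qed auto
  then show ?thesis by (simp add: power3_eq_cube power2_eq_square)
qed

text \<open>The real part is ln |1 - i t| and the imaginary part is at most pi in modulus.
  Logarithmic growth is essential near the origin, where the argument may be as large as |z| /
  |x|.\<close>

lemma cmod_Ln_ii_le_ln:
  "cmod (Ln_ii t) \<le> ln (1 + \<bar>t\<bar>) + pi"
proof -
  let ?w = "1 - \<i> * complex_of_real t"
  have nz: "?w \<noteq> 0" using cmod_one_minus_ii_ge_1[of t] by auto
  have "cmod ?w \<le> 1 + \<bar>t\<bar>"
    using norm_triangle_ineq4[of 1 "\<i> * complex_of_real t"] by (simp add: norm_mult)
  then have "ln (cmod ?w) \<le> ln (1 + \<bar>t\<bar>)"
    using cmod_one_minus_ii_ge_1[of t] by simp
  moreover have "0 \<le> ln (cmod ?w)" using cmod_one_minus_ii_ge_1[of t] by simp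
  moreover have "\<bar>Im (Ln ?w)\<bar> \<le> pi"
    using Im_Ln_le_pi[OF nz] mpi_less_Im_Ln[OF nz] by auto
  ultimately show ?thesis
    using cmod_le[of "Ln ?w"] Re_Ln[OF nz] by linarith
qed

section \<open>Fourier integrals of gamma kernels and the Frullani integral\<close>

lemma integrable_exp_minus_one_mult:
  fixes g :: "real \<Rightarrow> real"
  assumes "g \<in> borel_measurable borel" "integrable lborel (\<lambda>v. v * g v)"
  shows "integrable lborel (\<lambda>v. (iexp (t * v) - 1) * of_real (g v))"
proof (rule Bochner_Integration.integrable_bound[of _ "\<lambda>v. \<bar>t\<bar> * (v * g v)"])
  show "AE v in lborel. norm ((iexp (t * v) - 1) * complex_of_real (g v)) \<le> norm (\<bar>t\<bar> * (v * g v))"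
  proof (rule AE_I2)
    fix v
    have "cmod (iexp (t * v) - 1) \<le> \<bar>t * v\<bar>"
      using iexp_approx1[of "t * v" 0] by simp
    then show "norm ((iexp (t * v) - 1) * complex_of_real (g v)) \<le> norm (\<bar>t\<bar> * (v * g v))"
      by (auto simp: norm_mult abs_mult mult.assoc[symmetric] intro: mult_right_mono)
  qed
qed (use assms in \<open>auto intro: integrable_mult_right\<close>)

text \<open>A second-order Taylor bound on iexp makes the error of the difference quotient at most a
  constant times |h|, the constant being half the absolute second moment of g. Subtracting 1 keeps
  the statement meaningful for kernels such as exp (- s r) / r, which are not integrable at
  0.\<close>

lemma has_vector_derivative_exp_minus_one_integral:
  fixes g :: "real \<Rightarrow> real"
  assumes g[measurable]: "g \<in> borel_measurable borel"
    and i1: "integrable lborel (\<lambda>v. v * g v)" and i2: "integrable lborel (\<lambda>v. v\<^sup>2 * g v)"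
  shows "((\<lambda>t. \<integral>v. (iexp (t * v) - 1) * of_real (g v) \<partial>lborel) has_vector_derivative
          (\<integral>v. \<i> * iexp (t * v) * of_real (v * g v) \<partial>lborel)) (at t)"
proof -
  let ?F = "\<lambda>t. \<integral>v. (iexp (t * v) - 1) * of_real (g v) \<partial>lborel"
  let ?D = "\<integral>v. \<i> * iexp (t * v) * of_real (v * g v) \<partial>lborel"
  have intF: "integrable lborel (\<lambda>v. (iexp (t * v) - 1) * of_real (g v))" for t
    by (rule integrable_exp_minus_one_mult[OF g i1])
  have intD: "integrable lborel (\<lambda>v. \<i> * iexp (t * v) * of_real (v * g v))" for t
    by (rule Bochner_Integration.integrable_bound[OF i1]) (auto simp: norm_mult)
  define C where "C = (\<integral>v. \<bar>v\<^sup>2 * g v\<bar> \<partial>lborel) / 2"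
  have bound: "norm (?F (t + h) - ?F t - h *\<^sub>R ?D) \<le> C * h\<^sup>2" for h
  proof -
    let ?R = "\<lambda>v. (iexp ((t + h) * v) - 1) * complex_of_real (g v)
        - (iexp (t * v) - 1) * of_real (g v)
        - h *\<^sub>R (\<i> * iexp (t * v) * of_real (v * g v))"
    have eq: "?F (t + h) - ?F t - h *\<^sub>R ?D = (\<integral>v. ?R v \<partial>lborel)"
      using intF[of "t+h"] intF[of t] intD[of t] by simp
    have "norm (?F (t + h) - ?F t - h *\<^sub>R ?D) \<le> (\<integral>v. h\<^sup>2 / 2 * \<bar>v\<^sup>2 * g v\<bar> \<partial>lborel)"
      unfolding eq
    proof (rule Bochner_Integration.integral_norm_bound_integral)
      show "integrable lborel ?R"
        using intF[of "t+h"] intF[of t] intD[of t] by (intro Bochner_Integration.integrable_diff) auto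
      show "integrable lborel (\<lambda>v. h\<^sup>2 / 2 * \<bar>v\<^sup>2 * g v\<bar>)"
        using i2 by (intro integrable_mult_right integrable_abs)
      fix v
      have "?R v = iexp (t * v) * (iexp (h * v) - 1 - \<i> * of_real (h * v)) * of_real (g v)"
        by (simp add: algebra_simps exp_add scaleR_conv_of_real)
      then have "norm (?R v) = cmod (iexp (h * v) - 1 - \<i> * of_real (h * v)) * \<bar>g v\<bar>"
        by (simp add: norm_mult)
      also have "\<dots> \<le> ((h * v)\<^sup>2 / 2) * \<bar>g v\<bar>"
        using iexp_approx1[of "h * v" 1] by (intro mult_right_mono) (auto simp: numeral_2_eq_2 diff_diff_add)
      finally show "norm (?R v) \<le> h\<^sup>2 / 2 * \<bar>v\<^sup>2 * g v\<bar>"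
        by (simp add: abs_mult power_mult_distrib)
    qed
    also have "\<dots> = h\<^sup>2 / 2 * (\<integral>v. \<bar>v\<^sup>2 * g v\<bar> \<partial>lborel)"
      by (simp only: Bochner_Integration.integral_mult_right_zero)
    also have "\<dots> = C * h\<^sup>2"
      unfolding C_def by (metis mult.commute times_divide_eq_left)
    finally show ?thesis .
  qed
  show ?thesis
    unfolding has_vector_derivative_def has_derivative_at
  proof (intro conjI bounded_linear_scaleR_left)
    show "(\<lambda>h. norm (?F (t + h) - ?F t - h *\<^sub>R ?D) / norm h) \<midarrow>0\<rightarrow> 0"
    proof (rule tendsto_sandwich[of "\<lambda>_. 0" _ _ "\<lambda>h. C * \<bar>h\<bar>"])
      show "\<forall>\<^sub>F h in at 0. norm (?F (t + h) - ?F t - h *\<^sub>R ?D) / norm h \<le> C * \<bar>h\<bar>"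
      proof (rule eventually_at_ball'[THEN eventually_mono])
        fix h :: real assume "h \<in> ball 0 1 \<and> h \<noteq> 0 \<and> h \<in> UNIV"
        then show "norm (?F (t + h) - ?F t - h *\<^sub>R ?D) / norm h \<le> C * \<bar>h\<bar>"
          using bound[of h] by (simp add: divide_le_eq power2_eq_square)
      qed auto
      show "(\<lambda>h. C * \<bar>h\<bar>) \<midarrow>0\<rightarrow> 0" by (auto intro!: tendsto_eq_intros)
    qed auto
  qed
qed

abbreviation gamma_kernel :: "real \<Rightarrow> real \<Rightarrow> real \<Rightarrow> real" where
  "gamma_kernel \<alpha> \<beta> v \<equiv> (if v > 0 then v powr (\<alpha> - 1) * exp (- (\<beta> * v)) else 0)"

lemma nn_integral_powr_exp:
  assumes "\<alpha> > 0" "\<beta> > (0::real)"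
  shows "(\<integral>\<^sup>+v. ennreal (gamma_kernel \<alpha> \<beta> v) \<partial>lborel)
    = ennreal (Gamma \<alpha> / \<beta> powr \<alpha>)"
proof -
  let ?g = "\<lambda>v. ennreal (gamma_kernel \<alpha> \<beta> v)"
  have "ennreal (Gamma \<alpha>) = (\<integral>\<^sup>+t. ennreal (indicator {0..} t * t powr (\<alpha> - 1) / exp t) \<partial>lborel)"
    by (rule Gamma_conv_nn_integral_real[OF assms(1)])
  also have "\<dots> = ennreal \<bar>\<beta>\<bar> * (\<integral>\<^sup>+v. ennreal (indicator {0..} (0 + \<beta> * v) * (0 + \<beta> * v) powr (\<alpha> - 1) / exp (0 + \<beta> * v)) \<partial>lborel)"
    using assms by (intro nn_integral_real_affine) auto
  also have "(\<integral>\<^sup>+v. ennreal (indicator {0..} (0 + \<beta> * v) * (0 + \<beta> * v) powr (\<alpha> - 1) / exp (0 + \<beta> * v)) \<partial>lborel)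
     = (\<integral>\<^sup>+v. ennreal (\<beta> powr (\<alpha> - 1)) * ?g v \<partial>lborel)"
    using assms by (intro nn_integral_cong)
     (auto simp: indicator_def powr_mult exp_minus field_simps zero_le_mult_iff simp flip: ennreal_mult')
  also have "\<dots> = ennreal (\<beta> powr (\<alpha> - 1)) * (\<integral>\<^sup>+v. ?g v \<partial>lborel)"
    by (rule nn_integral_cmult) auto
  also have "ennreal \<bar>\<beta>\<bar> * (ennreal (\<beta> powr (\<alpha> - 1)) * (\<integral>\<^sup>+v. ?g v \<partial>lborel)) = ennreal (\<beta> powr \<alpha>) * (\<integral>\<^sup>+v. ?g v \<partial>lborel)"
    using assms by (simp add: powr_diff mult.assoc[symmetric] flip: ennreal_mult)
  finally have "ennreal (1 / \<beta> powr \<alpha>) * ennreal (Gamma \<alpha>) = ennreal (1 / \<beta> powr \<alpha>) * (ennreal (\<beta> powr \<alpha>) * (\<integral>\<^sup>+v. ?g v \<partial>lborel))"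
    by simp
  then show ?thesis using assms Gamma_real_pos[of \<alpha>]
    by (simp add: mult.assoc[symmetric] flip: ennreal_mult)
qed

lemma integral_powr_exp:
  assumes "\<alpha> > 0" "\<beta> > (0::real)"
  shows "integrable lborel (\<lambda>v. if v > 0 then v powr (\<alpha> - 1) * exp (- (\<beta> * v)) else 0)"
    and "(\<integral>v. gamma_kernel \<alpha> \<beta> v \<partial>lborel) = Gamma \<alpha> / \<beta> powr \<alpha>"
  using nn_integral_powr_exp[OF assms] Gamma_real_pos[OF assms(1)]
  by (auto intro!: integrableI_nonneg integral_eq_nn_integral simp: integral_eq_nn_integral)

text \<open>Integration by parts for v^\<alpha> exp (- (\<beta> - i t) v), whose derivative is the
  difference of the two integrands. It ties the derivative of the Fourier integral to the integral
  itself and so yields a first-order differential equation in t.\<close>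

lemma integral_powr_exp_parts:
  assumes "\<alpha> > 0" "\<beta> > (0::real)"
  shows "(of_real \<beta> - \<i> * of_real t) *
      (\<integral>v. iexp (t * v) * of_real (if v > 0 then v powr \<alpha> * exp (- (\<beta> * v)) else 0) \<partial>lborel)
     = of_real \<alpha> * (\<integral>v. iexp (t * v) * of_real (gamma_kernel \<alpha> \<beta> v) \<partial>lborel)"
    (is "?w * integral\<^sup>L _ ?J = _ * integral\<^sup>L _ ?I")
proof -
  have I: "integrable lborel ?I"
    by (rule Bochner_Integration.integrable_bound[OF integral_powr_exp(1)[OF assms]]) (auto simp: norm_mult)
  have J: "integrable lborel ?J"
    by (rule Bochner_Integration.integrable_bound[OF integral_powr_exp(1)[of "\<alpha>+1" \<beta>]]) (use assms in \<open>auto simp: norm_mult\<close>)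
  let ?F = "\<lambda>v. of_real (v powr \<alpha>) * exp (- (?w * of_real v))"
  let ?f = "\<lambda>v. of_real \<alpha> * ?I v - ?w * ?J v"
  have ex: "exp (- (?w * complex_of_real v)) = iexp (t * v) * of_real (exp (- (\<beta> * v)))" for v
  proof -
    have "- (?w * complex_of_real v) = \<i> * of_real (t * v) + of_real (- (\<beta> * v))"
      by (simp add: algebra_simps)
    then show ?thesis by (simp only: exp_add exp_of_real)
  qed
  have nF: "cmod (?F v) = v powr \<alpha> * exp (- (\<beta> * v))" for v
    unfolding ex by (simp add: norm_mult)
  \<comment> \<open>The primitive has modulus v^\<alpha> exp (- \<beta> v) and vanishes at both
    ends: at 0 because \<alpha> > 0, at infinity because \<beta> > 0.\<close>
  have "(LBINT x=0..\<infinity>. ?f x) = 0 - 0"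
  proof (rule interval_integral_FTC_integrable)
    fix x :: real assume "0 < ereal x" "ereal x < \<infinity>"
    then have x: "x > 0" by simp
    have "((\<lambda>v. exp (- (?w * of_real v))) has_vector_derivative (exp (- (?w * of_real x)) * (- ?w))) (at x)"
      by (rule has_vector_derivative_real_field) (auto intro!: derivative_eq_intros)
    moreover have "((\<lambda>v. complex_of_real (v powr \<alpha>)) has_vector_derivative of_real (\<alpha> * x powr (\<alpha> - 1))) (at x)"
      using x by (intro has_vector_derivative_of_real)
        (auto intro!: derivative_eq_intros simp: has_real_derivative_iff_has_vector_derivative[symmetric] powr_diff)
    ultimately have "(?F has_vector_derivative (of_real (x powr \<alpha>) * (exp (- (?w * of_real x)) * (- ?w))
        + of_real (\<alpha> * x powr (\<alpha> - 1)) * exp (- (?w * of_real x)))) (at x)"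
      by (rule has_vector_derivative_mult[rotated])
    then show "(?F has_vector_derivative ?f x) (at x)"
      unfolding ex using x by (simp add: algebra_simps)
    show "isCont ?f x"
    proof (rule isCont_cong[THEN iffD2])
      show "\<forall>\<^sub>F y in nhds x. ?f y = of_real \<alpha> * (iexp (t * y) * of_real (y powr (\<alpha> - 1) * exp (- (\<beta> * y))))
         - ?w * (iexp (t * y) * of_real (y powr \<alpha> * exp (- (\<beta> * y))))"
        using eventually_nhds_in_open[of "{0<..}" x] x by (auto elim!: eventually_mono)
      show "isCont (\<lambda>y. of_real \<alpha> * (iexp (t * y) * of_real (y powr (\<alpha> - 1) * exp (- (\<beta> * y))))
         - ?w * (iexp (t * y) * of_real (y powr \<alpha> * exp (- (\<beta> * y))))) x"
        using x by (intro continuous_intros) auto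
    qed
  next
    show "set_integrable lborel (einterval 0 \<infinity>) ?f"
      unfolding set_integrable_def using I J by (intro integrable_mult_indicator) auto
    show "((?F \<circ> real_of_ereal) \<longlongrightarrow> 0) (at_right 0)"
    proof -
      have "((\<lambda>x. x powr \<alpha>) \<longlongrightarrow> 0 powr \<alpha>) (at_right 0)"
        using assms by (intro tendsto_powr2) (auto intro: tendsto_ident_at eventually_at_right_less[THEN eventually_mono])
      then have "((\<lambda>x. x powr \<alpha> * exp (- (\<beta> * x))) \<longlongrightarrow> 0 * exp (- (\<beta> * 0))) (at_right 0)"
        by (intro tendsto_intros) (use assms in auto)
      then have "((\<lambda>v. cmod (?F v)) \<longlongrightarrow> 0) (at_right 0)"
        by (simp only: nF mult_zero_left)
      then have "(?F \<longlongrightarrow> 0) (at_right 0)"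
        by (rule tendsto_norm_zero_cancel)
      then show ?thesis
        unfolding zero_ereal_def by (simp add: ereal_tendsto_simps)
    qed
    show "((?F \<circ> real_of_ereal) \<longlongrightarrow> 0) (at_left \<infinity>)"
    proof -
      have "((\<lambda>x. x powr \<alpha> * exp (- (\<beta> * x))) \<longlongrightarrow> 0) at_top"
        using assms by real_asymp
      then have "((\<lambda>v. cmod (?F v)) \<longlongrightarrow> 0) at_top"
        by (simp only: nF)
      then have "(?F \<longlongrightarrow> 0) at_top"
        by (rule tendsto_norm_zero_cancel)
      then show ?thesis by (simp add: ereal_tendsto_simps)
    qed
  qed auto
  then have "(\<integral>x. indicator {0<..} x *\<^sub>R ?f x \<partial>lborel) = 0"
    by (simp add: interval_lebesgue_integral_def set_lebesgue_integral_def einterval_def zero_ereal_def greaterThan_def)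
  also have "(\<integral>x. indicator {0<..} x *\<^sub>R ?f x \<partial>lborel) = (\<integral>x. ?f x \<partial>lborel)"
    by (intro Bochner_Integration.integral_cong) (auto simp: indicator_def)
  also have "\<dots> = of_real \<alpha> * integral\<^sup>L lborel ?I - ?w * integral\<^sup>L lborel ?J"
    using I J by simp
  finally show ?thesis by simp
qed

text \<open>A differential equation replaces a contour shift: I' = i J and (\<beta> - i t) J =
  \<alpha> I, so the product of I with the integrating factor exp (\<alpha> Ln (1 - i t / \<beta>))
  is constant. Its value at t = 0 is the real gamma integral.\<close>

lemma integral_iexp_powr_exp:
  assumes a: "\<alpha> > 0" and b: "\<beta> > (0::real)"
  shows "(\<integral>v. iexp (t * v) * of_real (gamma_kernel \<alpha> \<beta> v) \<partial>lborel)
     = of_real (Gamma \<alpha> / \<beta> powr \<alpha>) * exp (- of_real \<alpha> * Ln_ii (t / \<beta>))"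
proof -
  define g where "g = (\<lambda>v. if v > 0 then v powr (\<alpha> - 1) * exp (- (\<beta> * v)) else 0)"
  define I where "I t = (\<integral>v. iexp (t * v) * complex_of_real (g v) \<partial>lborel)" for t
  define J where "J t = (\<integral>v. iexp (t * v) * complex_of_real (if v > 0 then v powr \<alpha> * exp (- (\<beta> * v)) else 0) \<partial>lborel)" for t
  have g[measurable]: "g \<in> borel_measurable borel" unfolding g_def by measurable
  have ig: "integrable lborel g" using integral_powr_exp(1)[OF a b] by (simp add: g_def)
  have vg: "v * g v = gamma_kernel (\<alpha> + 1) \<beta> v" for v
    by (auto simp: g_def powr_diff)
  have vvg: "v\<^sup>2 * g v = gamma_kernel (\<alpha> + 2) \<beta> v" for v
    by (auto simp: g_def powr_diff powr_add power2_eq_square)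
  have ivg: "integrable lborel (\<lambda>v. v * g v)" "integrable lborel (\<lambda>v. v\<^sup>2 * g v)"
    unfolding vg vvg using a b by (intro integral_powr_exp(1); simp)+
  have I_eq: "I = (\<lambda>t. (\<integral>v. (iexp (t * v) - 1) * complex_of_real (g v) \<partial>lborel) + of_real (integral\<^sup>L lborel g))"
  proof
    fix t
    have "integrable lborel (\<lambda>v. iexp (t * v) * complex_of_real (g v))"
      by (rule Bochner_Integration.integrable_bound[OF ig]) (auto simp: norm_mult)
    then show "I t = (\<integral>v. (iexp (t * v) - 1) * complex_of_real (g v) \<partial>lborel) + of_real (integral\<^sup>L lborel g)"
      using ig by (simp add: I_def left_diff_distrib)
  qed
  have dI: "(I has_vector_derivative \<i> * J t) (at t within A)" for t A
  proof -
    have 1: "(I has_vector_derivative ((\<integral>v. \<i> * iexp (t * v) * of_real (v * g v) \<partial>lborel) + 0)) (at t)"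
      unfolding I_eq by (intro has_vector_derivative_add has_vector_derivative_exp_minus_one_integral g ivg has_vector_derivative_const)
    have 2: "(\<integral>v. \<i> * iexp (t * v) * of_real (v * g v) \<partial>lborel) + 0 = \<i> * J t"
      unfolding vg J_def by (simp add: mult.assoc cong: if_cong)
    show ?thesis using 1 unfolding 2 by (rule has_vector_derivative_at_within)
  qed
  have w: "(of_real \<beta> - \<i> * of_real t) * J t = of_real \<alpha> * I t" for t
    using integral_powr_exp_parts[OF a b] by (simp add: J_def I_def g_def)
  have nz: "1 - \<i> * complex_of_real t \<noteq> 0" for t using cmod_one_minus_ii_ge_1[of t] by auto
  define h where "h t = I t * exp (of_real \<alpha> * Ln_ii (t / \<beta>))" for t
  have "(h has_vector_derivative 0) (at t within UNIV)" for t
  proof -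
    let ?L = "\<lambda>t. Ln_ii (t / \<beta>)"
    have dL: "(?L has_vector_derivative (1 / \<beta>) *\<^sub>R (- \<i> / (1 - \<i> * of_real (t / \<beta>)))) (at t)"
      using b by (intro has_vector_derivative_Ln_ii_divide) auto
    have "((\<lambda>t. exp (of_real \<alpha> * ?L t)) has_vector_derivative
        (of_real \<alpha> * ((1 / \<beta>) *\<^sub>R (- \<i> / (1 - \<i> * of_real (t / \<beta>))))) * exp (of_real \<alpha> * ?L t)) (at t)"
      using field_vector_diff_chain_at[OF has_vector_derivative_mult_right[OF dL, of "of_real \<alpha>"] DERIV_exp]
      by (simp add: o_def)
    then have "(h has_vector_derivative (I t * ((of_real \<alpha> * ((1 / \<beta>) *\<^sub>R (- \<i> / (1 - \<i> * of_real (t / \<beta>))))) * exp (of_real \<alpha> * ?L t))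
       + (\<i> * J t) * exp (of_real \<alpha> * ?L t))) (at t)"
      unfolding h_def by (intro has_vector_derivative_mult dI)
    moreover have "of_real \<alpha> * ((1 / \<beta>) *\<^sub>R (- \<i> / (1 - \<i> * of_real (t / \<beta>)))) * I t + \<i> * J t = 0"
    proof -
      define w' where "w' = 1 - \<i> * complex_of_real (t / \<beta>)"
      have "complex_of_real \<beta> - \<i> * of_real t = of_real \<beta> * w'"
        using b by (simp add: w'_def field_simps)
      with w[of t] have "of_real \<alpha> * I t = of_real \<beta> * w' * J t" by simp
      moreover have "of_real \<alpha> * ((1 / \<beta>) *\<^sub>R (- \<i> / w')) * I t = (of_real \<alpha> * I t) * (- \<i> / (of_real \<beta> * w'))"
        by (simp add: scaleR_conv_of_real)
      moreover have "w' \<noteq> 0" using nz[of "t / \<beta>"] by (simp only: w'_def not_False_eq_True)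
      ultimately show ?thesis using b unfolding w'_def[symmetric] by simp
    qed
    moreover have "a * (E * e) + b * e = (E * a + b) * e" for a b E e :: complex
      by (simp add: algebra_simps)
    ultimately show ?thesis by (simp only: mult_zero_left)
  qed
  then have "h t = h 0"
    using has_vector_derivative_zero_constant[of UNIV h] by (metis UNIV_I convex_UNIV)
  moreover have "h 0 = of_real (Gamma \<alpha> / \<beta> powr \<alpha>)"
    using integral_powr_exp(2)[OF a b] by (simp add: h_def I_def g_def)
  moreover have "I t = h t * exp (- of_real \<alpha> * Ln_ii (t / \<beta>))"
    by (simp add: h_def mult.assoc flip: exp_add)
  ultimately show ?thesis by (simp add: I_def g_def)
qed

text \<open>Differentiating in t cancels the 1 / r and leaves the gamma integral of shape 1, namely
  i / (s - i t). This is also the derivative of - Ln (1 - i t / s), and both sides vanish at t =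
  0.\<close>

lemma integral_exp_minus_one_div:
  assumes s: "s > (0::real)"
  shows "(\<integral>r. (iexp (t * r) - 1) * of_real (if r > 0 then exp (- (s * r)) / r else 0) \<partial>lborel)
     = - Ln_ii (t / s)"
proof -
  define g where "g = (\<lambda>r::real. if r > 0 then exp (- (s * r)) / r else 0)"
  define F where "F t = (\<integral>r. (iexp (t * r) - 1) * complex_of_real (g r) \<partial>lborel)" for t
  have g[measurable]: "g \<in> borel_measurable borel" unfolding g_def by measurable
  have vg: "v * g v = gamma_kernel 1 s v" for v
    by (auto simp: g_def)
  have vvg: "v\<^sup>2 * g v = gamma_kernel 2 s v" for v
    by (auto simp: g_def power2_eq_square)
  have ivg: "integrable lborel (\<lambda>v. v * g v)" "integrable lborel (\<lambda>v. v\<^sup>2 * g v)"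
    unfolding vg vvg using s by (intro integral_powr_exp(1); simp)+
  have nz: "1 - \<i> * complex_of_real t \<noteq> 0" for t using cmod_one_minus_ii_ge_1[of t] by auto
  have dF: "(F has_vector_derivative (\<i> / of_real s / (1 - \<i> * of_real (t / s)))) (at t)" for t
  proof -
    have 1: "(F has_vector_derivative (\<integral>v. \<i> * iexp (t * v) * of_real (v * g v) \<partial>lborel)) (at t)"
      unfolding F_def by (intro has_vector_derivative_exp_minus_one_integral g ivg)
    have 2: "(\<integral>v. \<i> * iexp (t * v) * of_real (v * g v) \<partial>lborel)
       = \<i> * (of_real (Gamma 1 / s powr 1) * exp (- of_real 1 * Ln_ii (t / s)))"
      unfolding vg mult.assoc
      by (subst integral_iexp_powr_exp[OF zero_less_one s, symmetric]) (simp only: Bochner_Integration.integral_mult_right_zero)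
    have 3: "\<i> * (of_real (Gamma 1 / s powr 1) * exp (- of_real 1 * Ln_ii (t / s)))
       = \<i> / of_real s / (1 - \<i> * of_real (t / s))"
      using s nz[of "t/s"] by (simp add: exp_minus field_simps)
    show ?thesis using 1 unfolding 2 3 .
  qed
  define h where "h t = F t + Ln_ii (t / s)" for t
  have "(h has_vector_derivative 0) (at t within UNIV)" for t
  proof -
    from has_vector_derivative_add[OF dF has_vector_derivative_Ln_ii_divide[of s]] s show ?thesis
      unfolding h_def by (simp add: scaleR_conv_of_real)
  qed
  then have "h t = h 0"
    using has_vector_derivative_zero_constant[of UNIV h] by (metis UNIV_I convex_UNIV)
  also have "h 0 = 0" by (simp add: h_def F_def)
  finally show ?thesis by (simp add: h_def F_def g_def add_eq_0_iff)
qed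

section \<open>Truncated Levy mass of a single ray\<close>

definition levy_radial_integral :: "real \<Rightarrow> ennreal" where
  "levy_radial_integral s =
     (\<integral>\<^sup>+r. ennreal (if r > 0 then min (r\<^sup>2) 1 * (exp (- (s * r)) / r) else 0) \<partial>lborel)"

text \<open>The size, up to constants, of \<open>levy_radial_integral\<close>, which is what a unit
  mass of the Thorin measure at distance s contributes to the Levy condition. The summand 1 keeps
  the bound away from 0 as s approaches 1 from below.\<close>

definition radial_bound :: "real \<Rightarrow> real" where
  "radial_bound s = (if s < 1 then 1 - ln s else 1 / s\<^sup>2)"

lemma radial_bound_pos: "s > 0 \<Longrightarrow> radial_bound s > 0"
  using ln_bound[of s] by (auto simp: radial_bound_def)

lemma radial_bound_measurable[measurable]: "radial_bound \<in> borel_measurable borel"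
  unfolding radial_bound_def[abs_def] by measurable

lemma levy_radial_integral_measurable[measurable]: "levy_radial_integral \<in> borel_measurable borel"
  unfolding levy_radial_integral_def[abs_def] by measurable

lemma nn_integral_id_Icc:
  assumes "0 \<le> b" shows "(\<integral>\<^sup>+r. ennreal r * indicator {0..b} r \<partial>lborel) = ennreal (b\<^sup>2 / 2)"
proof -
  have "(\<integral>\<^sup>+r. ennreal r * indicator {0..b} r \<partial>lborel) = ennreal (b\<^sup>2 / 2 - 0\<^sup>2 / 2)"
    using assms by (intro nn_integral_FTC_Icc[where F="\<lambda>x. x\<^sup>2 / 2"]) (auto intro!: derivative_eq_intros)
  then show ?thesis by simp
qed

lemma nn_integral_inverse_Icc:
  assumes "1 \<le> b" shows "(\<integral>\<^sup>+r. ennreal (1 / r) * indicator {1..b} r \<partial>lborel) = ennreal (ln b)"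
proof -
  have "(\<integral>\<^sup>+r. ennreal (1 / r) * indicator {1..b} r \<partial>lborel) = ennreal (ln b - ln 1)"
    using assms by (intro nn_integral_FTC_Icc[where F="\<lambda>x. ln x"]) (auto intro!: derivative_eq_intros)
  then show ?thesis by simp
qed

text \<open>For r <= 1 / s the exponential is at least exp (- 1). What remains is r on [0, 1] and 1
  / r on [1, 1 / s] if s < 1, giving 1 / 2 - ln s, and r on [0, 1 / s] otherwise, giving 1 / (2
  s^2).\<close>

lemma levy_radial_integral_ge:
  assumes s: "s > 0"
  shows "ennreal (exp (-1) / 2 * radial_bound s) \<le> levy_radial_integral s"
proof (cases "s < 1")
  case True
  have "ennreal (exp (-1) / 2 * radial_bound s) \<le> ennreal (exp (-1)) * (ennreal (1\<^sup>2 / 2) + ennreal (ln (1 / s)))"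
  proof -
    have le: "exp (-1) / 2 * radial_bound s \<le> exp (-1) * (1\<^sup>2 / 2 + ln (1 / s))"
      using True s ln_less_zero[of s] mult_right_mono[of "1 - ln s" "1 - 2 * ln s" "exp (-1) / 2"]
      by (simp add: radial_bound_def ln_div algebra_simps)
    moreover have "0 \<le> ln (1 / s)" "0 \<le> (1::real)\<^sup>2 / 2" using True s by auto
    moreover from this have "0 \<le> 1\<^sup>2 / 2 + ln (1 / s)" by linarith
    ultimately have "ennreal (exp (-1)) * (ennreal (1\<^sup>2 / 2) + ennreal (ln (1 / s)))
       = ennreal (exp (-1) * (1\<^sup>2 / 2 + ln (1 / s)))"
      by (simp only: ennreal_mult' ennreal_plus exp_ge_zero)
    then show ?thesis using le by (simp only: ennreal_leI)
  qed
  also have "\<dots> = (\<integral>\<^sup>+r. ennreal (exp (-1)) * (ennreal r * indicator {0..1} r + ennreal (1 / r) * indicator {1..1/s} r) \<partial>lborel)"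
    using True s by (simp add: nn_integral_cmult nn_integral_add nn_integral_id_Icc[of 1, simplified] nn_integral_inverse_Icc)
  also have "\<dots> \<le> levy_radial_integral s"
    unfolding levy_radial_integral_def
  proof (rule nn_integral_mono_AE)
    \<comment> \<open>Both indicators are 1 at r = 1, where their sum may exceed the integrand; this
      single point is discarded.\<close>
    have "AE r in lborel. r \<noteq> (1::real)" by (rule AE_lborel_singleton)
    then show "AE r in lborel. ennreal (exp (-1)) * (ennreal r * indicator {0..1} r + ennreal (1 / r) * indicator {1..1/s} r)
       \<le> ennreal (if 0 < r then min (r\<^sup>2) 1 * (exp (- (s * r)) / r) else 0)"
    proof eventually_elim
      fix r :: real assume "r \<noteq> 1"
      then consider "r \<le> 0" | "0 < r" "r < 1" | "1 < r" "r \<le> 1/s" | "1 < r" "r > 1/s" by linarith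
      then show "ennreal (exp (-1)) * (ennreal r * indicator {0..1} r + ennreal (1 / r) * indicator {1..1/s} r)
       \<le> ennreal (if 0 < r then min (r\<^sup>2) 1 * (exp (- (s * r)) / r) else 0)"
      proof cases
        case 1
        then have "ennreal r = 0" by (simp add: ennreal_neg)
        then show ?thesis using 1 by simp
      next
        case 2
        have "s * r \<le> 1 * 1" using 2 True s by (intro mult_mono) auto
        then have "r * exp (-1) \<le> r * exp (- (s * r))" using 2 by (intro mult_left_mono) auto
        moreover have "min (r\<^sup>2) 1 = r * r" using 2 by (simp add: power2_eq_square mult_le_one)
        ultimately show ?thesis using 2 by (simp add: mult.commute flip: ennreal_mult)
      next
        case 3
        have "s * r \<le> 1" using 3 s by (simp add: field_simps)
        then have "exp (-1) / r \<le> exp (- (s * r)) / r" using 3 by (intro divide_right_mono) auto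
        moreover have "min (r\<^sup>2) 1 = 1" using 3 one_le_power[of r 2] by (intro min_absorb2) auto
        ultimately show ?thesis using 3 by (simp flip: ennreal_mult)
      qed simp
    qed
  qed
  finally show ?thesis .
next
  case False
  have "ennreal (exp (-1) / 2 * radial_bound s) = ennreal (exp (-1)) * ennreal ((1/s)\<^sup>2 / 2)"
    using False by (simp add: radial_bound_def power_divide flip: ennreal_mult)
  also have "\<dots> = (\<integral>\<^sup>+r. ennreal (exp (-1)) * (ennreal r * indicator {0..1/s} r) \<partial>lborel)"
    using s by (simp add: nn_integral_cmult nn_integral_id_Icc)
  also have "\<dots> \<le> levy_radial_integral s"
    unfolding levy_radial_integral_def
  proof (rule nn_integral_mono)
    fix r :: real
    consider "r \<le> 0" | "0 < r" "r \<le> 1/s" | "r > 0" "r > 1/s" by linarith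
    then show "ennreal (exp (-1)) * (ennreal r * indicator {0..1/s} r)
       \<le> ennreal (if 0 < r then min (r\<^sup>2) 1 * (exp (- (s * r)) / r) else 0)"
    proof cases
      case 1
      then have "ennreal r = 0" by (simp add: ennreal_neg)
      then show ?thesis by simp
    next
      case 2
      have "s * r \<le> 1" using 2 s by (simp add: field_simps)
      then have "r * exp (-1) \<le> r * exp (- (s * r))" using 2 by (intro mult_left_mono) auto
      moreover have "r \<le> 1" 
      proof -
        have "1 / s \<le> 1" using False s by simp
        then show ?thesis using 2 by linarith
      qed
      then have "min (r\<^sup>2) 1 = r * r" using 2 by (simp add: power2_eq_square mult_le_one)
      ultimately show ?thesis using 2 by (simp add: mult.commute flip: ennreal_mult)
    qed simp
  qed
  finally show ?thesis .
qed

text \<open>For s < 1 the exponential matters only beyond 1 / s, where 1 / r <= s bounds the tail by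
  s times the integral of exp (- s r), that is by 1; the three ranges add up to 3 / 2 - ln s. For s
  >= 1 the truncation is dropped and the integral of r exp (- s r) is 1 / s^2.\<close>

lemma levy_radial_integral_le:
  assumes s: "s > 0"
  shows "levy_radial_integral s \<le> ennreal (2 * radial_bound s)"
proof (cases "s < 1")
  case True
  define e where "e = (\<lambda>r. ennreal (gamma_kernel 1 s r))"
  have [measurable]: "e \<in> borel_measurable borel" unfolding e_def by measurable
  have int_e: "(\<integral>\<^sup>+r. e r \<partial>lborel) = ennreal (1 / s)"
    unfolding e_def using s by (subst nn_integral_powr_exp) auto
  have "levy_radial_integral s \<le> (\<integral>\<^sup>+r. ennreal r * indicator {0..1} r + ennreal (1 / r) * indicator {1..1/s} r + ennreal s * e r \<partial>lborel)"
    unfolding levy_radial_integral_def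
  proof (rule nn_integral_mono)
    fix r :: real
    consider "r \<le> 0" | "0 < r" "r \<le> 1" | "1 < r" "r \<le> 1/s" | "1 < r" "r > 1/s" by linarith
    then show "ennreal (if 0 < r then min (r\<^sup>2) 1 * (exp (- (s * r)) / r) else 0)
      \<le> ennreal r * indicator {0..1} r + ennreal (1 / r) * indicator {1..1/s} r + ennreal s * e r"
    proof cases
      case 2
      have "min (r\<^sup>2) 1 * (exp (- (s * r)) / r) \<le> r * r * (1 / r)"
        using 2 s by (intro mult_mono divide_right_mono) (auto simp: power2_eq_square)
      then have "ennreal (min (r\<^sup>2) 1 * (exp (- (s * r)) / r)) \<le> ennreal r" using 2 by (auto intro: ennreal_leI)
      then show ?thesis using 2 by (auto intro!: add_increasing2)
    next
      case 3
      have "min (r\<^sup>2) 1 * (exp (- (s * r)) / r) \<le> 1 * (1 / r)"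
        using 3 s by (intro mult_mono divide_right_mono) auto
      then have "ennreal (min (r\<^sup>2) 1 * (exp (- (s * r)) / r)) \<le> ennreal (1 / r)" using 3 by (auto intro: ennreal_leI)
      then show ?thesis using 3 by (auto intro!: add_increasing2)
    next
      case 4
      have "1 / r \<le> s" using 4 s by (simp add: field_simps)
      then have "min (r\<^sup>2) 1 * (exp (- (s * r)) * (1 / r)) \<le> 1 * (exp (- (s * r)) * s)"
        using 4 s by (intro mult_mono mult_left_mono) auto
      then have "ennreal (min (r\<^sup>2) 1 * (exp (- (s * r)) / r)) \<le> ennreal (s * exp (- (s * r)))"
        by (intro ennreal_leI) (simp add: mult.commute)
      then show ?thesis using 4 s by (simp add: e_def flip: ennreal_mult)
    qed simp
  qed
  also have "\<dots> = ennreal (1\<^sup>2 / 2) + ennreal (ln (1 / s)) + ennreal s * ennreal (1 / s)"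
    using True s by (simp add: nn_integral_cmult nn_integral_add nn_integral_id_Icc[of 1, simplified] nn_integral_inverse_Icc int_e)
  also have "\<dots> = ennreal (1 / 2 + ln (1 / s) + 1)"
  proof -
    have "0 \<le> ln (1 / s)" "0 \<le> (1::real)\<^sup>2 / 2" "ennreal s * ennreal (1 / s) = ennreal 1"
      using True s by (auto simp flip: ennreal_mult)
    moreover from this have "0 \<le> 1\<^sup>2 / 2 + ln (1 / s)" by linarith
    ultimately show ?thesis by (simp only: ennreal_plus[symmetric] power_one zero_le_one)
  qed
  also have "\<dots> \<le> ennreal (2 * radial_bound s)"
    using True s ln_bound[of s] ln_le_minus_one[of s] by (intro ennreal_leI) (simp add: radial_bound_def ln_div)
  finally show ?thesis .
next
  case False
  have G2: "Gamma 2 = (1::real)" using Gamma_fact[of 1, where 'a=real] by simp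
  have "levy_radial_integral s \<le> (\<integral>\<^sup>+r. ennreal (gamma_kernel 2 s r) \<partial>lborel)"
    unfolding levy_radial_integral_def
  proof (rule nn_integral_mono)
    fix r :: real
    have "min (r\<^sup>2) 1 * (exp (- (s * r)) / r) \<le> r * r * (exp (- (s * r)) / r)" if "r > 0"
      using that by (intro mult_right_mono) (auto simp: power2_eq_square)
    then show "ennreal (if 0 < r then min (r\<^sup>2) 1 * (exp (- (s * r)) / r) else 0)
      \<le> ennreal (gamma_kernel 2 s r)"
      by (auto intro!: ennreal_leI)
  qed
  also have "\<dots> = ennreal (1 / s\<^sup>2)"
    using s by (subst nn_integral_powr_exp) (auto simp: G2)
  also have "\<dots> \<le> ennreal (2 * radial_bound s)"
    using False by (intro ennreal_leI) (simp add: radial_bound_def divide_right_mono)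
  finally show ?thesis .
qed

lemma integral_exp_Ioc:
  assumes s: "s > (0::real)"
  shows "integrable lborel (\<lambda>r. if 0 < r \<and> r \<le> 1 then exp (- (s * r)) else 0)"
    and "(\<integral>r. (if 0 < r \<and> r \<le> 1 then exp (- (s * r)) else 0) \<partial>lborel) = (1 - exp (- s)) / s"
proof -
  have "has_bochner_integral lborel (\<lambda>r. indicator {0..1} r *\<^sub>R exp (- (s * r))) (- exp (- (s * 1)) / s - (- exp (- (s * 0)) / s))"
    using s by (intro has_bochner_integral_FTC_Icc[where F="\<lambda>r. - exp (- (s * r)) / s"])
      (auto intro!: derivative_eq_intros continuous_intros simp: has_real_derivative_iff_has_vector_derivative[symmetric])
  then have 1: "has_bochner_integral lborel (\<lambda>r. indicator {0..1} r *\<^sub>R exp (- (s * r))) ((1 - exp (- s)) / s)"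
    by (simp add: diff_divide_distrib mult.commute)
  have "has_bochner_integral lborel (\<lambda>r. if 0 < r \<and> r \<le> 1 then exp (- (s * r)) else 0) ((1 - exp (- s)) / s)"
  proof (rule has_bochner_integral_cong_AE[THEN iffD1, OF _ _ _ 1])
    have "AE r in lborel. r \<noteq> (0::real)" by (rule AE_lborel_singleton)
    then show "AE r in lborel. indicator {0..1} r *\<^sub>R exp (- (s * r)) = (if 0 < r \<and> r \<le> 1 then exp (- (s * r)) else 0)"
      by eventually_elim (auto simp: indicator_def)
  qed auto
  from has_bochner_integral_iff[THEN iffD1, OF this] show "integrable lborel (\<lambda>r. if 0 < r \<and> r \<le> 1 then exp (- (s * r)) else 0)"
     "(\<integral>r. (if 0 < r \<and> r \<le> 1 then exp (- (s * r)) else 0) \<partial>lborel) = (1 - exp (- s)) / s" by auto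
qed

lemma integral_compensated_exp:
  assumes s: "s > (0::real)"
  shows "(\<integral>r. (iexp (c * r) - 1 - \<i> * of_real (c * r * indicator {..1} r))
      * of_real (if r > 0 then exp (- (s * r)) / r else 0) \<partial>lborel)
    = - Ln_ii (c / s) - \<i> * of_real (c * (1 - exp (- s)) / s)"
proof -
  let ?g = "\<lambda>r. if r > 0 then exp (- (s * r)) / r else 0"
  let ?h = "\<lambda>r. if 0 < r \<and> r \<le> 1 then exp (- (s * r)) else 0"
  have "(\<lambda>r. r * ?g r) = (\<lambda>r. if r > 0 then r powr (1 - 1) * exp (- (s * r)) else 0)"
    by auto
  then have "integrable lborel (\<lambda>r. r * ?g r)"
    using integral_powr_exp(1)[OF zero_less_one s] by simp
  then have 1: "integrable lborel (\<lambda>r. (iexp (c * r) - 1) * of_real (?g r))"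
    by (intro integrable_exp_minus_one_mult) auto
  have 2: "integrable lborel (\<lambda>r. \<i> * of_real c * of_real (?h r))"
    using integral_exp_Ioc(1)[OF s] by (intro integrable_mult_right integrable_of_real)
  have "(\<lambda>r. (iexp (c * r) - 1 - \<i> * of_real (c * r * indicator {..1} r)) * of_real (?g r))
     = (\<lambda>r. (iexp (c * r) - 1) * of_real (?g r) - \<i> * of_real c * of_real (?h r))"
    by (auto simp: fun_eq_iff algebra_simps)
  then have "(\<integral>r. (iexp (c * r) - 1 - \<i> * of_real (c * r * indicator {..1} r)) * of_real (?g r) \<partial>lborel)
    = (\<integral>r. (iexp (c * r) - 1) * of_real (?g r) \<partial>lborel) - (\<integral>r. \<i> * of_real c * of_real (?h r) \<partial>lborel)"
    using 1 2 by (simp only: Bochner_Integration.integral_diff)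
  also have "(\<integral>r. \<i> * of_real c * of_real (?h r) \<partial>lborel) = \<i> * of_real (c * (1 - exp (- s)) / s)"
    using integral_exp_Ioc(2)[OF s]
    by (simp only: Bochner_Integration.integral_mult_right_zero integral_complex_of_real) simp
  finally show ?thesis
    using integral_exp_minus_one_div[OF s, of c] by (simp only:)
qed

text \<open>For r <= 1 this is a second-order Taylor remainder; for r > 1 the compensator is absent
  and the modulus is at most 2. Since c enters through R alone, the bound is uniform over all
  directions once R is the norm of z.\<close>

lemma cmod_compensated_exp_le:
  assumes "\<bar>c\<bar> \<le> R" "r > 0"
  shows "cmod (iexp (c * r) - 1 - \<i> * of_real (c * r * indicator {..1} r)) \<le> (R\<^sup>2 + 2) * min (r\<^sup>2) 1"
proof (cases "r \<le> 1")
  case True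
  have "cmod (iexp (c * r) - 1 - \<i> * of_real (c * r)) \<le> (c * r)\<^sup>2 / 2"
    using iexp_approx1[of "c * r" 1] by (simp add: numeral_2_eq_2 diff_diff_add)
  also have "\<dots> \<le> R\<^sup>2 * r\<^sup>2"
  proof -
    have "c\<^sup>2 \<le> R\<^sup>2" using power_mono[OF assms(1) abs_ge_zero, of 2] by (simp only: power2_abs)
    then have "c\<^sup>2 / 2 \<le> R\<^sup>2" using zero_le_power2[of c] by linarith
    from mult_right_mono[OF this, of "r\<^sup>2"] show ?thesis by (simp add: power_mult_distrib)
  qed
  also have "\<dots> \<le> (R\<^sup>2 + 2) * r\<^sup>2" by (simp add: distrib_right)
  finally show ?thesis using True assms by (simp add: min_absorb1 power_le_one)
next
  case False
  have "cmod (iexp (c * r) - 1) \<le> 2"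
    using norm_triangle_ineq4[of "iexp (c * r)" 1] by simp
  moreover have "min (r\<^sup>2) 1 = 1" using False one_le_power[of r 2] by (intro min_absorb2) auto
  ultimately show ?thesis using False by (simp add: add_increasing)
qed

section \<open>Domination of the integrands by the radial bound\<close>

lemma thorin_weight_le_radial_bound:
  "x \<noteq> 0 \<Longrightarrow> thorin_weight x \<le> ennreal (radial_bound (norm x))"
  by (auto simp: thorin_weight_def radial_bound_def min_le_iff_disj intro!: ennreal_leI)

text \<open>On the shell between 1/2 and 2 the weight degenerates, as the logarithm vanishes on the
  unit sphere, and the indicator takes over. Outside the shell ln 2 >= 1/2 gives |ln s| >= 1/2: for
  small s the minimum is |ln s| and 1 - ln s <= 3 |ln s|, for large s the minimum is 1 /
  s^2.\<close>

lemma radial_bound_le_thorin_weight: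
  assumes "x \<noteq> 0"
  shows "ennreal (radial_bound (norm x)) \<le> 3 * (thorin_weight x + indicator {x. norm x \<in> {1/2..2}} x)"
proof -
  define s where "s = norm x"
  have s: "s > 0" using assms by (simp add: s_def)
  have ln2: "1 / 2 \<le> ln (2::real)" using ln2_ge_two_thirds by simp
  consider "s < 1/2" | "1/2 \<le> s" "s \<le> 2" | "s > 2" by linarith
  then have "radial_bound s \<le> 3 * (min \<bar>ln s\<bar> (1 / s\<^sup>2) + indicator {1/2..2} s)"
  proof cases
    case 1
    have "ln s \<le> ln (1/2)" using 1 s by (subst ln_le_cancel_iff) auto
    then have l: "ln s \<le> - 1 / 2" using ln2 by (simp add: ln_div)
    have "ln (1 / s) \<le> 1 / s - 1" using s by (intro ln_le_minus_one) auto
    then have "\<bar>ln s\<bar> \<le> 1 / s" using l s by (simp add: ln_div)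
    also have "\<dots> \<le> 1 / s\<^sup>2" using 1 s by (simp add: field_simps power2_eq_square)
    finally show ?thesis using 1 l by (simp add: radial_bound_def)
  next
    case 2
    have "ln (1/2) \<le> ln s" using 2 s by (subst ln_le_cancel_iff) auto
    then have "- ln s \<le> 1" using ln_2_less_1 by (simp add: ln_div)
    moreover have "1 / s\<^sup>2 \<le> 1" if "s \<ge> 1" using one_le_power[OF that, of 2] that by (simp add: divide_le_eq)
    ultimately have "radial_bound s \<le> 3" by (cases "s < 1") (auto simp: radial_bound_def not_less intro: order_trans[of _ 1])
    then show ?thesis using 2 by (simp add: add_increasing)
  next
    case 3
    have "ln 2 \<le> ln s" using 3 s by (subst ln_le_cancel_iff) auto
    then have "1 / 2 \<le> ln s" using ln2 by linarith
    moreover have "1 / s\<^sup>2 \<le> 1 / 2" using 3 power_mono[of 2 s 2] by (intro divide_left_mono) auto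
    ultimately have "min \<bar>ln s\<bar> (1 / s\<^sup>2) = 1 / s\<^sup>2" by linarith
    then show ?thesis using 3 s by (simp add: radial_bound_def divide_right_mono)
  qed
  then have "ennreal (radial_bound s) \<le> ennreal (3 * (min \<bar>ln s\<bar> (1 / s\<^sup>2) + indicator {1/2..2} s))"
    by (rule ennreal_leI)
  also have "\<dots> = 3 * (ennreal (min \<bar>ln s\<bar> (1 / s\<^sup>2)) + ennreal (indicator {1/2..2} s))"
    by (simp add: ennreal_mult ennreal_plus)
  also have "\<dots> = 3 * (thorin_weight x + indicator {x. norm x \<in> {1/2..2}} x)"
    using assms by (simp add: thorin_weight_def s_def indicator_def)
  finally show ?thesis by (simp add: s_def)
qed

text \<open>Inside the unit ball there is no compensator and the logarithmic bound applies with |t|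
  <= R / |x|; with pi < 4 it gives R + 4 - ln |x|, which explains the constant. Outside, the
  compensated logarithm is at most t^2. Uniformity in z over a ball is what the approximation of
  exponents requires.\<close>

lemma cmod_thorin_integrand_le:
  assumes x: "x \<noteq> 0" and z: "norm z \<le> R"
  shows "cmod (thorin_integrand z x) \<le> (R\<^sup>2 + R + 5) * radial_bound (norm x)"
proof -
  define t where "t = (z \<bullet> x) / (norm x)\<^sup>2"
  have s: "norm x > 0" and R: "R \<ge> 0" using x z norm_ge_zero[of z] by (auto simp del: norm_ge_zero)
  have "\<bar>z \<bullet> x\<bar> \<le> R * norm x"
    using Cauchy_Schwarz_ineq2[of z x] mult_right_mono[OF z norm_ge_zero[of x]] by linarith
  then have t: "\<bar>t\<bar> \<le> R / norm x"
    using s by (simp add: t_def abs_divide field_simps power2_eq_square)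
  show ?thesis
  proof (cases "norm x < 1")
    case True
    have "cmod (thorin_integrand z x) \<le> ln (1 + \<bar>t\<bar>) + pi"
      using cmod_Ln_ii_le_ln[of t] True by (simp add: thorin_integrand_def t_def)
    also have "ln (1 + \<bar>t\<bar>) \<le> ln ((1 + R) / norm x)"
    proof -
      have "1 + \<bar>t\<bar> \<le> 1 / norm x + R / norm x" using t True s by (intro add_mono) auto
      then show ?thesis using R s by (subst ln_le_cancel_iff) (auto simp: add_divide_distrib)
    qed
    also have "\<dots> \<le> R - ln (norm x)"
      using R s ln_add_one_self_le_self[of R] by (simp add: ln_div)
    finally have "cmod (thorin_integrand z x) \<le> R + 4 + (- ln (norm x))" using pi_less_4 by simp
    also have "\<dots> \<le> (R + 5) * radial_bound (norm x)"
      using True R s ln_less_zero[of "norm x"] mult_nonneg_nonneg[of "R + 4" "- ln (norm x)"]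
      by (simp add: radial_bound_def algebra_simps)
    also have "\<dots> \<le> (R\<^sup>2 + R + 5) * radial_bound (norm x)"
      using radial_bound_pos[OF s] by (intro mult_right_mono) auto
    finally show ?thesis .
  next
    case False
    have "cmod (thorin_integrand z x) \<le> t\<^sup>2"
      using cmod_Ln_ii_linear[of t] False by (simp add: thorin_integrand_def t_def)
    also have "\<dots> \<le> (R / norm x)\<^sup>2" using t power_mono[of "\<bar>t\<bar>" _ 2] by force
    also have "\<dots> \<le> (R\<^sup>2 + R + 5) * radial_bound (norm x)"
      using False R s by (simp add: radial_bound_def power_divide divide_right_mono)
    finally show ?thesis .
  qed
qed

text \<open>Outside the unit ball the two fractions cancel up to - exp (- s) / s^2, and exp (- s) <=
  1 / s. Inside, 1 - exp (- s) <= s makes the integrand bounded by 1.\<close>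

lemma abs_drift_integrand_le:
  assumes x: "x \<noteq> 0"
  shows "\<bar>drift_integrand j x\<bar> \<le> radial_bound (norm x)"
proof -
  define s where "s = norm x"
  have s: "s > 0" and c: "\<bar>x $ j\<bar> \<le> s" using x component_le_norm_cart[of x j] by (auto simp: s_def)
  show ?thesis
  proof (cases "s < 1")
    case True
    have "1 - exp (- s) \<le> s" using exp_ge_add_one_self[of "- s"] by simp
    then have "\<bar>x $ j\<bar> * ((1 - exp (- s)) / s\<^sup>2) \<le> s * (s / s\<^sup>2)"
      using c s by (intro mult_mono divide_right_mono) auto
    also have "\<dots> = 1" using s by (simp add: power2_eq_square)
    also have "\<dots> \<le> radial_bound s" using True s ln_less_zero[of s] by (simp add: radial_bound_def)
    finally show ?thesis using True s by (simp add: drift_integrand_def s_def[symmetric] abs_mult)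
  next
    case False
    have "s \<le> exp s" using exp_ge_add_one_self[of s] by linarith
    then have "exp (- s) \<le> 1 / s" using s by (simp add: exp_minus field_simps)
    then have "\<bar>x $ j\<bar> * (exp (- s) / s\<^sup>2) \<le> s * ((1 / s) / s\<^sup>2)"
      using c s by (intro mult_mono divide_right_mono) auto
    also have "\<dots> = radial_bound s" using False s by (simp add: radial_bound_def)
    finally show ?thesis using False s
      by (simp add: drift_integrand_def s_def[symmetric] abs_mult diff_divide_distrib[symmetric])
  qed
qed

section \<open>The continuity theorem for characteristic functions of several variables\<close>

text \<open>The distance from t to the nearest even integer; in this form continuity and the period
  2 are inherited from the cosine.\<close>

definition tri_wave :: "real \<Rightarrow> real" where "tri_wave t = arccos (cos (pi * t)) / pi"

text \<open>A continuous reader of the first ternary digit: 0 on [0, 1/3], 1 on [2/3, 1], and linear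
  on the middle third, which Cantor points avoid.\<close>

definition plateau :: "real \<Rightarrow> real" where "plateau t = min 1 (max 0 (3 * tri_wave t - 1))"

lemma continuous_on_tri_wave [continuous_intros]:
  fixes f :: "'a::t2_space \<Rightarrow> real"
  shows "continuous_on A f \<Longrightarrow> continuous_on A (\<lambda>x. tri_wave (f x))"
  unfolding tri_wave_def by (auto intro!: continuous_intros)

lemma continuous_on_plateau [continuous_intros]:
  fixes f :: "'a::t2_space \<Rightarrow> real"
  shows "continuous_on A f \<Longrightarrow> continuous_on A (\<lambda>x. plateau (f x))"
  unfolding plateau_def by (intro continuous_intros) auto

lemma tri_wave_periodic: "tri_wave (t + 2 * of_int k) = tri_wave t"
proof -
  have "cos (pi * (t + 2 * of_int k)) = cos (pi * t)"
    using cos.plus_of_int[of "pi * t" k] by (simp add: algebra_simps)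
  then show ?thesis by (simp add: tri_wave_def)
qed

lemma tri_wave_eq: "0 \<le> t \<Longrightarrow> t \<le> 1 \<Longrightarrow> tri_wave t = t"
  by (simp add: tri_wave_def arccos_cos)

lemma plateau_periodic: "plateau (t + 2 * of_int k) = plateau t"
  by (simp add: plateau_def tri_wave_periodic)

lemma plateau_bounds: "0 \<le> plateau t" "plateau t \<le> 1"
  by (auto simp: plateau_def)

section \<open>Binary digits and points of the Cantor set\<close>

definition binary_digit :: "real \<Rightarrow> nat \<Rightarrow> int" where
  "binary_digit y n = \<lfloor>2 ^ Suc n * y\<rfloor> mod 2"

lemma binary_digit_cases: "binary_digit y n = 0 \<or> binary_digit y n = 1"
  by (simp add: binary_digit_def) presburger

text \<open>Halving and rounding down drops the last binary digit, so the partial sums telescope to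
  floor (2^k y) / 2^k, which differs from y by at most 2^-k. The assumption y < 1 makes the sum
  start at 0.\<close>

lemma binary_digit_sums:
  assumes "0 \<le> y" "y < 1"
  shows "(\<lambda>n. of_int (binary_digit y n) / 2 ^ Suc n) sums y"
proof -
  have part: "(\<Sum>n<k. of_int (binary_digit y n) / 2 ^ Suc n) = (of_int \<lfloor>2 ^ k * y\<rfloor> / 2 ^ k :: real)" for k
  proof (induction k)
    case 0
    have "\<lfloor>y\<rfloor> = 0" using assms by (simp add: floor_eq_iff)
    then show ?case by simp
  next
    case (Suc k)
    have "\<lfloor>2 ^ Suc k * y / of_int 2\<rfloor> = \<lfloor>2 ^ Suc k * y\<rfloor> div 2"
      by (rule floor_divide_real_eq_div) simp
    then have "\<lfloor>2 ^ Suc k * y\<rfloor> = 2 * \<lfloor>2 ^ k * y\<rfloor> + binary_digit y k"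
      by (simp add: binary_digit_def)
    then have "of_int \<lfloor>2 ^ Suc k * y\<rfloor> = 2 * (of_int \<lfloor>2 ^ k * y\<rfloor> :: real) + of_int (binary_digit y k)"
      by (simp only: of_int_add of_int_mult of_int_numeral)
    then show ?case using Suc by (simp add: add_divide_distrib)
  qed
  have "(\<lambda>k. y - 1 / 2 ^ k) \<longlonglongrightarrow> y - 0"
    by (intro tendsto_intros LIMSEQ_divide_realpow_zero) auto
  moreover have "y - 1 / 2 ^ k \<le> of_int \<lfloor>2 ^ k * y\<rfloor> / 2 ^ k" for k
  proof -
    have "2 ^ k * y - 1 \<le> of_int \<lfloor>2 ^ k * y\<rfloor>" by linarith
    then have "(2 ^ k * y - 1) / 2 ^ k \<le> of_int \<lfloor>2 ^ k * y\<rfloor> / 2 ^ k" by (intro divide_right_mono) auto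
    then show ?thesis by (simp add: diff_divide_distrib)
  qed
  moreover have "of_int \<lfloor>2 ^ k * y\<rfloor> / 2 ^ k \<le> y" for k
  proof -
    have "of_int \<lfloor>2 ^ k * y\<rfloor> \<le> 2 ^ k * y" by linarith
    then show ?thesis by (simp add: divide_le_eq mult.commute)
  qed
  ultimately have "(\<lambda>k. of_int \<lfloor>2 ^ k * y\<rfloor> / 2 ^ k) \<longlonglongrightarrow> y"
    using tendsto_sandwich[of "\<lambda>k. y - 1 / 2 ^ k" "\<lambda>k. of_int \<lfloor>2 ^ k * y\<rfloor> / 2 ^ k" sequentially "\<lambda>_. y" y]
    by simp
  then show ?thesis by (simp only: sums_def part)
qed

text \<open>The factor 2 turns binary digits into the ternary digits 0 and 2 and thus keeps the
  point and all its shifts off the open middle third.\<close>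

definition cantor_point :: "(nat \<Rightarrow> int) \<Rightarrow> real" where
  "cantor_point b = (\<Sum>m. 2 * of_int (b m) / 3 ^ Suc m)"

context
  fixes b :: "nat \<Rightarrow> int" assumes b: "\<And>m. b m = 0 \<or> b m = 1"
begin

lemma cantor_point_aux: "0 \<le> (of_int (b m) :: real)" "(of_int (b m) :: real) \<le> 1"
  using b[of m] by auto

lemma cantor_point_term_le: "2 * of_int (b m) / 3 ^ Suc m \<le> 2 / 3 * (1 / 3 :: real) ^ m"
  using cantor_point_aux[of m] by (simp add: power_divide divide_right_mono)

lemma cantor_point_majorant: "(\<lambda>m. 2 / 3 * (1 / 3 :: real) ^ m) sums 1"
  using sums_mult[OF geometric_sums[of "1/3::real"], of "2/3"] by simp

lemma cantor_point_summable: "summable (\<lambda>m. 2 * of_int (b m) / 3 ^ Suc m :: real)"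
  by (rule summable_comparison_test'[OF sums_summable[OF cantor_point_majorant], of 0])
     (use cantor_point_term_le cantor_point_aux in simp)

lemma cantor_point_bounds: "0 \<le> cantor_point b" "cantor_point b \<le> 1"
proof -
  show "0 \<le> cantor_point b"
    unfolding cantor_point_def using cantor_point_aux by (intro suminf_nonneg cantor_point_summable) auto
  show "cantor_point b \<le> 1"
    using suminf_le[OF cantor_point_term_le cantor_point_summable sums_summable[OF cantor_point_majorant]]
      sums_unique[OF cantor_point_majorant] by (simp add: cantor_point_def)
qed

lemma cantor_point_rec: "cantor_point b = (2 * of_int (b 0) + cantor_point (\<lambda>m. b (Suc m))) / 3"
proof -
  have "cantor_point b = 2 * of_int (b 0) / 3 + (\<Sum>m. 2 * of_int (b (Suc m)) / 3 ^ Suc (Suc m))"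
    unfolding cantor_point_def using suminf_split_initial_segment[OF cantor_point_summable, of 1] by simp
  also have "(\<Sum>m. 2 * of_int (b (Suc m)) / 3 ^ Suc (Suc m)) = (\<Sum>m. (2 * of_int (b (Suc m)) / 3 ^ Suc m) / 3 :: real)"
    by simp
  also have "\<dots> = cantor_point (\<lambda>m. b (Suc m)) / 3"
  proof -
    have "summable (\<lambda>m. 2 * of_int (b (Suc m)) / 3 ^ Suc (Suc m) :: real)"
      using cantor_point_summable by (subst summable_Suc_iff)
    from summable_mult[OF this, of 3] have "summable (\<lambda>m. 2 * of_int (b (Suc m)) / 3 ^ Suc m :: real)"
      by simp
    from suminf_divide[OF this, of 3] show ?thesis by (simp only: cantor_point_def)
  qed
  finally show ?thesis by (simp add: add_divide_distrib)
qed

end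

text \<open>Multiplication by 3^m moves digit m to the first place. The integer part split off is
  even, because all ternary digits are 0 or 2, and therefore invisible to a function of period
  2.\<close>

lemma plateau_cantor_point:
  assumes b: "\<And>m. b m = 0 \<or> b m = (1::int)"
  shows "plateau (3 ^ m * cantor_point b) = of_int (b m)"
proof -
  have shift: "\<exists>k. 3 ^ m * cantor_point b = cantor_point (\<lambda>i. b (m + i)) + 2 * of_int k" for m
  proof (induction m)
    case (Suc m)
    then obtain k where k: "3 ^ m * cantor_point b = cantor_point (\<lambda>i. b (m + i)) + 2 * of_int k" by blast
    have "3 ^ Suc m * cantor_point b = 3 * cantor_point (\<lambda>i. b (m + i)) + 2 * of_int (3 * k)"
      using k by simp
    also have "3 * cantor_point (\<lambda>i. b (m + i)) = cantor_point (\<lambda>i. b (Suc m + i)) + 2 * of_int (b m)"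
      using cantor_point_rec[of "\<lambda>i. b (m + i)"] b by simp
    finally have "3 ^ Suc m * cantor_point b = cantor_point (\<lambda>i. b (Suc m + i)) + 2 * of_int (b m + 3 * k)"
      by simp
    then show ?case by blast
  qed (auto intro: exI[of _ 0])
  obtain k where k: "3 ^ m * cantor_point b = cantor_point (\<lambda>i. b (m + i)) + 2 * of_int k"
    using shift by blast
  define c where "c = cantor_point (\<lambda>i. b (m + i))"
  define c' where "c' = cantor_point (\<lambda>i. b (m + Suc i))"
  have c: "c = (2 * of_int (b m) + c') / 3" "0 \<le> c" "c \<le> 1" "0 \<le> c'" "c' \<le> 1"
    unfolding c_def c'_def
    using cantor_point_rec[of "\<lambda>i. b (m + i)"] cantor_point_bounds[of "\<lambda>i. b (m + i)"]
      cantor_point_bounds[of "\<lambda>i. b (m + Suc i)"] b by auto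
  have "plateau (3 ^ m * cantor_point b) = plateau c"
    unfolding k c_def by (rule plateau_periodic)
  also have "\<dots> = of_int (b m)"
    using b[of m] c by (auto simp: plateau_def tri_wave_eq)
  finally show ?thesis .
qed

lemma cantor_point_measurable[measurable]:
  assumes [measurable]: "\<And>m. (\<lambda>x. of_int (b x m) :: real) \<in> borel_measurable M"
  shows "(\<lambda>x. cantor_point (b x)) \<in> borel_measurable M"
  unfolding cantor_point_def by measurable

text \<open>
  A variant of Schoenberg's curve that exhausts the whole space. The binary digits of the rescaled
  coordinates are interleaved into the ternary digits of a point of the Cantor set, from which
  \<open>plateau\<close> reads them off again. The amplitude \<open>A\<close> is constantly \<open>N\<close> on \<open>[2 N, 2 N + 1]\<close>, where the curve
  covers the open cube of side \<open>2 N\<close>; hence the section \<open>h\<close> maps bounded sets to bounded sets and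
  preserves tightness.
\<close>

lemma space_filling_curve:
  obtains g :: "real \<Rightarrow> real ^ 'n" and h :: "real ^ 'n \<Rightarrow> real"
  where "continuous_on UNIV g" "h \<in> borel_measurable borel" "\<And>x. g (h x) = x"
    "\<And>x. 0 \<le> h x" "\<And>x. h x \<le> 2 * norm x + 5"
proof -
  let ?d = "CARD('n)"
  obtain e :: "'n \<Rightarrow> nat" where e: "bij_betw e UNIV {0..<?d}"
    using ex_bij_betw_finite_nat[of "UNIV :: 'n set"] by auto
  define e' where "e' = inv_into UNIV e"
  have e'e: "e' (e j) = j" for j using e by (simp add: e'_def bij_betw_def)
  have ed: "e j < ?d" for j using e by (auto simp: bij_betw_def)
  define A where "A t = (t - tri_wave t) / 2" for t
  define \<gamma> where "\<gamma> j t = (\<Sum>n. plateau (3 ^ (n * ?d + e j) * t) / 2 ^ Suc n)" for j t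
  define g :: "real \<Rightarrow> real ^ 'n" where "g t = (\<chi> j. A t * (2 * \<gamma> j t - 1))" for t
  \<comment> \<open>The added 1 gives |x| < N strictly, so the rescaled coordinates lie in [0, 1) as
    the binary expansion demands.\<close>
  define N where "N x = \<lceil>norm x\<rceil> + 1" for x :: "real ^ 'n"
  define Y where "Y x j = (x $ j / of_int (N x) + 1) / 2" for x :: "real ^ 'n" and j
  \<comment> \<open>Position m serves coordinate m mod d with its digit m div d. Since
    \<open>\<gamma> j\<close> reads the positions n * d + e j, it recovers exactly the digits of
    coordinate j.\<close>
  define b where "b x m = binary_digit (Y x (e' (m mod ?d))) (m div ?d)" for x :: "real ^ 'n" and m
  define h where "h x = 2 * of_int (N x) + cantor_point (b x)" for x :: "real ^ 'n"
  have b01: "b x m = 0 \<or> b x m = 1" for x m unfolding b_def by (rule binary_digit_cases)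
  note cb = cantor_point_bounds[of "b _", OF b01]
  show thesis
  proof (rule that)
    have "continuous_on UNIV (\<gamma> j)" for j
      unfolding \<gamma>_def
    proof (rule uniform_limit_theorem)
      show "uniform_limit UNIV (\<lambda>k t. \<Sum>n<k. plateau (3 ^ (n * ?d + e j) * t) / 2 ^ Suc n)
          (\<lambda>t. \<Sum>n. plateau (3 ^ (n * ?d + e j) * t) / 2 ^ Suc n) sequentially"
      proof (rule Weierstrass_m_test)
        show "norm (plateau (3 ^ (n * ?d + e j) * t) / 2 ^ Suc n) \<le> (1 / 2) ^ Suc n" for n t
          using plateau_bounds[of "3 ^ (n * ?d + e j) * t"] by (simp add: power_divide divide_right_mono)
        show "summable (\<lambda>n. (1 / 2 :: real) ^ Suc n)"
          by (subst summable_Suc_iff) (rule summable_geometric, simp)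
      qed
      show "\<forall>\<^sub>F k in sequentially. continuous_on UNIV (\<lambda>t. \<Sum>n<k. plateau (3 ^ (n * ?d + e j) * t) / 2 ^ Suc n)"
        by (intro always_eventually allI continuous_intros) auto
    qed auto
    then show "continuous_on UNIV g"
      unfolding g_def A_def by (intro continuous_intros) auto
    have "(\<lambda>x. of_int (b x m) :: real) \<in> borel_measurable borel" for m
      unfolding b_def binary_digit_def Y_def N_def by measurable
    then show "h \<in> borel_measurable borel"
      unfolding h_def N_def by measurable
    fix x :: "real ^ 'n"
    have N: "1 \<le> N x" "norm x < of_int (N x)" "of_int (N x) \<le> norm x + 2"
      using norm_ge_zero[of x] unfolding N_def by (auto simp del: norm_ge_zero) linarith+
    show "0 \<le> h x" "h x \<le> 2 * norm x + 5"
      using N cb[of x] by (auto simp: h_def)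
    have Npos: "0 < (of_int (N x) :: real)" using N by simp
    have Y: "0 \<le> Y x j" "Y x j < 1" for j
      using component_le_norm_cart[of x j] N Npos by (auto simp: Y_def field_simps abs_le_iff)
    have "A (h x) = of_int (N x)"
      using tri_wave_periodic[of "cantor_point (b x)" "N x"] tri_wave_eq[OF cb[of x]]
      by (simp add: A_def h_def add.commute)
    moreover have "\<gamma> j (h x) = Y x j" for j
    proof -
      have "plateau (3 ^ k * h x) = of_int (b x k)" for k
      proof -
        \<comment> \<open>The offset 2 N that selects the amplitude remains an even integer after
          scaling by 3^k and does not disturb the digits.\<close>
        have "3 ^ k * h x = 3 ^ k * cantor_point (b x) + 2 * of_int (3 ^ k * N x)"
          by (simp add: h_def algebra_simps)
        then show ?thesis using plateau_periodic plateau_cantor_point[of "b x", OF b01] by metis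
      qed
      moreover have "b x (n * ?d + e j) = binary_digit (Y x j) n" for n
        using ed[of j] e'e[of j] by (simp add: b_def)
      ultimately have "\<gamma> j (h x) = (\<Sum>n. of_int (binary_digit (Y x j) n) / 2 ^ Suc n)"
        by (simp add: \<gamma>_def)
      then show ?thesis using binary_digit_sums[OF Y] sums_unique by metis
    qed
    moreover have "of_int (N x) * (2 * Y x j - 1) = x $ j" for j
      using Npos by (simp add: Y_def field_simps)
    ultimately show "g (h x) = x"
      by (simp add: g_def vec_eq_iff)
  qed
qed

text \<open>The laws move to the line by the measurable \<open>h\<close>, and the limit comes back
  by the continuous \<open>g\<close>. A bounded continuous f becomes f o g, again bounded and
  continuous, and g o h = id identifies its integral over the image law with that of f over
  \<open>M k\<close>.\<close>

lemma tight_imp_weakly_convergent_subsequence: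
  fixes M :: "nat \<Rightarrow> (real ^ 'n) measure"
  assumes law: "\<And>k. law (M k)"
    and tight: "\<And>\<epsilon>. \<epsilon> > 0 \<Longrightarrow> \<exists>R. \<forall>k. measure (M k) {x. R < norm x} < \<epsilon>"
  obtains s \<mu> where "strict_mono s" "law \<mu>" "weakly_converges (M \<circ> s) \<mu>"
proof -
  obtain g :: "real \<Rightarrow> real ^ 'n" and h :: "real ^ 'n \<Rightarrow> real"
  where g: "continuous_on UNIV g" and h[measurable]: "h \<in> borel_measurable borel"
    and gh: "\<And>x. g (h x) = x" and h_bounds: "\<And>x. 0 \<le> h x" "\<And>x. h x \<le> 2 * norm x + 5"
    using space_filling_curve by blast
  have [measurable]: "g \<in> borel_measurable borel"
    using g by (rule borel_measurable_continuous_onI)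
  have prob: "prob_space (M k)" and ms[measurable_cong]: "sets (M k) = sets borel" for k
    using law[of k] by (auto simp: law_def)
  have sp: "space (M k) = UNIV" for k using sets_eq_imp_space_eq[OF ms, of k] by simp
  define \<rho> where "\<rho> k = distr (M k) borel h" for k
  have rd: "real_distribution (\<rho> k)" for k
    unfolding \<rho>_def by (intro prob_space.real_distribution_distr prob) measurable
  have "Helly_Selection.tight \<rho>"
    unfolding Helly_Selection.tight_def
  proof (intro conjI allI impI rd)
    fix \<epsilon> :: real assume "\<epsilon> > 0"
    then obtain R where R: "\<And>k. measure (M k) {x. R < norm x} < \<epsilon>" using tight by blast
    \<comment> \<open>The right end is the growth bound of \<open>h\<close> on the ball of radius
      |R|; the left end lies below 0 because \<open>h\<close> takes nonnegative values and the
      interval is open on the left.\<close>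
    let ?I = "{-1<..2 * \<bar>R\<bar> + 5}"
    have "measure (\<rho> k) ?I > 1 - \<epsilon>" for k
    proof -
      interpret prob_space "M k" by (rule prob)
      have "measure (M k) (UNIV - h -` ?I) \<le> measure (M k) {x. R < norm x}"
      proof (rule finite_measure_mono)
        show "UNIV - h -` ?I \<subseteq> {x. R < norm x}"
        proof
          fix x assume "x \<in> UNIV - h -` ?I"
          then have "2 * \<bar>R\<bar> + 5 < h x" using h_bounds(1)[of x] by auto
          then show "x \<in> {x. R < norm x}" using h_bounds(2)[of x] by auto
        qed
      qed measurable
      moreover have "measure (M k) (UNIV - h -` ?I) = 1 - measure (M k) (h -` ?I)"
      proof -
        have "h -` ?I \<in> sets (M k)" using measurable_sets_borel[OF h, of ?I] by (simp add: ms)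
        from prob_compl[OF this] show ?thesis by (simp add: sp)
      qed
      moreover have "measure (\<rho> k) ?I = measure (M k) (h -` ?I)"
        unfolding \<rho>_def by (subst measure_distr) (auto simp: sp)
      ultimately show ?thesis using R[of k] by simp
    qed
    then show "\<exists>a b. a < b \<and> (\<forall>n. 1 - \<epsilon> < measure (\<rho> n) {a<..b})"
      by (intro exI[of _ "-1"] exI[of _ "2 * \<bar>R\<bar> + 5"]) auto
  qed
  then obtain s \<rho>' where s: "strict_mono (s :: nat \<Rightarrow> nat)" and \<rho>': "real_distribution \<rho>'"
    and conv: "weak_conv_m (\<rho> \<circ> id \<circ> s) \<rho>'"
    using tight_imp_convergent_subsubsequence[of \<rho> id] strict_mono_id by blast
  interpret \<rho>': real_distribution \<rho>' by (rule \<rho>')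
  define \<mu> where "\<mu> = distr \<rho>' borel g"
  show thesis
  proof (rule that[OF s])
    show "law \<mu>"
      unfolding law_def \<mu>_def by (auto intro!: \<rho>'.prob_space_distr)
    show "weakly_converges (M \<circ> s) \<mu>"
      unfolding weakly_converges_def
    proof (intro allI impI)
      fix f :: "real ^ 'n \<Rightarrow> real" assume f: "continuous_on UNIV f" and "bounded (range f)"
      then obtain B where B: "\<And>x. norm (f x) \<le> B" by (auto simp: bounded_iff)
      have [measurable]: "f \<in> borel_measurable borel"
        using f by (rule borel_measurable_continuous_onI)
      have "continuous_on UNIV (f \<circ> g)"
        using f g continuous_on_compose continuous_on_subset by blast
      then have "isCont (f \<circ> g) t" for t by (metis continuous_on_eq_continuous_at open_UNIV UNIV_I)
      then have "(\<lambda>k. \<integral>t. (f \<circ> g) t \<partial>\<rho> (s k)) \<longlonglongrightarrow> (\<integral>t. (f \<circ> g) t \<partial>\<rho>')"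
        using weak_conv_imp_integral_bdd_continuous_conv[OF _ \<rho>' conv, of "f \<circ> g" B] rd B by (simp add: o_def)
      moreover have "(\<integral>t. (f \<circ> g) t \<partial>\<rho> k) = (\<integral>x. f x \<partial>M k)" for k
        unfolding \<rho>_def by (subst integral_distr) (auto simp: gh)
      moreover have "(\<integral>t. (f \<circ> g) t \<partial>\<rho>') = (\<integral>x. f x \<partial>\<mu>)"
        unfolding \<mu>_def by (subst integral_distr) (auto simp: o_def)
      ultimately show "(\<lambda>k. \<integral>x. f x \<partial>(M \<circ> s) k) \<longlonglongrightarrow> (\<integral>x. f x \<partial>\<mu>)" by simp
    qed
  qed
qed

section \<open>Characteristic functions and tightness\<close>

lemma law_space: "law \<mu> \<Longrightarrow> space \<mu> = UNIV"
  using sets_eq_imp_space_eq[of \<mu> borel] by (simp add: law_def)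

lemma integrable_iexp_inner:
  assumes "law \<mu>" shows "integrable \<mu> (\<lambda>x. iexp (z \<bullet> x))"
proof -
  interpret prob_space \<mu> using assms by (simp add: law_def)
  have [measurable_cong]: "sets \<mu> = sets borel" using assms by (simp add: law_def)
  show ?thesis by (rule integrable_const_bound[of _ 1]) auto
qed

lemma char_fun_zero: "law \<mu> \<Longrightarrow> char_fun \<mu> 0 = 1"
  by (simp add: char_fun_def law_def prob_space.prob_space)

lemma cmod_char_fun_le_1:
  assumes "law \<mu>" shows "cmod (char_fun \<mu> z) \<le> 1"
proof -
  interpret prob_space \<mu> using assms by (simp add: law_def)
  have "cmod (char_fun \<mu> z) \<le> (\<integral>x. cmod (iexp (z \<bullet> x)) \<partial>\<mu>)"
    unfolding char_fun_def by (rule integral_norm_bound)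
  then show ?thesis by (simp add: prob_space)
qed

lemma char_fun_measurable:
  assumes "law \<mu>" shows "char_fun \<mu> \<in> borel_measurable borel"
proof -
  interpret prob_space \<mu> using assms by (simp add: law_def)
  have [measurable_cong]: "sets \<mu> = sets borel" using assms by (simp add: law_def)
  show ?thesis unfolding char_fun_def[abs_def] by measurable
qed

text \<open>By Fubini the average over t falls on iexp alone and produces the characteristic
  function of the normal law, again a Gaussian. The right side is close to 1 only if the j-th
  coordinate is mostly of size at most 1 / \<sigma>.\<close>

lemma gaussian_average_char_fun:
  fixes \<mu> :: "(real ^ 'n) measure"
  assumes "law \<mu>"
  shows "(\<integral>t. char_fun \<mu> ((\<sigma> * t) *\<^sub>R axis j 1) \<partial>std_normal_distribution)
    = of_real (\<integral>x. exp (- (\<sigma> * x $ j)\<^sup>2 / 2) \<partial>\<mu>)"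
proof -
  interpret \<mu>: prob_space \<mu> using assms by (simp add: law_def)
  have [measurable_cong]: "sets \<mu> = sets borel" using assms by (simp add: law_def)
  interpret N: real_distribution std_normal_distribution by (rule real_dist_normal_dist)
  interpret P: pair_prob_space std_normal_distribution \<mu> ..
  have inner: "((\<sigma> * t) *\<^sub>R axis j 1) \<bullet> x = t * (\<sigma> * x $ j)" for t and x :: "real ^ 'n"
    by (simp add: inner_axis' mult.commute mult.left_commute)
  have [measurable]: "(\<lambda>p :: real \<times> (real ^ 'n). snd p $ j) \<in> borel_measurable (borel \<Otimes>\<^sub>M borel)"
    for j :: 'n
    by (rule measurable_compose[OF measurable_snd borel_measurable_nth])
  have "(\<integral>t. char_fun \<mu> ((\<sigma> * t) *\<^sub>R axis j 1) \<partial>std_normal_distribution)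
    = (\<integral>t. \<integral>x. iexp (t * (\<sigma> * x $ j)) \<partial>\<mu> \<partial>std_normal_distribution)"
    unfolding char_fun_def inner ..
  also have "\<dots> = (\<integral>x. \<integral>t. iexp (t * (\<sigma> * x $ j)) \<partial>std_normal_distribution \<partial>\<mu>)"
  proof (rule P.Fubini_integral[symmetric])
    show "integrable (std_normal_distribution \<Otimes>\<^sub>M \<mu>) (\<lambda>(t, x). iexp (t * (\<sigma> * x $ j)))"
      by (rule P.P.integrable_const_bound[of _ 1], simp add: case_prod_beta) measurable
  qed
  also have "\<dots> = (\<integral>x. of_real (exp (- (\<sigma> * x $ j)\<^sup>2 / 2)) \<partial>\<mu>)"
  proof (rule Bochner_Integration.integral_cong[OF refl])
    fix x
    have "(\<integral>t. iexp (t * (\<sigma> * x $ j)) \<partial>std_normal_distribution) = char std_normal_distribution (\<sigma> * x $ j)"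
      unfolding char_def by (simp add: mult.commute)
    then show "(\<integral>t. iexp (t * (\<sigma> * x $ j)) \<partial>std_normal_distribution) = of_real (exp (- (\<sigma> * x $ j)\<^sup>2 / 2))"
      by (simp add: char_std_normal_distribution)
  qed
  also have "\<dots> = of_real (\<integral>x. exp (- (\<sigma> * x $ j)\<^sup>2 / 2) \<partial>\<mu>)"
    by (rule integral_complex_of_real)
  finally show ?thesis .
qed

text \<open>On the tail \<sigma> |x_j| > 1, so 1 - exp (- (\<sigma> x_j)^2 / 2) is at least 1 - exp
  (- 1 / 2); everywhere else it is nonnegative.\<close>

lemma measure_coordinate_tail_le:
  fixes \<mu> :: "(real ^ 'n) measure"
  assumes \<mu>: "law \<mu>" and \<sigma>: "\<sigma> > 0"
  shows "(1 - exp (- 1 / 2)) * measure \<mu> {x. 1 / \<sigma> < \<bar>x $ j\<bar>}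
    \<le> cmod (1 - (\<integral>t. char_fun \<mu> ((\<sigma> * t) *\<^sub>R axis j 1) \<partial>std_normal_distribution))"
proof -
  interpret \<mu>: prob_space \<mu> using \<mu> by (simp add: law_def)
  have [measurable_cong]: "sets \<mu> = sets borel" using \<mu> by (simp add: law_def)
  let ?f = "\<lambda>x. exp (- (\<sigma> * x $ j)\<^sup>2 / 2)"
  have int: "integrable \<mu> ?f" by (rule \<mu>.integrable_const_bound[of _ 1]) auto
  have "(1 - exp (- 1 / 2)) * measure \<mu> {x. 1 / \<sigma> < \<bar>x $ j\<bar>}
    = (\<integral>x. (1 - exp (- 1 / 2)) * indicator {x. 1 / \<sigma> < \<bar>x $ j\<bar>} x \<partial>\<mu>)"
    using law_space[OF \<mu>] by simp
  also have "\<dots> \<le> (\<integral>x. 1 - ?f x \<partial>\<mu>)"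
  proof (rule integral_mono)
    show "integrable \<mu> (\<lambda>x. (1 - exp (- 1 / 2)) * indicator {x. 1 / \<sigma> < \<bar>x $ j\<bar>} x :: real)"
      by (rule \<mu>.integrable_const_bound[of _ 1]) (auto simp: indicator_def)
    show "integrable \<mu> (\<lambda>x. 1 - ?f x)" using int by simp
    fix x
    have "exp (- (\<sigma> * x $ j)\<^sup>2 / 2) \<le> exp (- 1 / 2)" if "1 / \<sigma> < \<bar>x $ j\<bar>"
    proof -
      have "1 \<le> \<sigma> * \<bar>x $ j\<bar>" using that \<sigma> by (simp add: field_simps)
      then have "1 \<le> (\<sigma> * \<bar>x $ j\<bar>)\<^sup>2" by (rule one_le_power)
      then show ?thesis by (simp add: power_mult_distrib)
    qed
    then show "(1 - exp (- 1 / 2)) * indicator {x. 1 / \<sigma> < \<bar>x $ j\<bar>} x \<le> 1 - ?f x"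
      by (auto simp: indicator_def)
  qed
  also have "\<dots> = 1 - (\<integral>x. ?f x \<partial>\<mu>)" using int by (simp add: \<mu>.prob_space)
  also have "\<dots> \<le> cmod (1 - of_real (\<integral>x. ?f x \<partial>\<mu>))"
    using complex_Re_le_cmod[of "1 - of_real (\<integral>x. ?f x \<partial>\<mu>)"] by simp
  finally show ?thesis unfolding gaussian_average_char_fun[OF \<mu>] .
qed

text \<open>Dominated convergence is used twice. Continuity of \<open>\<phi>\<close> at 0 fixes a
  Gaussian scale at which the average of \<open>\<phi>\<close> is nearly 1; at that fixed scale the
  averages belonging to \<open>M k\<close> converge to it, and the tail estimate applies to all
  large k.\<close>

lemma asymptotically_tight:
  fixes M :: "nat \<Rightarrow> (real ^ 'n) measure"
  assumes law: "\<And>k. law (M k)" and conv: "\<And>z. (\<lambda>k. char_fun (M k) z) \<longlonglongrightarrow> \<phi> z"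
    and cont: "isCont \<phi> 0" and \<epsilon>: "\<epsilon> > 0"
  shows "\<forall>\<^sub>F R in at_top. \<forall>\<^sub>F k in sequentially. measure (M k) {x. R < norm x} < \<epsilon>"
proof -
  interpret N: real_distribution std_normal_distribution by (rule real_dist_normal_dist)
  have fin: "finite_measure (M k)" and [measurable_cong]: "sets (M k) = sets borel" for k
    using law[of k] by (auto simp: law_def prob_space_def)
  have \<phi>0: "\<phi> 0 = 1"
    using LIMSEQ_unique[OF conv[of 0]] char_fun_zero[OF law] by auto
  have \<phi>_le: "cmod (\<phi> z) \<le> 1" for z
    using cmod_char_fun_le_1[OF law] by (intro tendsto_upperbound[OF tendsto_norm[OF conv]]) auto
  have [measurable]: "\<phi> \<in> borel_measurable borel"
    by (rule borel_measurable_LIMSEQ_metric[OF char_fun_measurable[OF law] conv])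
  note [measurable] = char_fun_measurable[OF law]
  have coord: "\<forall>\<^sub>F R in at_top. \<forall>\<^sub>F k in sequentially. measure (M k) {x. R < \<bar>x $ j\<bar>} < \<epsilon>" if \<epsilon>: "\<epsilon> > 0" for j \<epsilon>
  proof -
    define c :: real where "c = 1 - exp (- 1 / 2)"
    have c: "c > 0" by (simp add: c_def)
    let ?I = "\<lambda>f n. \<integral>t. f ((1 / real (Suc n) * t) *\<^sub>R axis j 1) \<partial>std_normal_distribution"
    have "(\<lambda>n. ?I \<phi> n) \<longlonglongrightarrow> (\<integral>t. 1 \<partial>std_normal_distribution)"
    proof (rule integral_dominated_convergence[where w="\<lambda>_. 1"])
      show "AE t in std_normal_distribution. (\<lambda>n. \<phi> ((1 / real (Suc n) * t) *\<^sub>R axis j 1)) \<longlonglongrightarrow> 1"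
      proof (rule AE_I2)
        fix t
        have "(\<lambda>n. 1 / real (Suc n)) \<longlonglongrightarrow> 0" by (rule LIMSEQ_Suc[OF lim_1_over_n])
        then have "(\<lambda>n. (1 / real (Suc n) * t) *\<^sub>R axis j 1 :: real ^ 'n) \<longlonglongrightarrow> (0 * t) *\<^sub>R axis j 1"
          by (intro tendsto_intros)
        then have "(\<lambda>n. (1 / real (Suc n) * t) *\<^sub>R axis j 1 :: real ^ 'n) \<longlonglongrightarrow> 0" by simp
        from isCont_tendsto_compose[OF cont this]
        show "(\<lambda>n. \<phi> ((1 / real (Suc n) * t) *\<^sub>R axis j 1)) \<longlonglongrightarrow> 1" by (simp only: \<phi>0)
      qed
    qed (use \<phi>_le in auto)
    then have "(\<lambda>n. ?I \<phi> n) \<longlonglongrightarrow> 1" using N.prob_space by simp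
    then have "\<forall>\<^sub>F n in sequentially. dist (?I \<phi> n) 1 < c * \<epsilon>"
      using c \<epsilon> by (intro tendstoD) auto
    then obtain n where "dist (?I \<phi> n) 1 < c * \<epsilon>"
      using eventually_happens trivial_limit_sequentially by blast
    then have n: "cmod (1 - ?I \<phi> n) < c * \<epsilon>" by (simp add: dist_norm norm_minus_commute)
    have "(\<lambda>k. ?I (char_fun (M k)) n) \<longlonglongrightarrow> ?I \<phi> n"
    proof (rule integral_dominated_convergence[where w="\<lambda>_. 1"])
      show "AE t in std_normal_distribution. cmod (char_fun (M k) ((1 / real (Suc n) * t) *\<^sub>R axis j 1)) \<le> 1" for k
        using cmod_char_fun_le_1[OF law] by auto
    qed (use conv in auto)
    then have "(\<lambda>k. cmod (1 - ?I (char_fun (M k)) n)) \<longlonglongrightarrow> cmod (1 - ?I \<phi> n)"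
      by (intro tendsto_intros)
    from order_tendstoD(2)[OF this n]
    have ev: "\<forall>\<^sub>F k in sequentially. measure (M k) {x. real (Suc n) < \<bar>x $ j\<bar>} < \<epsilon>"
    proof eventually_elim
      case (elim k)
      have "c * measure (M k) {x. 1 / (1 / real (Suc n)) < \<bar>x $ j\<bar>} < c * \<epsilon>"
        unfolding c_def by (rule le_less_trans[OF measure_coordinate_tail_le[OF law]]) (use elim in \<open>auto simp: c_def\<close>)
      then show ?case using c by simp
    qed
    show ?thesis
      using eventually_ge_at_top[of "real (Suc n)"]
    proof eventually_elim
      case (elim R)
      show ?case using ev
      proof eventually_elim
        case (elim k)
        have "measure (M k) {x. R < \<bar>x $ j\<bar>} \<le> measure (M k) {x. real (Suc n) < \<bar>x $ j\<bar>}"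
          using \<open>real (Suc n) \<le> R\<close> by (intro finite_measure.finite_measure_mono[OF fin]) auto
        then show ?case using elim by simp
      qed
    qed
  qed
  \<comment> \<open>The l1 norm dominates the Euclidean one, so |x| > R forces some coordinate
    beyond R / d; each of the d coordinates receives the share \<epsilon> / d.\<close>
  let ?d = "real CARD('n)"
  have "\<forall>\<^sub>F R in at_top. \<forall>j\<in>UNIV. \<forall>\<^sub>F k in sequentially. measure (M k) {x. R < \<bar>x $ j :: real\<bar>} < \<epsilon> / ?d"
    using coord \<epsilon> by (intro eventually_ball_finite) auto
  moreover have "filterlim (\<lambda>R. R / ?d) at_top at_top"
  proof -
    have "filterlim (\<lambda>R. 1 / ?d * R) at_top at_top"
      by (intro filterlim_tendsto_pos_mult_at_top[OF tendsto_const] filterlim_ident) auto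
    then show ?thesis by simp
  qed
  ultimately have "\<forall>\<^sub>F R in at_top. \<forall>j\<in>UNIV. \<forall>\<^sub>F k in sequentially. measure (M k) {x. R / ?d < \<bar>x $ j :: real\<bar>} < \<epsilon> / ?d"
    by (rule eventually_compose_filterlim[where f="\<lambda>R. R / ?d"])
  then show ?thesis
  proof eventually_elim
    case (elim R)
    then have "\<forall>\<^sub>F k in sequentially. \<forall>j\<in>UNIV. measure (M k) {x. R / ?d < \<bar>x $ j :: real\<bar>} < \<epsilon> / ?d"
      by (intro eventually_ball_finite) auto
    then show ?case
    proof eventually_elim
      case (elim k)
      have "measure (M k) {x. R < norm x} \<le> measure (M k) (\<Union>j\<in>UNIV. {x. R / ?d < \<bar>x $ j :: real\<bar>})"
      proof (rule finite_measure.finite_measure_mono[OF fin])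
        show "{x. R < norm x} \<subseteq> (\<Union>j\<in>(UNIV :: 'n set). {x. R / ?d < \<bar>x $ j :: real\<bar>})"
        proof
          fix x :: "real ^ 'n" assume "x \<in> {x. R < norm x}"
          then have "R < (\<Sum>j\<in>UNIV. \<bar>x $ j\<bar>)" using norm_le_l1_cart[of x] by simp
          have "\<exists>j. R / ?d < \<bar>x $ j\<bar>"
          proof (rule ccontr)
            assume "\<nexists>j. R / ?d < \<bar>x $ j\<bar>"
            then have "(\<Sum>j\<in>UNIV. \<bar>x $ j\<bar>) \<le> (\<Sum>j\<in>(UNIV::'n set). R / ?d)"
              by (intro sum_mono) (auto simp: not_less)
            then show False using \<open>R < _\<close> by simp
          qed
          then show "x \<in> (\<Union>j\<in>UNIV. {x. R / ?d < \<bar>x $ j :: real\<bar>})" by auto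
        qed
      qed measurable
      also have "\<dots> \<le> (\<Sum>j\<in>UNIV. measure (M k) {x. R / ?d < \<bar>x $ j :: real\<bar>})"
        by (intro finite_measure.finite_measure_subadditive_finite[OF fin]) auto
      also have "\<dots> < (\<Sum>j\<in>(UNIV::'n set). \<epsilon> / ?d)"
        using elim by (intro sum_strict_mono) auto
      finally show ?case by simp
    qed
  qed
qed

text \<open>Only finitely many laws escape the asymptotic statement. Each is tight by continuity
  from above, and the largest of the finitely many radii serves for all.\<close>

lemma tight_of_char_fun_convergence:
  fixes M :: "nat \<Rightarrow> (real ^ 'n) measure"
  assumes law: "\<And>k. law (M k)" and conv: "\<And>z. (\<lambda>k. char_fun (M k) z) \<longlonglongrightarrow> \<phi> z"
    and cont: "isCont \<phi> 0" and \<epsilon>: "\<epsilon> > 0"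
  shows "\<exists>R. \<forall>k. measure (M k) {x. R < norm x} < \<epsilon>"
proof -
  have fin: "finite_measure (M k)" and [measurable_cong]: "sets (M k) = sets borel" for k
    using law[of k] by (auto simp: law_def prob_space_def)
  have mono: "measure (M k) {x. R' < norm x} < \<epsilon>" if *: "measure (M k) {x. R < norm x} < \<epsilon>" "R \<le> R'" for k R R'
  proof -
    have "measure (M k) {x. R' < norm x} \<le> measure (M k) {x. R < norm x}"
      using *(2) by (intro finite_measure.finite_measure_mono[OF fin]) auto
    then show ?thesis using *(1) by simp
  qed
  have single: "\<exists>R. measure (M k) {x. R < norm x} < \<epsilon>" for k
  proof -
    have "(\<lambda>n. measure (M k) {x. real n < norm x}) \<longlonglongrightarrow> measure (M k) (\<Inter>n. {x. real n < norm x})"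
      by (intro finite_measure.finite_Lim_measure_decseq[OF fin]) (auto simp: decseq_def)
    also have "(\<Inter>n. {x :: real ^ 'n. real n < norm x}) = {}"
    proof -
      have "\<exists>n. \<not> real n < norm x" for x :: "real ^ 'n"
        using reals_Archimedean2[of "norm x"] by (auto simp: not_less intro: less_imp_le)
      then show ?thesis by blast
    qed
    finally have "(\<lambda>n. measure (M k) {x. real n < norm x}) \<longlonglongrightarrow> 0" by simp
    from order_tendstoD(2)[OF this \<epsilon>] show ?thesis
      using eventually_happens trivial_limit_sequentially by blast
  qed
  then obtain R where R: "\<And>k. measure (M k) {x. R k < norm x} < \<epsilon>" by metis
  from asymptotically_tight[OF law conv cont \<epsilon>] obtain R' where
    "\<forall>\<^sub>F k in sequentially. measure (M k) {x. R' < norm x} < \<epsilon>"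
    using eventually_happens trivial_limit_at_top_linorder by blast
  then obtain K where K: "\<And>k. k \<ge> K \<Longrightarrow> measure (M k) {x. R' < norm x} < \<epsilon>"
    by (auto simp: eventually_sequentially)
  let ?R = "Max (insert R' (R ` {..<K}))"
  have "measure (M k) {x. ?R < norm x} < \<epsilon>" for k
  proof (cases "k < K")
    case True
    then show ?thesis by (intro mono[OF R[of k]] Max_ge) auto
  next
    case False
    then show ?thesis by (intro mono[OF K] Max_ge) auto
  qed
  then show ?thesis by blast
qed

text \<open>A subsequence is enough, because membership in the Thorin class asks for some
  approximating sequence. Weak convergence is tested on real functions, so the limit is identified
  through cosine and sine separately.\<close>

lemma levy_continuity_vec:
  fixes M :: "nat \<Rightarrow> (real ^ 'n) measure"
  assumes law: "\<And>k. law (M k)" and conv: "\<And>z. (\<lambda>k. char_fun (M k) z) \<longlonglongrightarrow> \<phi> z" and cont: "isCont \<phi> 0"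
  obtains s \<mu> where "strict_mono s" "law \<mu>" "weakly_converges (M \<circ> s) \<mu>" "\<And>z. char_fun \<mu> z = \<phi> z"
proof -
  obtain s \<mu> where s: "strict_mono s" and \<mu>: "law \<mu>" and w: "weakly_converges (M \<circ> s) \<mu>"
    using tight_imp_weakly_convergent_subsequence[OF law tight_of_char_fun_convergence[OF law conv cont]] by blast
  have re_im: "char_fun \<nu> z = Complex (\<integral>x. cos (z \<bullet> x) \<partial>\<nu>) (\<integral>x. sin (z \<bullet> x) \<partial>\<nu>)" if "law \<nu>" for \<nu> and z :: "real ^ 'n"
  proof -
    have "Re (char_fun \<nu> z) = (\<integral>x. cos (z \<bullet> x) \<partial>\<nu>)" "Im (char_fun \<nu> z) = (\<integral>x. sin (z \<bullet> x) \<partial>\<nu>)"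
      unfolding char_fun_def using integrable_iexp_inner[OF that, of z]
      by (simp_all add: integral_Re[symmetric] integral_Im[symmetric] Re_exp Im_exp)
    then show ?thesis by (simp add: complex_eq_iff)
  qed
  have "char_fun \<mu> z = \<phi> z" for z
  proof (rule LIMSEQ_unique)
    have "(\<lambda>k. \<integral>x. cos (z \<bullet> x) \<partial>(M \<circ> s) k) \<longlonglongrightarrow> (\<integral>x. cos (z \<bullet> x) \<partial>\<mu>)"
      using w unfolding weakly_converges_def
      by (elim allE impE) (auto intro!: continuous_intros simp: bounded_iff intro: exI[of _ 1])
    moreover have "(\<lambda>k. \<integral>x. sin (z \<bullet> x) \<partial>(M \<circ> s) k) \<longlonglongrightarrow> (\<integral>x. sin (z \<bullet> x) \<partial>\<mu>)"
      using w unfolding weakly_converges_def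
      by (elim allE impE) (auto intro!: continuous_intros simp: bounded_iff intro: exI[of _ 1])
    ultimately show "(\<lambda>k. char_fun ((M \<circ> s) k) z) \<longlonglongrightarrow> char_fun \<mu> z"
      using law \<mu> by (simp add: re_im tendsto_Complex)
    show "(\<lambda>k. char_fun ((M \<circ> s) k) z) \<longlonglongrightarrow> \<phi> z"
      using LIMSEQ_subseq_LIMSEQ[OF conv s, of z] by (simp add: o_def)
  qed
  then show thesis using that s \<mu> w by blast
qed

section \<open>Exponents of gamma convolutions and their limits\<close>

lemma gamma_density_nonneg: "\<alpha> > 0 \<Longrightarrow> \<beta> > 0 \<Longrightarrow> 0 \<le> gamma_density \<alpha> \<beta> v"
  by (simp add: gamma_density_def)

lemma gamma_density_measurable[measurable]: "gamma_density \<alpha> \<beta> \<in> borel_measurable borel"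
  unfolding gamma_density_def[abs_def] by measurable

lemma gamma_density_altdef:
  "gamma_density \<alpha> \<beta> v =
    \<beta> powr \<alpha> / Gamma \<alpha> * gamma_kernel \<alpha> \<beta> v"
  by (simp add: gamma_density_def)

lemma prob_space_gamma_density:
  assumes "\<alpha> > 0" "\<beta> > 0"
  shows "prob_space (density lborel (\<lambda>v. ennreal (gamma_density \<alpha> \<beta> v)))"
proof (rule prob_spaceI)
  have G: "Gamma \<alpha> > 0" using assms by (simp add: Gamma_real_pos)
  have "(\<integral>\<^sup>+v. ennreal (gamma_density \<alpha> \<beta> v) \<partial>lborel)
     = (\<integral>\<^sup>+v. ennreal (\<beta> powr \<alpha> / Gamma \<alpha>) * ennreal (gamma_kernel \<alpha> \<beta> v) \<partial>lborel)"
    unfolding gamma_density_altdef using assms G by (intro nn_integral_cong ennreal_mult) auto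
  also have "\<dots> = ennreal (\<beta> powr \<alpha> / Gamma \<alpha>) * ennreal (Gamma \<alpha> / \<beta> powr \<alpha>)"
    using assms by (subst nn_integral_cmult) (simp_all add: nn_integral_powr_exp)
  also have "\<dots> = 1" using assms G by (simp add: less_imp_neq[symmetric] flip: ennreal_mult)
  finally show "emeasure (density lborel (\<lambda>v. ennreal (gamma_density \<alpha> \<beta> v)))
      (space (density lborel (\<lambda>v. ennreal (gamma_density \<alpha> \<beta> v)))) = 1"
    by (simp add: emeasure_density)
qed

lemma law_elementary_gamma_law:
  assumes "\<alpha> > 0" "\<beta> > 0" shows "law (elementary_gamma_law \<alpha> \<beta> x)"
  unfolding law_def elementary_gamma_law_def
  by (auto intro!: prob_space.prob_space_distr prob_space_gamma_density assms)

lemma char_fun_elementary_gamma_law: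
  assumes "\<alpha> > 0" "\<beta> > 0"
  shows "char_fun (elementary_gamma_law \<alpha> \<beta> x) z = exp (- of_real \<alpha> * Ln_ii (z \<bullet> x / \<beta>))"
proof -
  have G: "Gamma \<alpha> > 0" using assms by (simp add: Gamma_real_pos)
  have "char_fun (elementary_gamma_law \<alpha> \<beta> x) z
    = (\<integral>v. gamma_density \<alpha> \<beta> v *\<^sub>R iexp (z \<bullet> (v *\<^sub>R x)) \<partial>lborel)"
    unfolding char_fun_def elementary_gamma_law_def
    by (simp add: integral_distr integral_density gamma_density_nonneg assms)
  also have "\<dots> = (\<integral>v. of_real (\<beta> powr \<alpha> / Gamma \<alpha>) * (iexp ((z \<bullet> x) * v) *
       of_real (gamma_kernel \<alpha> \<beta> v)) \<partial>lborel)"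
    unfolding gamma_density_altdef scaleR_conv_of_real[where 'a=complex]
    by (intro Bochner_Integration.integral_cong refl) (simp add: mult_ac)
  also have "\<dots> = of_real (\<beta> powr \<alpha> / Gamma \<alpha>) * (of_real (Gamma \<alpha> / \<beta> powr \<alpha>) * exp (- of_real \<alpha> * Ln_ii (z \<bullet> x / \<beta>)))"
    unfolding integral_iexp_powr_exp[OF assms, symmetric]
    by (simp only: Bochner_Integration.integral_mult_right_zero)
  also have "\<dots> = exp (- of_real \<alpha> * Ln_ii (z \<bullet> x / \<beta>))"
    using G assms by (simp add: less_imp_neq[symmetric] flip: of_real_mult)
  finally show ?thesis .
qed

lemma law_convolution:
  fixes \<mu> \<nu> :: "(real ^ 'n) measure"
  assumes "law \<mu>" "law \<nu>" shows "law (\<mu> \<star> \<nu>)"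
proof -
  interpret \<mu>: prob_space \<mu> using assms by (simp add: law_def)
  interpret \<nu>: prob_space \<nu> using assms by (simp add: law_def)
  interpret P: pair_prob_space \<mu> \<nu> ..
  have [measurable_cong]: "sets \<mu> = sets borel" "sets \<nu> = sets borel" using assms by (simp_all add: law_def)
  show ?thesis unfolding law_def convolution_def by (auto intro!: P.P.prob_space_distr)
qed

lemma char_fun_convolution:
  fixes \<mu> \<nu> :: "(real ^ 'n) measure"
  assumes "law \<mu>" "law \<nu>" shows "char_fun (\<mu> \<star> \<nu>) z = char_fun \<mu> z * char_fun \<nu> z"
proof -
  interpret \<mu>: prob_space \<mu> using assms by (simp add: law_def)
  interpret \<nu>: prob_space \<nu> using assms by (simp add: law_def)
  interpret P: pair_prob_space \<mu> \<nu> ..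
  have [measurable_cong]: "sets \<mu> = sets borel" "sets \<nu> = sets borel" using assms by (simp_all add: law_def)
  let ?e = "\<lambda>x. iexp (z \<bullet> x)"
  have int: "integrable (\<mu> \<Otimes>\<^sub>M \<nu>) (\<lambda>p. ?e (fst p + snd p))"
    by (rule P.P.integrable_const_bound[of _ 1], simp) measurable
  have "char_fun (\<mu> \<star> \<nu>) z = (\<integral>p. ?e (fst p + snd p) \<partial>(\<mu> \<Otimes>\<^sub>M \<nu>))"
    unfolding char_fun_def convolution_def by (subst integral_distr) (auto simp: case_prod_beta)
  also have "\<dots> = (\<integral>x. \<integral>y. ?e (x + y) \<partial>\<nu> \<partial>\<mu>)"
    using P.integral_fst'[OF int] by simp
  also have "\<dots> = (\<integral>x. \<integral>y. ?e x * ?e y \<partial>\<nu> \<partial>\<mu>)"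
    by (simp add: inner_add_right distrib_left exp_add)
  also have "\<dots> = char_fun \<mu> z * char_fun \<nu> z"
    unfolding char_fun_def by (simp only: Bochner_Integration.integral_mult_right_zero Bochner_Integration.integral_mult_left_zero)
  finally show ?thesis .
qed

text \<open>A gamma law enters only through its shape and the quotient of vector and rate, so the
  rate is normalised to 1 and absorbed in y.\<close>

definition gamma_exponent :: "real \<Rightarrow> real ^ 'n \<Rightarrow> real ^ 'n \<Rightarrow> complex" where
  "gamma_exponent \<alpha> y z = - of_real \<alpha> * Ln_ii (z \<bullet> y)"

lemma gamma_exponent_trivial [simp]: "gamma_exponent 0 y = (\<lambda>z. 0)" "gamma_exponent \<alpha> 0 = (\<lambda>z. 0)"
  by (simp_all add: gamma_exponent_def fun_eq_iff)

lemma continuous_on_gamma_exponent: "continuous_on A (gamma_exponent \<alpha> y)"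
  unfolding gamma_exponent_def[abs_def] by (intro continuous_intros) (auto simp: complex_nonpos_Reals_iff)

text \<open>The clauses copy those of \<open>gamma_convolutions\<close>, with convolution turned
  into addition, so that laws can be constructed along the same induction.\<close>

inductive_set gamma_exponents :: "(real ^ 'n \<Rightarrow> complex) set" where
  single: "\<alpha> > 0 \<Longrightarrow> y \<noteq> 0 \<Longrightarrow> gamma_exponent \<alpha> y \<in> gamma_exponents"
| add: "\<psi> \<in> gamma_exponents \<Longrightarrow> \<alpha> > 0 \<Longrightarrow> y \<noteq> 0 \<Longrightarrow>
     (\<lambda>z. \<psi> z + gamma_exponent \<alpha> y z) \<in> gamma_exponents"

lemma gamma_exponents_add:
  assumes "\<psi> \<in> gamma_exponents" "\<phi> \<in> gamma_exponents"
  shows "(\<lambda>z. \<psi> z + \<phi> z) \<in> gamma_exponents"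
  using assms(2)
proof induction
  case (single \<alpha> y)
  then show ?case using assms(1) by (intro gamma_exponents.add)
next
  case (add \<phi> \<alpha> y)
  then show ?case
    using gamma_exponents.add[of "\<lambda>z. \<psi> z + \<phi> z" \<alpha> y] by (simp add: add.assoc)
qed

lemma gamma_exponents_continuous: "\<psi> \<in> gamma_exponents \<Longrightarrow> continuous_on A \<psi>"
  by (induction rule: gamma_exponents.induct) (auto intro!: continuous_on_gamma_exponent continuous_intros)

lemma gamma_exponents_zero: "\<psi> \<in> gamma_exponents \<Longrightarrow> \<psi> 0 = 0"
  by (induction rule: gamma_exponents.induct) (auto simp: gamma_exponent_def)

lemma gamma_exponents_imp_gamma_convolution:
  "\<psi> \<in> gamma_exponents \<Longrightarrow> \<exists>\<mu>\<in>gamma_convolutions. law \<mu> \<and> (\<forall>z. char_fun \<mu> z = exp (\<psi> z))"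
proof (induction rule: gamma_exponents.induct)
  case (single \<alpha> y)
  then show ?case
    by (intro bexI[of _ "elementary_gamma_law \<alpha> 1 y"] conjI law_elementary_gamma_law gamma_convolutions.single)
       (auto simp: char_fun_elementary_gamma_law gamma_exponent_def)
next
  case (add \<psi> \<alpha> y)
  then obtain \<mu> where \<mu>: "\<mu> \<in> gamma_convolutions" "law \<mu>" "\<And>z. char_fun \<mu> z = exp (\<psi> z)" by blast
  with add show ?case
    by (intro bexI[of _ "\<mu> \<star> elementary_gamma_law \<alpha> 1 y"] conjI law_convolution law_elementary_gamma_law gamma_convolutions.conv)
       (auto simp: char_fun_elementary_gamma_law gamma_exponent_def char_fun_convolution law_elementary_gamma_law
         simp flip: exp_add)
qed

text \<open>The closure of \<open>gamma_exponents\<close> for uniform convergence on bounded sets.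
  With one radius and one error instead of sequences, sums and iterated limits become \<epsilon> / 2
  arguments.\<close>

definition thorin_exponents :: "(real ^ 'n \<Rightarrow> complex) set" where
  "thorin_exponents = {\<psi>. \<forall>R. \<forall>\<epsilon>>0. \<exists>\<phi>\<in>gamma_exponents. \<forall>z. norm z \<le> R \<longrightarrow> cmod (\<psi> z - \<phi> z) \<le> \<epsilon>}"

lemma thorin_exponentsD:
  assumes "\<psi> \<in> thorin_exponents" "\<epsilon> > 0"
  obtains \<phi> where "\<phi> \<in> gamma_exponents" "\<And>z. norm z \<le> R \<Longrightarrow> cmod (\<psi> z - \<phi> z) \<le> \<epsilon>"
  using assms unfolding thorin_exponents_def by blast

lemma thorin_exponents_add:
  assumes "\<psi>\<^sub>1 \<in> thorin_exponents" "\<psi>\<^sub>2 \<in> thorin_exponents"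
  shows "(\<lambda>z. \<psi>\<^sub>1 z + \<psi>\<^sub>2 z) \<in> thorin_exponents"
  unfolding thorin_exponents_def
proof (intro CollectI allI impI)
  fix R \<epsilon> :: real assume \<epsilon>: "\<epsilon> > 0"
  obtain \<phi>\<^sub>1 where 1: "\<phi>\<^sub>1 \<in> gamma_exponents" "\<And>z. norm z \<le> R \<Longrightarrow> cmod (\<psi>\<^sub>1 z - \<phi>\<^sub>1 z) \<le> \<epsilon> / 2"
    using thorin_exponentsD[OF assms(1), of "\<epsilon> / 2" R] \<epsilon> by auto
  obtain \<phi>\<^sub>2 where 2: "\<phi>\<^sub>2 \<in> gamma_exponents" "\<And>z. norm z \<le> R \<Longrightarrow> cmod (\<psi>\<^sub>2 z - \<phi>\<^sub>2 z) \<le> \<epsilon> / 2"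
    using thorin_exponentsD[OF assms(2), of "\<epsilon> / 2" R] \<epsilon> by auto
  have "cmod (\<psi>\<^sub>1 z + \<psi>\<^sub>2 z - (\<phi>\<^sub>1 z + \<phi>\<^sub>2 z)) \<le> \<epsilon>" if "norm z \<le> R" for z
    using norm_triangle_ineq[of "\<psi>\<^sub>1 z - \<phi>\<^sub>1 z" "\<psi>\<^sub>2 z - \<phi>\<^sub>2 z"] 1(2)[OF that] 2(2)[OF that] by (simp add: algebra_simps)
  then show "\<exists>\<phi>\<in>gamma_exponents. \<forall>z. norm z \<le> R \<longrightarrow> cmod (\<psi>\<^sub>1 z + \<psi>\<^sub>2 z - \<phi> z) \<le> \<epsilon>"
    by (intro bexI[OF _ gamma_exponents_add[OF 1(1) 2(1)]]) simp
qed

text \<open>The closure is closed. Approximations need only be supplied for R > 0, as the radius may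
  be raised to max R 1; several applications divide by R.\<close>

lemma thorin_exponents_limit:
  assumes "\<And>R \<epsilon>. \<epsilon> > 0 \<Longrightarrow> R > 0 \<Longrightarrow> \<exists>\<phi>\<in>thorin_exponents. \<forall>z. norm z \<le> R \<longrightarrow> cmod (\<psi> z - \<phi> z) \<le> \<epsilon>"
  shows "\<psi> \<in> thorin_exponents"
  unfolding thorin_exponents_def
proof (intro CollectI allI impI)
  fix R \<epsilon> :: real assume \<epsilon>: "\<epsilon> > 0"
  obtain \<phi> where \<phi>: "\<phi> \<in> thorin_exponents" "\<And>z. norm z \<le> max R 1 \<Longrightarrow> cmod (\<psi> z - \<phi> z) \<le> \<epsilon> / 2"
    using assms[OF half_gt_zero[OF \<epsilon>], of "max R 1"] max.strict_coboundedI2[OF zero_less_one, of R] by blast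
  obtain \<phi>' where \<phi>': "\<phi>' \<in> gamma_exponents" "\<And>z. norm z \<le> R \<Longrightarrow> cmod (\<phi> z - \<phi>' z) \<le> \<epsilon> / 2"
    using thorin_exponentsD[OF \<phi>(1), of "\<epsilon> / 2" R] \<epsilon> by auto
  have "cmod (\<psi> z - \<phi>' z) \<le> \<epsilon>" if "norm z \<le> R" for z
    using norm_triangle_ineq[of "\<psi> z - \<phi> z" "\<phi> z - \<phi>' z"] \<phi>(2)[OF max.coboundedI1[OF that]] \<phi>'(2)[OF that] by simp
  then show "\<exists>\<phi>\<in>gamma_exponents. \<forall>z. norm z \<le> R \<longrightarrow> cmod (\<psi> z - \<phi> z) \<le> \<epsilon>"
    using \<phi>'(1) by blast
qed

lemma gamma_exponents_subset_thorin_exponents: "\<psi> \<in> gamma_exponents \<Longrightarrow> \<psi> \<in> thorin_exponents"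
  unfolding thorin_exponents_def by (auto intro!: bexI[of _ \<psi>])

lemma thorin_exponents_sequence:
  assumes "\<psi> \<in> thorin_exponents"
  obtains \<phi> where "\<And>k. \<phi> k \<in> gamma_exponents"
    "\<And>k z. norm z \<le> real k \<Longrightarrow> cmod (\<psi> z - \<phi> k z) \<le> 1 / real (Suc k)"
proof -
  have "\<exists>\<phi>\<in>gamma_exponents. \<forall>z. norm z \<le> real k \<longrightarrow> cmod (\<psi> z - \<phi> z) \<le> 1 / real (Suc k)" for k
    using assms unfolding thorin_exponents_def by auto
  then show thesis using that by metis
qed

lemma thorin_exponents_zero_at_0:
  assumes "\<psi> \<in> thorin_exponents" shows "\<psi> 0 = 0"
proof -
  have "cmod (\<psi> 0) \<le> \<epsilon>" if \<epsilon>: "\<epsilon> > 0" for \<epsilon>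
  proof -
    obtain \<phi> where "\<phi> \<in> gamma_exponents" "\<And>z. norm z \<le> 1 \<Longrightarrow> cmod (\<psi> z - \<phi> z) \<le> \<epsilon>"
      using thorin_exponentsD[OF assms \<epsilon>, of 1] by blast
    from this(2)[of 0] gamma_exponents_zero[OF this(1)] show ?thesis by simp
  qed
  then show ?thesis using field_le_epsilon[of "cmod (\<psi> 0)" 0] by simp
qed

lemma thorin_exponents_continuous:
  fixes z :: "real ^ 'n"
  assumes "\<psi> \<in> thorin_exponents" shows "isCont \<psi> z"
proof -
  obtain \<phi> where \<phi>: "\<And>k. \<phi> k \<in> gamma_exponents"
    "\<And>k z. norm z \<le> real k \<Longrightarrow> cmod (\<psi> z - \<phi> k z) \<le> 1 / real (Suc k)"
    using thorin_exponents_sequence[OF assms] by blast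
  let ?B = "ball (0 :: real ^ 'n) (norm z + 1)"
  have "continuous_on ?B \<psi>"
  proof (rule uniform_limit_theorem)
    show "\<forall>\<^sub>F k in sequentially. continuous_on ?B (\<phi> k)"
      using gamma_exponents_continuous[OF \<phi>(1)] by simp
    show "uniform_limit ?B \<phi> \<psi> sequentially"
    proof (rule uniform_limitI)
      fix e :: real assume "e > 0"
      have "\<forall>\<^sub>F k in sequentially. 1 / real (Suc k) < e"
        using order_tendstoD(2)[OF LIMSEQ_Suc[OF lim_1_over_n] \<open>e > 0\<close>] by simp
      moreover have "\<forall>\<^sub>F k in sequentially. norm z + 1 \<le> real k"
        using filterlim_real_sequentially by (auto simp: filterlim_at_top)
      ultimately show "\<forall>\<^sub>F k in sequentially. \<forall>x\<in>?B. dist (\<phi> k x) (\<psi> x) < e"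
      proof eventually_elim
        case (elim k)
        show ?case
        proof
          fix x assume "x \<in> ?B"
          then have "cmod (\<psi> x - \<phi> k x) \<le> 1 / real (Suc k)" using elim by (intro \<phi>(2)) auto
          then show "dist (\<phi> k x) (\<psi> x) < e" using elim by (simp add: dist_norm norm_minus_commute)
        qed
      qed
    qed
  qed auto
  then show ?thesis by (simp add: continuous_on_eq_continuous_at)
qed

text \<open>Locally uniform approximation supplies both inputs of the continuity theorem: pointwise
  convergence of the characteristic functions and continuity of the limit at 0. The function \<psi>
  is itself continuous with value 0 at 0, hence the distinguished exponent of the limit law.\<close>

lemma thorin_exponents_imp_thorin_class:
  assumes "\<psi> \<in> thorin_exponents"
  shows "\<exists>\<mu>\<in>thorin_class. is_char_exponent \<mu> \<psi>"
proof -
  obtain \<phi> where \<phi>: "\<And>k. \<phi> k \<in> gamma_exponents"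
    "\<And>k z. norm z \<le> real k \<Longrightarrow> cmod (\<psi> z - \<phi> k z) \<le> 1 / real (Suc k)"
    using thorin_exponents_sequence[OF assms] by blast
  obtain M where M: "\<And>k. M k \<in> gamma_convolutions" "\<And>k. law (M k)" "\<And>k z. char_fun (M k) z = exp (\<phi> k z)"
    using gamma_exponents_imp_gamma_convolution[OF \<phi>(1)] by metis
  have "(\<lambda>k. \<phi> k z) \<longlonglongrightarrow> \<psi> z" for z
  proof -
    have "(\<lambda>k. \<phi> k z - \<psi> z) \<longlonglongrightarrow> 0"
    proof (rule Lim_null_comparison)
      have "\<forall>\<^sub>F k in sequentially. norm z \<le> real k"
        using filterlim_real_sequentially by (auto simp: filterlim_at_top)
      then show "\<forall>\<^sub>F k in sequentially. cmod (\<phi> k z - \<psi> z) \<le> 1 / real (Suc k)"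
        by eventually_elim (metis \<phi>(2) norm_minus_commute)
      show "(\<lambda>k. 1 / real (Suc k)) \<longlonglongrightarrow> 0" by (rule LIMSEQ_Suc[OF lim_1_over_n])
    qed
    then show ?thesis by (rule LIM_zero_cancel)
  qed
  then have "(\<lambda>k. char_fun (M k) z) \<longlonglongrightarrow> exp (\<psi> z)" for z
    unfolding M(3) by (rule tendsto_exp)
  moreover have "isCont (\<lambda>z. exp (\<psi> z)) 0"
    using thorin_exponents_continuous[OF assms] by (intro continuous_intros) auto
  ultimately obtain s \<mu> where "law \<mu>" "weakly_converges (M \<circ> s) \<mu>" "\<And>z. char_fun \<mu> z = exp (\<psi> z)"
    using levy_continuity_vec[of M "\<lambda>z. exp (\<psi> z)", OF M(2)] by blast
  then have "\<mu> \<in> thorin_class" "is_char_exponent \<mu> \<psi>"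
    using M(1) thorin_exponents_continuous[OF assms] thorin_exponents_zero_at_0[OF assms]
    by (auto simp: thorin_class_def is_char_exponent_def continuous_on_eq_continuous_at intro!: exI[of _ "M \<circ> s"])
  then show ?thesis by blast
qed

text \<open>Elementary gamma laws are nondegenerate, so the point mass at 0 arises only as a limit
  of laws with shrinking y.\<close>

lemma thorin_exponents_zero: "(\<lambda>z :: real ^ 'n. 0) \<in> thorin_exponents"
proof (rule thorin_exponents_limit)
  fix R \<epsilon> :: real assume \<epsilon>: "\<epsilon> > 0" and R: "R > 0"
  \<comment> \<open>Any vector of length \<epsilon> / R would do, since |Ln (1 - i t)| <= |t|;
    \<open>undefined\<close> merely names a coordinate.\<close>
  define y :: "real ^ 'n" where "y = (\<epsilon> / R) *\<^sub>R axis undefined 1"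
  have y: "y \<noteq> 0" "norm y = \<epsilon> / R" using \<epsilon> R by (auto simp: y_def axis_eq_0_iff norm_axis_1)
  have "cmod (0 - gamma_exponent 1 y z) \<le> \<epsilon>" if "norm z \<le> R" for z
  proof -
    have "cmod (0 - gamma_exponent 1 y z) \<le> \<bar>z \<bullet> y\<bar>"
      using cmod_Ln_ii_le[of "z \<bullet> y"] by (simp add: gamma_exponent_def)
    also have "\<dots> \<le> norm z * norm y" by (rule Cauchy_Schwarz_ineq2)
    also have "\<dots> \<le> R * (\<epsilon> / R)" unfolding y(2) using that \<epsilon> R by (intro mult_right_mono) auto
    finally show ?thesis using R by simp
  qed
  then show "\<exists>\<phi>\<in>(thorin_exponents :: (real ^ 'n \<Rightarrow> complex) set). \<forall>z. norm z \<le> R \<longrightarrow> cmod (0 - \<phi> z) \<le> \<epsilon>"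
    by (intro bexI[OF _ gamma_exponents_subset_thorin_exponents[OF gamma_exponents.single[OF zero_less_one y(1)]]]) simp
qed

section \<open>Members of the closure: drifts, Gaussian parts and bounded integrals\<close>

lemma thorin_exponents_sum:
  "finite A \<Longrightarrow> (\<And>i. i \<in> A \<Longrightarrow> \<psi> i \<in> thorin_exponents) \<Longrightarrow> (\<lambda>z. \<Sum>i\<in>A. \<psi> i z) \<in> thorin_exponents"
  by (induction A rule: finite_induct) (auto intro: thorin_exponents_zero thorin_exponents_add)

text \<open>Shape 0 or vector 0 yields the zero function, available in the closure. Sums over the
  values of a simple function thus avoid case distinctions.\<close>

lemma gamma_exponent_in_thorin_exponents:
  assumes "\<alpha> \<ge> 0" shows "gamma_exponent \<alpha> y \<in> thorin_exponents"
proof (cases "\<alpha> = 0 \<or> y = 0")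
  case False
  then show ?thesis
    using assms by (intro gamma_exponents_subset_thorin_exponents gamma_exponents.single) auto
qed (auto intro: thorin_exponents_zero)

text \<open>A law of large numbers: the gamma law of shape n along b / n has mean b and concentrates
  there. The linear Taylor bound leaves an error of at most n (R |b| / n)^2.\<close>

lemma drift_in_thorin_exponents:
  fixes b :: "real ^ 'n"
  shows "(\<lambda>z. \<i> * of_real (z \<bullet> b)) \<in> thorin_exponents"
proof (rule thorin_exponents_limit)
  fix R \<epsilon> :: real assume \<epsilon>: "\<epsilon> > 0" and R: "R > 0"
  obtain n :: nat where n: "n > 0" "(R * norm b)\<^sup>2 / real n \<le> \<epsilon>"
  proof -
    obtain n :: nat where "(R * norm b)\<^sup>2 / \<epsilon> < real n" using reals_Archimedean2 by blast
    then have "(R * norm b)\<^sup>2 / \<epsilon> < real (Suc n)" by simp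
    then show thesis using \<epsilon> by (intro that[of "Suc n"]) (auto simp: field_simps)
  qed
  let ?g = "gamma_exponent (real n) ((1 / real n) *\<^sub>R b)"
  have "cmod (\<i> * of_real (z \<bullet> b) - ?g z) \<le> \<epsilon>" if z: "norm z \<le> R" for z
  proof -
    define t where "t = (z \<bullet> b) / real n"
    have "\<i> * of_real (z \<bullet> b) - ?g z = of_real (real n) * (Ln_ii t + \<i> * of_real t)"
      using n by (simp add: gamma_exponent_def t_def algebra_simps)
    then have "cmod (\<i> * of_real (z \<bullet> b) - ?g z) \<le> real n * t\<^sup>2"
      using mult_left_mono[OF cmod_Ln_ii_linear[of t], of "real n"] by (simp add: norm_mult)
    also have "\<dots> = \<bar>z \<bullet> b\<bar>\<^sup>2 / real n" using n by (simp add: t_def power_divide power2_eq_square)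
    also have "\<dots> \<le> (R * norm b)\<^sup>2 / real n"
    proof (intro divide_right_mono power_mono)
      show "\<bar>z \<bullet> b\<bar> \<le> R * norm b"
        using Cauchy_Schwarz_ineq2[of z b] mult_right_mono[OF z norm_ge_zero[of b]] by linarith
    qed auto
    finally show ?thesis using n by simp
  qed
  then show "\<exists>\<phi>\<in>thorin_exponents. \<forall>z. norm z \<le> R \<longrightarrow> cmod (\<i> * of_real (z \<bullet> b) - \<phi> z) \<le> \<epsilon>"
    using n by (intro bexI[of _ ?g] gamma_exponent_in_thorin_exponents) auto
qed

text \<open>A central limit theorem: shape n along v / sqrt n gives covariance v v^T, and the drift
  - sqrt n v removes the mean. The cubic Taylor bound leaves (R |v|)^3 / sqrt n.\<close>

lemma gaussian_rank_one_in_thorin_exponents: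
  fixes v :: "real ^ 'n"
  shows "(\<lambda>z. - of_real ((z \<bullet> v)\<^sup>2 / 2)) \<in> thorin_exponents"
proof (rule thorin_exponents_limit)
  fix R \<epsilon> :: real assume \<epsilon>: "\<epsilon> > 0" and R: "R > 0"
  obtain n :: nat where n: "n > 0" "(R * norm v) ^ 3 / sqrt (real n) \<le> \<epsilon>"
  proof -
    obtain n :: nat where n: "((R * norm v) ^ 3 / \<epsilon>)\<^sup>2 < real n" using reals_Archimedean2 by blast
    then have "((R * norm v) ^ 3 / \<epsilon>)\<^sup>2 < real (Suc n)" by simp
    then have "(R * norm v) ^ 3 / \<epsilon> \<le> sqrt (real (Suc n))" by (intro real_le_rsqrt) simp
    then have "(R * norm v) ^ 3 / sqrt (real (Suc n)) \<le> \<epsilon>" using \<epsilon>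
      by (simp add: divide_le_eq mult.commute)
    then show thesis by (intro that[of "Suc n"]) auto
  qed
  define q where "q = sqrt (real n)"
  have q: "q > 0" "q * q = real n" using n by (auto simp: q_def)
  let ?g = "\<lambda>z. gamma_exponent (real n) ((1 / q) *\<^sub>R v) z + \<i> * of_real (z \<bullet> (- q *\<^sub>R v))"
  have "cmod (- of_real ((z \<bullet> v)\<^sup>2 / 2) - ?g z) \<le> \<epsilon>" if z: "norm z \<le> R" for z
  proof -
    define t where "t = (z \<bullet> v) / q"
    have zv: "z \<bullet> v = q * t" using q by (simp add: t_def)
    have "- of_real ((z \<bullet> v)\<^sup>2 / 2) - ?g z = of_real (real n) * (Ln_ii t + \<i> * of_real t - of_real (t\<^sup>2 / 2))"
      using q by (simp add: gamma_exponent_def zv q(2)[symmetric] algebra_simps power2_eq_square)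
    then have "cmod (- of_real ((z \<bullet> v)\<^sup>2 / 2) - ?g z) \<le> real n * \<bar>t\<bar> ^ 3"
      using mult_left_mono[OF cmod_Ln_ii_quadratic[of t], of "real n"] by (simp add: norm_mult)
    also have "\<dots> = \<bar>z \<bullet> v\<bar> ^ 3 / q"
      using q by (simp add: t_def power3_eq_cube abs_divide q(2)[symmetric])
    also have "\<dots> \<le> (R * norm v) ^ 3 / q"
    proof (intro divide_right_mono power_mono)
      show "\<bar>z \<bullet> v\<bar> \<le> R * norm v"
        using Cauchy_Schwarz_ineq2[of z v] mult_right_mono[OF z norm_ge_zero[of v]] by linarith
    qed (use q in auto)
    finally show ?thesis using n by (simp add: q_def)
  qed
  then show "\<exists>\<phi>\<in>thorin_exponents. \<forall>z. norm z \<le> R \<longrightarrow> cmod (- of_real ((z \<bullet> v)\<^sup>2 / 2) - \<phi> z) \<le> \<epsilon>"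
    using n by (intro bexI[of _ ?g] thorin_exponents_add gamma_exponent_in_thorin_exponents drift_in_thorin_exponents) auto
qed

text \<open>
  A nonnegative self-adjoint operator is a sum of rank one ones: one step of the elimination
  makes it vanish on a further basis vector and keeps it nonnegative by the Cauchy--Schwarz inequality.
\<close>

lemma gaussian_in_thorin_exponents_aux:
  fixes L :: "real ^ 'n \<Rightarrow> real ^ 'n"
  assumes "finite A" "linear L" "\<And>x y. L x \<bullet> y = x \<bullet> L y" "\<And>x. 0 \<le> L x \<bullet> x"
    and "\<And>j. j \<notin> A \<Longrightarrow> L (axis j 1) = 0"
  shows "(\<lambda>z. - of_real (L z \<bullet> z / 2)) \<in> thorin_exponents"
  using assms
proof (induction A arbitrary: L rule: finite_induct)
  case empty
  have "L z = 0" for z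
  proof -
    have "L z = L (\<Sum>i\<in>UNIV. (z $ i) *\<^sub>R axis i 1)"
      using basis_expansion[of z] by (simp add: scalar_mult_eq_scaleR)
    also have "\<dots> = (\<Sum>i\<in>UNIV. (z $ i) *\<^sub>R L (axis i 1))"
      using \<open>linear L\<close> by (simp add: linear_sum linear_cmul)
    finally show ?thesis using empty by simp
  qed
  then show ?case using thorin_exponents_zero by simp
next
  case (insert a A)
  note lin = \<open>linear L\<close> and adj = insert.prems(2) and pos = insert.prems(3)
  define v :: "real ^ 'n" where "v = axis a 1"
  define w where "w = L v"
  define c where "c = w \<bullet> v"
  have quad: "0 \<le> L y \<bullet> y + 2 * t * (w \<bullet> y) + t\<^sup>2 * c" for y t
  proof -
    have "L (y + t *\<^sub>R v) \<bullet> (y + t *\<^sub>R v) = L y \<bullet> y + 2 * t * (w \<bullet> y) + t\<^sup>2 * c"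
      using adj[of y v] by (simp add: linear_add[OF lin] linear_cmul[OF lin] w_def c_def inner_add_left inner_add_right
        algebra_simps power2_eq_square inner_commute)
    then show ?thesis using pos by metis
  qed
  have "c \<ge> 0" using pos[of v] by (simp add: c_def w_def)
  show ?case
  proof (cases "c = 0")
    case True
    have "w \<bullet> w = 0"
    proof (rule ccontr)
      assume "w \<bullet> w \<noteq> 0"
      \<comment> \<open>With c = 0 the form in \<open>quad\<close> is affine in t with slope 2
        |w|^2; this choice of t brings it down to - (L w . w) - 2, which is negative.\<close>
      then have "2 * (- (L w \<bullet> w + 1) / (w \<bullet> w)) * (w \<bullet> w) = - 2 * (L w \<bullet> w + 1)" by simp
      then show False
        using quad[of w "- (L w \<bullet> w + 1) / (w \<bullet> w)"] pos[of w] True by simp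
    qed
    then have "L (axis a 1) = 0" by (simp add: w_def v_def)
    then have "L (axis j 1) = 0" if "j \<notin> A" for j
      using insert.prems(4)[of j] that by (cases "j = a") auto
    then show ?thesis using insert.prems by (intro insert.IH)
  next
    case False
    with \<open>c \<ge> 0\<close> have c: "c > 0" by simp
    \<comment> \<open>The Schur complement of the pivot c. The part removed from the quadratic form
      is (w . z)^2 / c, the rank one form of w / sqrt c.\<close>
    define L' where "L' z = L z - ((w \<bullet> z) / c) *\<^sub>R w" for z
    have L'_form: "L' z \<bullet> y = L z \<bullet> y - (w \<bullet> z) * (w \<bullet> y) / c" for z y
      by (simp add: L'_def inner_diff_left)
    have "(\<lambda>z. - of_real (L' z \<bullet> z / 2)) \<in> thorin_exponents"
    proof (rule insert.IH)
      show "linear L'"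
        by (rule linearI) (simp_all add: L'_def linear_add[OF lin] linear_cmul[OF lin] algebra_simps
          inner_add_right add_divide_distrib)
      show "L' x \<bullet> y = x \<bullet> L' y" for x y
        using L'_form[of x y] L'_form[of y x] adj[of x y] by (simp add: inner_commute mult.commute)
      show "0 \<le> L' x \<bullet> x" for x
      proof -
        \<comment> \<open>The value t = - (w . x) / c minimises the polynomial in
          \<open>quad\<close>, and the minimum is the new form at x.\<close>
        have "0 \<le> L x \<bullet> x + 2 * (- (w \<bullet> x) / c) * (w \<bullet> x) + (- (w \<bullet> x) / c)\<^sup>2 * c" by (rule quad)
        also have "\<dots> = L' x \<bullet> x" using c by (simp add: L'_form field_simps power2_eq_square)
        finally show ?thesis .
      qed
      show "L' (axis j 1) = 0" if "j \<notin> A" for j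
      proof (cases "j = a")
        case True
        then show ?thesis using c by (simp add: L'_def w_def[unfolded v_def, symmetric] c_def[unfolded v_def])
      next
        case False
        then have "L (axis j 1) = 0" using that insert.prems by simp
        \<comment> \<open>Self-adjointness gives w . e_j = v . L e_j = 0, so a basis vector
          annihilated before stays annihilated.\<close>
        moreover have "w \<bullet> axis j 1 = 0" using adj[of v "axis j 1"] calculation by (simp add: w_def)
        ultimately show ?thesis by (simp add: L'_def)
      qed
    qed
    from thorin_exponents_add[OF this gaussian_rank_one_in_thorin_exponents[of "(1 / sqrt c) *\<^sub>R w"]]
    show ?thesis
    proof (rule back_subst[of "\<lambda>f. f \<in> thorin_exponents"])
      have "- (L' z \<bullet> z / 2) + - ((z \<bullet> ((1 / sqrt c) *\<^sub>R w))\<^sup>2 / 2) = - (L z \<bullet> z / 2)" for z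
      proof -
        have "(z \<bullet> ((1 / sqrt c) *\<^sub>R w))\<^sup>2 = (w \<bullet> z) * (w \<bullet> z) / c"
          using c by (simp add: power_divide inner_commute power2_eq_square)
        then show ?thesis using L'_form[of z z] by linarith
      qed
      then have "- complex_of_real (L' z \<bullet> z / 2) + - of_real ((z \<bullet> ((1 / sqrt c) *\<^sub>R w))\<^sup>2 / 2) = - of_real (L z \<bullet> z / 2)" for z
        by (simp only: of_real_minus[symmetric] of_real_add[symmetric])
      then show "(\<lambda>z. - complex_of_real (L' z \<bullet> z / 2) + - of_real ((z \<bullet> ((1 / sqrt c) *\<^sub>R w))\<^sup>2 / 2))
          = (\<lambda>z. - of_real (L z \<bullet> z / 2))"
        by (intro ext)
    qed
  qed
qed

lemma gaussian_in_thorin_exponents: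
  fixes S :: "real ^ 'n ^ 'n"
  assumes "symmetric_nonneg_def S"
  shows "(\<lambda>z. - (of_real ((S *v z) \<bullet> z) / 2)) \<in> thorin_exponents"
proof -
  have "(\<lambda>z. - of_real ((S *v z) \<bullet> z / 2)) \<in> thorin_exponents"
  proof (rule gaussian_in_thorin_exponents_aux[of UNIV])
    show "(S *v x) \<bullet> y = x \<bullet> (S *v y)" for x y
      using assms dot_lmul_matrix[of x S y] by (metis symmetric_nonneg_def_def vector_transpose_matrix)
  qed (use assms in \<open>auto simp: symmetric_nonneg_def_def\<close>)
  then show ?thesis by simp
qed

lemma Ln_ii_measurable: "(\<lambda>t. Ln_ii t) \<in> borel_measurable borel"
  by (intro borel_measurable_continuous_onI continuous_intros) (auto simp: complex_nonpos_Reals_iff)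

text \<open>For a simple function the integral is a finite sum of gamma exponents, the masses of the
  level sets being the shapes. The Lipschitz bound of the logarithm makes the error at most R times
  the L1 distance, uniformly over |z| <= R.\<close>

lemma thorin_integral_in_thorin_exponents:
  fixes f :: "'a \<Rightarrow> real ^ 'n"
  assumes "finite_measure M" and f[measurable]: "f \<in> borel_measurable M"
    and B: "\<And>x. x \<in> space M \<Longrightarrow> norm (f x) \<le> B"
  shows "(\<lambda>z. - (\<integral>x. Ln_ii (z \<bullet> f x) \<partial>M)) \<in> thorin_exponents"
proof (rule thorin_exponents_limit)
  interpret finite_measure M by fact
  fix R \<epsilon> :: real assume \<epsilon>: "\<epsilon> > 0" and R: "R > 0"
  obtain F where "(\<forall>i. simple_function M (F i)) \<and> (\<forall>x\<in>space M. (\<lambda>i. F i x) \<longlonglongrightarrow> f x) \<and>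
      (\<forall>i. \<forall>x\<in>space M. dist (F i x) 0 \<le> 2 * dist (f x) 0)"
    using borel_measurable_implies_sequence_metric[OF f] by blast
  then have F: "\<And>i. simple_function M (F i)" "\<And>x. x \<in> space M \<Longrightarrow> (\<lambda>i. F i x) \<longlonglongrightarrow> f x"
    "\<And>i x. x \<in> space M \<Longrightarrow> norm (F i x) \<le> 2 * norm (f x)"
    by (simp_all add: dist_norm)
  have [measurable]: "F i \<in> borel_measurable M" for i
    using F(1) by (rule borel_measurable_simple_function)
  have FB: "norm (F i x) \<le> 2 * B" if "x \<in> space M" for i x
    using F(3)[OF that, of i] B[OF that] by simp
  have "(\<lambda>i. \<integral>x. norm (f x - F i x) \<partial>M) \<longlonglongrightarrow> (\<integral>x. 0 \<partial>M)"
  proof (rule integral_dominated_convergence[where w="\<lambda>_. 3 * B"])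
    show "AE x in M. (\<lambda>i. norm (f x - F i x)) \<longlonglongrightarrow> 0"
      using F(2) by (auto intro!: AE_I2 tendsto_eq_intros)
    show "AE x in M. norm (norm (f x - F i x)) \<le> 3 * B" for i
    proof (rule AE_I2)
      fix x assume "x \<in> space M"
      then show "norm (norm (f x - F i x)) \<le> 3 * B"
        using norm_triangle_ineq4[of "f x" "F i x"] B[of x] FB[of x i] by simp
    qed
  qed auto
  then have "(\<lambda>i. \<integral>x. norm (f x - F i x) \<partial>M) \<longlonglongrightarrow> 0" by simp
  from order_tendstoD(2)[OF this divide_pos_pos[OF \<epsilon> R]]
  obtain i where i: "(\<integral>x. norm (f x - F i x) \<partial>M) < \<epsilon> / R"
    using eventually_happens'[OF sequentially_bot] by blast
  let ?L = "\<lambda>z y. Ln_ii (z \<bullet> y)"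
  have int_L: "integrable M (\<lambda>x. ?L z (g x))"
    if [measurable]: "g \<in> borel_measurable M" and g: "\<And>x. x \<in> space M \<Longrightarrow> norm (g x) \<le> C" for g :: "'a \<Rightarrow> real ^ 'n" and C z
  proof (rule integrable_const_bound[of _ "norm z * C"])
    show "AE x in M. norm (?L z (g x)) \<le> norm z * C"
    proof (rule AE_I2)
      fix x assume x: "x \<in> space M"
      have "norm (?L z (g x)) \<le> \<bar>z \<bullet> g x\<bar>" by (rule cmod_Ln_ii_le)
      also have "\<dots> \<le> norm z * norm (g x)" by (rule Cauchy_Schwarz_ineq2)
      also have "\<dots> \<le> norm z * C" using g[OF x] by (intro mult_left_mono) auto
      finally show "norm (?L z (g x)) \<le> norm z * C" .
    qed
  qed (rule measurable_compose[OF _ Ln_ii_measurable], measurable)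
  let ?\<phi> = "\<lambda>z. \<Sum>y\<in>F i ` space M. gamma_exponent (measure M (F i -` {y} \<inter> space M)) y z"
  have fin: "finite (F i ` space M)" using F(1) by (rule simple_functionD)
  have \<phi>: "?\<phi> z = - (\<integral>x. ?L z (F i x) \<partial>M)" for z
  proof -
    have meas: "F i -` {y} \<inter> space M \<in> sets M" for y using simple_functionD(2)[OF F(1)] .
    have "(\<integral>x. ?L z (F i x) \<partial>M) = (\<integral>x. (\<Sum>y\<in>F i ` space M. indicator (F i -` {y} \<inter> space M) x *\<^sub>R ?L z y) \<partial>M)"
    proof (rule Bochner_Integration.integral_cong[OF refl])
      fix x assume x: "x \<in> space M"
      have "(\<Sum>y\<in>F i ` space M. indicator (F i -` {y} \<inter> space M) x *\<^sub>R ?L z y) = (\<Sum>y\<in>F i ` space M. if y = F i x then ?L z y else 0)"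
        using x by (intro sum.cong) (auto simp: indicator_def)
      then show "?L z (F i x) = (\<Sum>y\<in>F i ` space M. indicator (F i -` {y} \<inter> space M) x *\<^sub>R ?L z y)"
        using fin x by (simp add: sum.delta')
    qed
    also have "\<dots> = (\<Sum>y\<in>F i ` space M. \<integral>x. indicator (F i -` {y} \<inter> space M) x *\<^sub>R ?L z y \<partial>M)"
      using meas by (intro Bochner_Integration.integral_sum integrable_scaleR_left integrable_real_indicator) (auto simp: emeasure_eq_measure)
    also have "\<dots> = (\<Sum>y\<in>F i ` space M. measure M (F i -` {y} \<inter> space M) *\<^sub>R ?L z y)"
      using meas by (intro sum.cong refl) (simp add: integral_scaleR_left emeasure_eq_measure)
    finally show ?thesis
      by (simp add: gamma_exponent_def sum_negf scaleR_conv_of_real)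
  qed
  have "cmod (- (\<integral>x. ?L z (f x) \<partial>M) - ?\<phi> z) \<le> \<epsilon>" if z: "norm z \<le> R" for z
  proof -
    have "- (\<integral>x. ?L z (f x) \<partial>M) - ?\<phi> z = (\<integral>x. ?L z (F i x) - ?L z (f x) \<partial>M)"
      unfolding \<phi> using int_L[of "F i" "2 * B" z] int_L[of f B z] FB B by simp
    then have "cmod (- (\<integral>x. ?L z (f x) \<partial>M) - ?\<phi> z) \<le> (\<integral>x. cmod (?L z (F i x) - ?L z (f x)) \<partial>M)"
      using integral_norm_bound[of M "\<lambda>x. ?L z (F i x) - ?L z (f x)"] by simp
    also have "\<dots> \<le> (\<integral>x. R * norm (f x - F i x) \<partial>M)"
    proof (rule integral_mono')
      show "integrable M (\<lambda>x. R * norm (f x - F i x))"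
      proof (rule integrable_const_bound[of _ "R * (3 * B)"])
        show "AE x in M. norm (R * norm (f x - F i x)) \<le> R * (3 * B)"
        proof (rule AE_I2)
          fix x assume "x \<in> space M"
          then have "norm (f x - F i x) \<le> 3 * B"
            using norm_triangle_ineq4[of "f x" "F i x"] B[of x] FB[of x i] by simp
          then show "norm (R * norm (f x - F i x)) \<le> R * (3 * B)" using R by (simp add: abs_mult)
        qed
      qed measurable
      fix x
      have "cmod (?L z (F i x) - ?L z (f x)) \<le> \<bar>z \<bullet> (F i x - f x)\<bar>"
        using cmod_Ln_ii_diff_le[of "z \<bullet> F i x" "z \<bullet> f x"] by (simp add: inner_diff_right)
      also have "\<dots> \<le> norm z * norm (F i x - f x)" by (rule Cauchy_Schwarz_ineq2)
      also have "\<dots> \<le> R * norm (F i x - f x)" using z by (intro mult_right_mono) auto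
      finally show "cmod (?L z (F i x) - ?L z (f x)) \<le> R * norm (f x - F i x)" by (simp add: norm_minus_commute)
    qed (use R in auto)
    also have "\<dots> \<le> \<epsilon>" using i R by (simp add: field_simps)
    finally show ?thesis .
  qed
  moreover have "?\<phi> \<in> thorin_exponents"
    using fin by (intro thorin_exponents_sum gamma_exponent_in_thorin_exponents) auto
  ultimately show "\<exists>\<phi>\<in>thorin_exponents. \<forall>z. norm z \<le> R \<longrightarrow> cmod (- (\<integral>x. ?L z (f x) \<partial>M) - \<phi> z) \<le> \<epsilon>"
    by (intro bexI[of _ ?\<phi>] allI impI)
qed

section \<open>The Levy measure of a Thorin measure\<close>

text \<open>Markov's inequality gives finite mass to each set where w >= 1 / (n + 1); these sets
  together with the null set where w = 0 cover the space.\<close>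

lemma sigma_finite_measure_of_nn_integral:
  assumes w[measurable]: "w \<in> borel_measurable M" and pos: "AE x in M. 0 < w x"
    and fin: "(\<integral>\<^sup>+x. w x \<partial>M) < \<infinity>"
  shows "sigma_finite_measure M"
proof
  define A where "A n = {x \<in> space M. 1 \<le> of_nat (Suc n) * w x}" for n
  define Z where "Z = {x \<in> space M. w x = 0}"
  have [measurable]: "A n \<in> sets M" "Z \<in> sets M" for n by (auto simp: A_def Z_def)
  have Z: "emeasure M Z = 0"
  proof -
    have "AE x in M. x \<notin> Z" using pos by eventually_elim (auto simp: Z_def)
    then show ?thesis by (subst (asm) AE_iff_measurable[OF _ refl]) (auto simp: Z_def)
  qed
  have A: "emeasure M (A n) < \<infinity>" for n
  proof -
    have "emeasure M (A n) \<le> of_nat (Suc n) * (\<integral>\<^sup>+x. w x * indicator (space M) x \<partial>M)"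
      unfolding A_def by (rule nn_integral_Markov_inequality) auto
    also have "(\<integral>\<^sup>+x. w x * indicator (space M) x \<partial>M) = (\<integral>\<^sup>+x. w x \<partial>M)"
      by (intro nn_integral_cong) auto
    also have "of_nat (Suc n) * (\<integral>\<^sup>+x. w x \<partial>M) < \<infinity>"
      using fin by (simp add: ennreal_mult_less_top of_nat_less_top)
    finally show ?thesis .
  qed
  have "space M \<subseteq> Z \<union> (\<Union>n. A n)"
  proof
    fix x assume x: "x \<in> space M"
    show "x \<in> Z \<union> (\<Union>n. A n)"
    proof (cases "w x = 0")
      case False
      have "\<exists>n. 1 \<le> of_nat (Suc n) * w x"
      proof (cases "w x")
        case (real r)
        with False have r: "r > 0" by (auto simp: less_le)
        obtain n where "1 / r < real n" using reals_Archimedean2 by blast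
        then have "1 \<le> real (Suc n) * r" using r by (simp add: field_simps)
        then have "ennreal 1 \<le> ennreal (real (Suc n)) * ennreal r"
          using r by (subst ennreal_mult[symmetric]) (auto intro: ennreal_leI simp del: of_nat_Suc ennreal_1)
        then show ?thesis using real by (intro exI[of _ n]) (simp add: ennreal_of_nat_eq_real_of_nat del: of_nat_Suc)
      next
        case top
        then show ?thesis by (intro exI[of _ 0]) simp
      qed
      then show ?thesis using x by (auto simp: A_def)
    qed (use x in \<open>auto simp: Z_def\<close>)
  qed
  then show "\<exists>F. countable F \<and> F \<subseteq> sets M \<and> \<Union> F = space M \<and> (\<forall>a\<in>F. emeasure M a \<noteq> \<infinity>)"
    using Z A by (intro exI[of _ "insert Z (range A)"]) (auto simp: A_def Z_def less_top)
qed

section \<open>Measurability of integrals over families of measures\<close>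

lemma measurable_congI:
  assumes "f \<in> measurable M N" "\<And>x. x \<in> space M \<Longrightarrow> f x = g x"
  shows "g \<in> measurable M N"
  using assms measurable_cong[of M f g N] by blast

text \<open>The integrand does not depend on the parameter u, so induction over it works even for
  members of infinite mass.\<close>

lemma kernel_nn_integral_measurable:
  assumes "\<And>u. u \<in> space M \<Longrightarrow> sets (K u) = sets N"
    and "\<And>B. B \<in> sets N \<Longrightarrow> (\<lambda>u. emeasure (K u) B) \<in> borel_measurable M"
    and "g \<in> borel_measurable N"
  shows "(\<lambda>u. \<integral>\<^sup>+s. g s \<partial>K u) \<in> borel_measurable M"
proof -
  have meas_K: "h \<in> borel_measurable (K u)" if "u \<in> space M" "h \<in> borel_measurable N" for u and h :: "'b \<Rightarrow> ennreal"
    using measurable_cong_sets[OF assms(1)[OF that(1)] refl] that(2) by blast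
  from assms(3) show ?thesis
  proof (induction rule: borel_measurable_induct)
    case (cong f g)
    show ?case
    proof (rule measurable_congI[OF cong(4)])
      fix u assume u: "u \<in> space M"
      show "(\<integral>\<^sup>+s. g s \<partial>K u) = (\<integral>\<^sup>+s. f s \<partial>K u)"
        using cong(3) sets_eq_imp_space_eq[OF assms(1)[OF u]] by (intro nn_integral_cong) auto
    qed
  next
    case (set A)
    show ?case by (rule measurable_congI[OF assms(2)[OF set]]) (use assms(1) set in auto)
  next
    case (mult f c)
    have "(\<lambda>u. c * (\<integral>\<^sup>+s. f s \<partial>K u)) \<in> borel_measurable M"
      using mult by measurable
    then show ?case
      by (rule measurable_congI) (simp add: nn_integral_cmult meas_K mult)
  next
    case (add f g)
    have "(\<lambda>u. (\<integral>\<^sup>+s. g s \<partial>K u) + (\<integral>\<^sup>+s. f s \<partial>K u)) \<in> borel_measurable M"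
      using add by measurable
    then show ?case
      by (rule measurable_congI) (simp add: nn_integral_add meas_K add)
  next
    case (seq U)
    have "(\<lambda>u. SUP i. \<integral>\<^sup>+s. U i s \<partial>K u) \<in> borel_measurable M"
      using seq by measurable
    then show ?case
    proof (rule measurable_congI)
      fix u assume u: "u \<in> space M"
      have "(\<integral>\<^sup>+s. (SUP i. U i s) \<partial>K u) = (SUP i. \<integral>\<^sup>+s. U i s \<partial>K u)"
        using \<open>incseq U\<close> by (rule nn_integral_monotone_convergence_SUP) (rule meas_K[OF u seq(1)])
      then show "(SUP i. \<integral>\<^sup>+s. U i s \<partial>K u) = (\<integral>\<^sup>+s. (SUP i. U i) s \<partial>K u)"
        by (simp add: image_comp)
    qed
  qed
qed

text \<open>
  The weight \<open>w\<close> makes the kernels finite, so that dividing by \<open>1 + \<integral> w\<close> reduces the claim to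
  subprobability kernels.
\<close>

lemma kernel_nn_integral_measurable2:
  fixes w :: "'b \<Rightarrow> ennreal"
  assumes sets: "\<And>u. u \<in> space M \<Longrightarrow> sets (K u) = sets N"
    and meas: "\<And>B. B \<in> sets N \<Longrightarrow> (\<lambda>u. emeasure (K u) B) \<in> borel_measurable M"
    and w[measurable]: "w \<in> borel_measurable N" and w_pos: "\<And>s. s \<in> space N \<Longrightarrow> 0 < w s \<and> w s < \<infinity>"
    and w_fin: "\<And>u. u \<in> space M \<Longrightarrow> (\<integral>\<^sup>+s. w s \<partial>K u) < \<infinity>"
    and N: "space N \<noteq> {}"
    and f[measurable]: "(\<lambda>(u, s). f u s) \<in> borel_measurable (M \<Otimes>\<^sub>M N)"
  shows "(\<lambda>u. \<integral>\<^sup>+s. f u s \<partial>K u) \<in> borel_measurable M"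
proof -
  \<comment> \<open>The added 1 keeps the divisor positive when \<open>K u\<close> is the zero
    measure.\<close>
  define c where "c u = 1 + (\<integral>\<^sup>+s. w s \<partial>K u)" for u
  have [measurable]: "c \<in> borel_measurable M"
    unfolding c_def using kernel_nn_integral_measurable[OF sets meas w] by measurable
  have c: "1 \<le> c u" "c u < \<infinity>" if "u \<in> space M" for u
    using w_fin[OF that] by (auto simp: c_def)
  define K' where "K' u = density (K u) (\<lambda>s. w s / c u)" for u
  have meas_K: "g \<in> borel_measurable (K u) \<longleftrightarrow> g \<in> borel_measurable N" if "u \<in> space M" for u and g :: "'b \<Rightarrow> ennreal"
    using measurable_cong_sets[OF sets[OF that] refl] by auto
  have sp_K: "space (K u) = space N" if "u \<in> space M" for u
    using sets_eq_imp_space_eq[OF sets[OF that]] .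
  have em_K': "emeasure (K' u) A = (\<integral>\<^sup>+s. w s * indicator A s \<partial>K u) / c u" if u: "u \<in> space M" and A: "A \<in> sets N" for u A
  proof -
    have "emeasure (K' u) A = (\<integral>\<^sup>+s. (w s * indicator A s) / c u \<partial>K u)"
      unfolding K'_def using A sets[OF u] meas_K[OF u] 
      by (subst emeasure_density) (auto intro!: nn_integral_cong simp: divide_ennreal_def mult_ac)
    also have "\<dots> = (\<integral>\<^sup>+s. w s * indicator A s \<partial>K u) / c u"
      using A sets[OF u] meas_K[OF u] by (intro nn_integral_divide) auto
    finally show ?thesis .
  qed
  have K': "K' \<in> measurable M (subprob_algebra N)"
  proof (rule measurable_subprob_algebra)
    fix u assume u: "u \<in> space M"
    show "sets (K' u) = sets N" using sets[OF u] by (simp add: K'_def)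
    have "emeasure (K' u) (space (K' u)) = (\<integral>\<^sup>+s. w s \<partial>K u) / c u"
      using em_K'[OF u, of "space N"] sp_K[OF u] by (auto simp: K'_def intro!: arg_cong2[where f="(/)"] nn_integral_cong)
    also have "\<dots> \<le> c u / c u" by (intro divide_right_mono_ennreal) (simp add: c_def)
    also have "\<dots> = 1" using c[OF u] by (intro ennreal_divide_self) (auto simp: not_le)
    finally show "subprob_space (K' u)"
      using N sp_K[OF u] by (intro subprob_spaceI) (auto simp: K'_def)
  next
    fix A assume A: "A \<in> sets N"
    have "(\<lambda>u. (\<integral>\<^sup>+s. w s * indicator A s \<partial>K u) / c u) \<in> borel_measurable M"
      using A by (intro borel_measurable_divide_ennreal kernel_nn_integral_measurable[OF sets meas]) auto
    then show "(\<lambda>u. emeasure (K' u) A) \<in> borel_measurable M"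
      by (rule measurable_congI) (simp add: em_K' A)
  qed
  have "(\<lambda>u. c u * (\<integral>\<^sup>+s. f u s / w s \<partial>K' u)) \<in> borel_measurable M"
    by (intro borel_measurable_times_ennreal nn_integral_measurable_subprob_algebra2[OF _ K']) measurable
  moreover have "c u * (\<integral>\<^sup>+s. f u s / w s \<partial>K' u) = (\<integral>\<^sup>+s. f u s \<partial>K u)" if u: "u \<in> space M" for u
  proof -
    have fu: "f u \<in> borel_measurable N" using measurable_Pair2[OF f u] by simp
    have "(\<integral>\<^sup>+s. f u s / w s \<partial>K' u) = (\<integral>\<^sup>+s. w s / c u * (f u s / w s) \<partial>K u)"
      unfolding K'_def using fu meas_K[OF u] by (intro nn_integral_density) auto
    also have "\<dots> = (\<integral>\<^sup>+s. f u s / c u \<partial>K u)"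
    proof (rule nn_integral_cong)
      fix s assume "s \<in> space (K u)"
      then have "0 < w s" "w s < \<infinity>" using w_pos sp_K[OF u] by auto
      then have "w s / w s = 1" by (intro ennreal_divide_self) auto
      moreover have "w s / c u * (f u s / w s) = (w s / w s) * (f u s / c u)"
        by (simp add: divide_ennreal_def mult_ac)
      ultimately show "w s / c u * (f u s / w s) = f u s / c u" by simp
    qed
    also have "\<dots> = (\<integral>\<^sup>+s. f u s \<partial>K u) / c u"
      using fu meas_K[OF u] by (intro nn_integral_divide) auto
    finally have "c u * (\<integral>\<^sup>+s. f u s / w s \<partial>K' u) = (c u / c u) * (\<integral>\<^sup>+s. f u s \<partial>K u)"
      by (simp add: divide_ennreal_def mult_ac)
    also have "c u / c u = 1" using c[OF u] by (intro ennreal_divide_self) (auto simp: not_le)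
    finally show ?thesis by simp
  qed
  ultimately show ?thesis by (rule measurable_congI)
qed

section \<open>The Levy measure in polar coordinates\<close>

lemma measurable_restrict_borel_ident: "sets M = sets (restrict_space borel A) \<Longrightarrow> (\<lambda>x. x) \<in> measurable M borel"
  using measurable_restrict_space1[OF measurable_ident] measurable_cong_sets[of M "restrict_space borel A" borel borel]
  by (metis (mono_tags, lifting) id_def measurable_ident_sets measurable_restrict_space1)

text \<open>A point x of the Thorin measure spreads the mass exp (- |x| r) / r dr along its own ray;
  mixing over |x| produces the Laplace transform divided by r.\<close>

definition radial_density :: "(real ^ 'n) \<times> real \<Rightarrow> real" where
  "radial_density p = (if snd p > 0 then exp (- (norm (fst p) * snd p)) / snd p else 0)"

text \<open>As the image of a product measure it makes Fubini on \<open>T\<close> and the half line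
  directly available. Since \<open>sgn 0\<close> is 0, its agreement with the polar formula depends
  on \<open>T\<close> not charging the origin.\<close>

definition levy_of_thorin :: "(real ^ 'n) measure \<Rightarrow> (real ^ 'n) measure" where
  "levy_of_thorin T = distr (density (T \<Otimes>\<^sub>M lborel) (\<lambda>p. ennreal (radial_density p))) borel
     (\<lambda>p. snd p *\<^sub>R sgn (fst p))"

lemma radial_density_nonneg: "0 \<le> radial_density p"
  by (simp add: radial_density_def)

lemma sgn_measurable_vec: "(sgn :: real ^ 'n \<Rightarrow> real ^ 'n) \<in> borel_measurable borel"
  unfolding sgn_div_norm by measurable

locale thorin_data =
  fixes lam :: "(real ^ 'n) measure" and tau :: "real ^ 'n \<Rightarrow> real measure" and T :: "(real ^ 'n) measure"
  assumes lam: "finite_sphere_measure lam" and tau: "measurable_family {0..} tau"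
    and laplace_finite: "\<And>u r. u \<in> sphere 0 1 \<Longrightarrow> r > 0 \<Longrightarrow> laplace (tau u) r < \<infinity>"
    and T: "thorin_measure T lam tau"
begin

abbreviation polar_integral :: "(real ^ 'n \<Rightarrow> ennreal) \<Rightarrow> ennreal" where
  "polar_integral f \<equiv>
     \<integral>\<^sup>+u. \<integral>\<^sup>+r. f (r *\<^sub>R u) * (laplace (tau u) r / ennreal r) * indicator {0<..} r \<partial>lborel \<partial>lam"

lemma space_lam: "space lam = sphere 0 1"
  using sets_eq_imp_space_eq[of lam "restrict_space borel (sphere 0 1)"] lam
  by (simp add: finite_sphere_measure_def space_restrict_space)

lemma sets_lam [measurable_cong]: "sets lam = sets (restrict_space borel (sphere 0 1))"
  using lam by (simp add: finite_sphere_measure_def)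

lemma sets_tau: "u \<in> sphere 0 1 \<Longrightarrow> sets (tau u) = sets (restrict_space borel {0..})"
  using tau by (simp add: measurable_family_def)

lemma space_tau: "u \<in> sphere 0 1 \<Longrightarrow> space (tau u) = {0..}"
  using sets_eq_imp_space_eq[OF sets_tau] by (simp add: space_restrict_space)

lemma sets_T [measurable_cong]: "sets T = sets borel"
  using T by (simp add: thorin_measure_def)

lemma lam_ident: "(\<lambda>u. u) \<in> measurable lam borel"
  by (rule measurable_restrict_borel_ident[OF sets_lam])

lemma tau_ident: "u \<in> sphere 0 1 \<Longrightarrow> (\<lambda>u. u) \<in> measurable (tau u) borel"
  by (rule measurable_restrict_borel_ident[OF sets_tau])

text \<open>Finiteness of the Laplace transform at r = 1 makes exp (- s) a strictly positive weight
  of finite integral. The same weight yields joint measurability in u and s.\<close>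

lemma sigma_finite_tau: "u \<in> sphere 0 1 \<Longrightarrow> sigma_finite_measure (tau u)"
  using laplace_finite[of u 1] measurable_compose[OF tau_ident[of u], of "\<lambda>s. ennreal (exp (- s))" borel]
  by (intro sigma_finite_measure_of_nn_integral[of "\<lambda>s. ennreal (exp (- s))"]) (auto simp: laplace_def)

lemma tau_integral_measurable:
  assumes f[measurable]: "f \<in> borel_measurable (borel \<Otimes>\<^sub>M borel)"
  shows "(\<lambda>u. \<integral>\<^sup>+s. f (u, s) \<partial>tau u) \<in> borel_measurable lam"
proof (rule kernel_nn_integral_measurable2[where N="restrict_space borel {0..}" and w="\<lambda>s. ennreal (exp (- s))"])
  show "(\<lambda>u. emeasure (tau u) B) \<in> borel_measurable lam" if "B \<in> sets (restrict_space borel {0..})" for B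
    using tau that measurable_cong_sets[OF sets_lam refl] by (auto simp: measurable_family_def)
  have "(\<lambda>p. (fst p, snd p)) \<in> measurable (lam \<Otimes>\<^sub>M restrict_space borel {0..}) (borel \<Otimes>\<^sub>M borel)"
    by (intro measurable_Pair measurable_compose[OF measurable_fst lam_ident]
        measurable_compose[OF measurable_snd measurable_restrict_borel_ident[OF refl]])
  from measurable_compose[OF this f]
  show "(\<lambda>(u, s). f (u, s)) \<in> borel_measurable (lam \<Otimes>\<^sub>M restrict_space borel {0..})"
    by (simp add: case_prod_beta)
  show "(\<integral>\<^sup>+s. ennreal (exp (- s)) \<partial>tau u) < \<infinity>" if "u \<in> space lam" for u
    using laplace_finite[of u 1] that by (simp add: laplace_def space_lam)
  show "(\<lambda>s. ennreal (exp (- s))) \<in> borel_measurable (restrict_space borel {0..})"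
    by (intro measurable_restrict_space1) measurable
qed (auto simp: space_lam sets_tau space_restrict_space)

lemma tau_integral_measurable':
  assumes f[measurable]: "f \<in> borel_measurable borel"
  shows "(\<lambda>u. \<integral>\<^sup>+s. f (s *\<^sub>R u) \<partial>tau u) \<in> borel_measurable lam"
  using tau_integral_measurable[of "\<lambda>p. f (snd p *\<^sub>R fst p)"] by simp

lemma tau_scale_measurable:
  assumes "u \<in> sphere 0 1" "f \<in> borel_measurable borel"
  shows "(\<lambda>s. f (s *\<^sub>R u)) \<in> borel_measurable (tau u)"
proof -
  have "(\<lambda>s. s *\<^sub>R u) \<in> borel_measurable borel" by simp
  from measurable_compose[OF tau_ident[OF assms(1)] measurable_compose[OF this assms(2)]]
  show ?thesis .
qed

lemma nn_integral_T:
  assumes "f \<in> borel_measurable borel"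
  shows "(\<integral>\<^sup>+x. f x \<partial>T) = (\<integral>\<^sup>+u. \<integral>\<^sup>+s. f (s *\<^sub>R u) \<partial>tau u \<partial>lam)"
  using assms
proof (induction rule: borel_measurable_induct)
  case (cong f g)
  then have "f = g" by auto
  then show ?case using cong by simp
next
  case (set A)
  then show ?case using T by (simp add: thorin_measure_def)
next
  case (mult f c)
  have "(\<integral>\<^sup>+u. \<integral>\<^sup>+s. c * f (s *\<^sub>R u) \<partial>tau u \<partial>lam) = (\<integral>\<^sup>+u. c * (\<integral>\<^sup>+s. f (s *\<^sub>R u) \<partial>tau u) \<partial>lam)"
    using mult by (intro nn_integral_cong nn_integral_cmult tau_scale_measurable) (auto simp: space_lam)
  also have "\<dots> = c * (\<integral>\<^sup>+u. \<integral>\<^sup>+s. f (s *\<^sub>R u) \<partial>tau u \<partial>lam)"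
    by (intro nn_integral_cmult tau_integral_measurable' mult)
  finally show ?case using mult measurable_cong_sets[OF sets_T refl, of borel] by (simp add: nn_integral_cmult)
next
  case (add f g)
  have "(\<integral>\<^sup>+u. \<integral>\<^sup>+s. g (s *\<^sub>R u) + f (s *\<^sub>R u) \<partial>tau u \<partial>lam)
     = (\<integral>\<^sup>+u. (\<integral>\<^sup>+s. g (s *\<^sub>R u) \<partial>tau u) + (\<integral>\<^sup>+s. f (s *\<^sub>R u) \<partial>tau u) \<partial>lam)"
    using add by (intro nn_integral_cong nn_integral_add tau_scale_measurable) (auto simp: space_lam)
  also have "\<dots> = (\<integral>\<^sup>+u. \<integral>\<^sup>+s. g (s *\<^sub>R u) \<partial>tau u \<partial>lam) + (\<integral>\<^sup>+u. \<integral>\<^sup>+s. f (s *\<^sub>R u) \<partial>tau u \<partial>lam)"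
    by (intro nn_integral_add tau_integral_measurable' add)
  finally show ?case using add measurable_cong_sets[OF sets_T refl, of borel] by (simp add: nn_integral_add)
next
  case (seq U)
  have inc: "incseq (\<lambda>i s. U i (s *\<^sub>R u))" for u
    using \<open>incseq U\<close> by (auto simp: incseq_def le_fun_def)
  have "(\<integral>\<^sup>+u. \<integral>\<^sup>+s. (SUP i. U i (s *\<^sub>R u)) \<partial>tau u \<partial>lam) = (\<integral>\<^sup>+u. (SUP i. \<integral>\<^sup>+s. U i (s *\<^sub>R u) \<partial>tau u) \<partial>lam)"
    using seq by (intro nn_integral_cong nn_integral_monotone_convergence_SUP inc tau_scale_measurable) (auto simp: space_lam)
  also have "\<dots> = (SUP i. \<integral>\<^sup>+u. \<integral>\<^sup>+s. U i (s *\<^sub>R u) \<partial>tau u \<partial>lam)"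
  proof (intro nn_integral_monotone_convergence_SUP tau_integral_measurable' seq)
    show "incseq (\<lambda>i u. \<integral>\<^sup>+s. U i (s *\<^sub>R u) \<partial>tau u)"
      using \<open>incseq U\<close> by (auto simp: incseq_def le_fun_def intro!: nn_integral_mono)
  qed
  also have "\<dots> = (SUP i. \<integral>\<^sup>+x. U i x \<partial>T)" using seq by simp
  also have "\<dots> = (\<integral>\<^sup>+x. (SUP i. U i x) \<partial>T)"
    using \<open>incseq U\<close> seq measurable_cong_sets[OF sets_T refl, of borel]
    by (intro nn_integral_monotone_convergence_SUP[symmetric]) auto
  finally show ?case by (simp add: image_comp)
qed

lemma emeasure_T_origin: "emeasure T {0} = (\<integral>\<^sup>+u. emeasure (tau u) {0} \<partial>lam)"
proof -
  have "(\<integral>\<^sup>+s. indicator {0} (s *\<^sub>R u) \<partial>tau u) = emeasure (tau u) {0}" if u: "u \<in> sphere 0 1" for u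
  proof -
    have "(\<integral>\<^sup>+s. indicator {0} (s *\<^sub>R u) \<partial>tau u) = (\<integral>\<^sup>+s. indicator {0} s \<partial>tau u)"
      using u by (intro nn_integral_cong) (auto simp: indicator_def)
    also have "{0} \<in> sets (tau u)"
      unfolding sets_tau[OF u] by (auto simp: sets_restrict_space intro!: image_eqI[of _ _ "{0}"])
    then have "(\<integral>\<^sup>+s. indicator {0} s \<partial>tau u) = emeasure (tau u) {0}" by simp
    finally show ?thesis .
  qed
  then show ?thesis
    using T by (auto simp: thorin_measure_def space_lam intro!: nn_integral_cong)
qed

lemma tau_origin_measurable: "(\<lambda>u. emeasure (tau u) {0}) \<in> borel_measurable lam"
proof -
  have "{0::real} \<in> sets (restrict_space borel {0..})"
    by (auto simp: sets_restrict_space intro!: image_eqI[of _ _ "{0}"])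
  then show ?thesis
    using tau measurable_cong_sets[OF sets_lam refl] by (auto simp: measurable_family_def)
qed

lemma radial_density_measurable [measurable]: "radial_density \<in> borel_measurable (borel \<Otimes>\<^sub>M borel)"
  unfolding radial_density_def[abs_def] by measurable

lemma polar_map_measurable [measurable]:
  "(\<lambda>p :: (real ^ 'n) \<times> real. snd p *\<^sub>R sgn (fst p)) \<in> borel_measurable (borel \<Otimes>\<^sub>M borel)"
  using measurable_compose[OF measurable_fst sgn_measurable_vec] by measurable

lemma measurable_pair_T: "measurable (T \<Otimes>\<^sub>M lborel) N = measurable (borel \<Otimes>\<^sub>M borel) N"
  by (intro measurable_cong_sets sets_pair_measure_cong sets_T sets_lborel refl)

lemma sets_levy_of_thorin [simp]: "sets (levy_of_thorin T) = sets borel"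
  by (simp add: levy_of_thorin_def)

lemma nn_integral_levy_of_thorin:
  assumes [measurable]: "f \<in> borel_measurable borel"
  shows "(\<integral>\<^sup>+y. f y \<partial>levy_of_thorin T) = (\<integral>\<^sup>+x. \<integral>\<^sup>+r. ennreal (radial_density (x, r)) * f (r *\<^sub>R sgn x) \<partial>lborel \<partial>T)"
proof -
  have "(\<integral>\<^sup>+y. f y \<partial>levy_of_thorin T) = (\<integral>\<^sup>+p. ennreal (radial_density p) * f (snd p *\<^sub>R sgn (fst p)) \<partial>(T \<Otimes>\<^sub>M lborel))"
  proof -
    have m: "radial_density \<in> borel_measurable (T \<Otimes>\<^sub>M lborel)"
        "(\<lambda>p. snd p *\<^sub>R sgn (fst p)) \<in> borel_measurable (T \<Otimes>\<^sub>M lborel)"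
        "(\<lambda>p. f (snd p *\<^sub>R sgn (fst p))) \<in> borel_measurable (T \<Otimes>\<^sub>M lborel)"
      unfolding measurable_pair_T by measurable
    show ?thesis
      unfolding levy_of_thorin_def using m by (simp add: nn_integral_distr nn_integral_density)
  qed
  also have "\<dots> = (\<integral>\<^sup>+x. \<integral>\<^sup>+r. ennreal (radial_density (x, r)) * f (snd (x, r) *\<^sub>R sgn (fst (x, r))) \<partial>lborel \<partial>T)"
  proof (rule lborel.nn_integral_fst[symmetric])
    show "(\<lambda>p. ennreal (radial_density p) * f (snd p *\<^sub>R sgn (fst p))) \<in> borel_measurable (T \<Otimes>\<^sub>M lborel)"
      unfolding measurable_pair_T by measurable
  qed
  finally show ?thesis by simp
qed

text \<open>Tonelli for a fixed direction: integrating exp (- s r) over s first gives the Laplace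
  transform, which is how complete monotonicity of the canonical function enters.\<close>

lemma nn_integral_laplace_swap:
  assumes u: "u \<in> sphere 0 1" and g[measurable]: "g \<in> borel_measurable borel"
  shows "(\<integral>\<^sup>+s. \<integral>\<^sup>+r. g r * ennreal (if r > 0 then exp (- (s * r)) / r else 0) \<partial>lborel \<partial>tau u)
    = (\<integral>\<^sup>+r. g r * (laplace (tau u) r / ennreal r) * indicator {0<..} r \<partial>lborel)"
proof -
  interpret tau: sigma_finite_measure "tau u" by (rule sigma_finite_tau[OF u])
  interpret P: pair_sigma_finite "tau u" lborel ..
  let ?g = "\<lambda>s r. g r * ennreal (if r > 0 then exp (- (s * r)) / r else 0)"
  have "(\<integral>\<^sup>+s. \<integral>\<^sup>+r. ?g s r \<partial>lborel \<partial>tau u) = (\<integral>\<^sup>+r. \<integral>\<^sup>+s. ?g s r \<partial>tau u \<partial>lborel)"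
  proof (rule P.Fubini'[symmetric])
    have 1: "(\<lambda>p. (fst p, snd p)) \<in> measurable (tau u \<Otimes>\<^sub>M lborel) (borel \<Otimes>\<^sub>M borel)"
      by (intro measurable_Pair measurable_compose[OF measurable_fst tau_ident[OF u]]) simp
    have 2: "(\<lambda>(s, r). ?g s r) \<in> borel_measurable (borel \<Otimes>\<^sub>M borel)" by measurable
    show "(\<lambda>(s, r). ?g s r) \<in> borel_measurable (tau u \<Otimes>\<^sub>M lborel)"
      using measurable_compose[OF 1 2] by (simp only: prod.collapse)
  qed
  also have "\<dots> = (\<integral>\<^sup>+r. g r * (laplace (tau u) r / ennreal r) * indicator {0<..} r \<partial>lborel)"
  proof (rule nn_integral_cong)
    fix r :: real
    have e: "(\<lambda>s. ennreal (exp (- (r * s)))) \<in> borel_measurable (tau u)"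
      by (intro measurable_compose[OF tau_ident[OF u]]) measurable
    show "(\<integral>\<^sup>+s. ?g s r \<partial>tau u) = g r * (laplace (tau u) r / ennreal r) * indicator {0<..} r"
    proof (cases "r > 0")
      case True
      have "(\<integral>\<^sup>+s. ?g s r \<partial>tau u) = (\<integral>\<^sup>+s. g r * (ennreal (exp (- (r * s))) / ennreal r) \<partial>tau u)"
        using True by (simp add: divide_ennreal mult.commute)
      also have "\<dots> = g r * ((\<integral>\<^sup>+s. ennreal (exp (- (r * s))) \<partial>tau u) / ennreal r)"
        using e by (subst nn_integral_cmult) (auto simp: nn_integral_divide)
      finally show ?thesis using True by (simp add: laplace_def)
    qed simp
  qed
  finally show ?thesis .
qed

text \<open>This is the link between the two descriptions of the Levy measure. For s > 0 the
  direction of s u is u and its norm s, so the kernels match; the exceptional s = 0 is null for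
  almost every u because the origin is null for \<open>T\<close>.\<close>

lemma nn_integral_polar_swap:
  assumes T0: "emeasure T {0} = 0" and f[measurable]: "f \<in> borel_measurable borel"
  shows "(\<integral>\<^sup>+y. f y \<partial>levy_of_thorin T)
    = polar_integral f"
proof -
  define h where "h x = (\<integral>\<^sup>+r. ennreal (radial_density (x, r)) * f (r *\<^sub>R sgn x) \<partial>lborel)" for x
  have h[measurable]: "h \<in> borel_measurable borel"
  proof -
    have "(\<lambda>p. ennreal (radial_density p) * f (snd p *\<^sub>R sgn (fst p))) \<in> borel_measurable (borel \<Otimes>\<^sub>M lborel)"
      by measurable
    from lborel.borel_measurable_nn_integral_fst[OF this] show ?thesis by (simp add: h_def[abs_def])
  qed
  have "AE u in lam. emeasure (tau u) {0} = 0"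
    using T0 unfolding emeasure_T_origin by (subst (asm) nn_integral_0_iff_AE[OF tau_origin_measurable])
  then have "(\<integral>\<^sup>+u. \<integral>\<^sup>+s. h (s *\<^sub>R u) \<partial>tau u \<partial>lam)
    = polar_integral f"
  proof (intro nn_integral_cong_AE, elim AE_mp, intro AE_I2 impI)
    fix u assume "u \<in> space lam" and u0: "emeasure (tau u) {0} = 0"
    then have u: "u \<in> sphere 0 1" by (simp add: space_lam)
    let ?g = "\<lambda>s r. f (r *\<^sub>R u) * ennreal (if r > 0 then exp (- (s * r)) / r else 0)"
    have "{0} \<in> sets (tau u)"
      unfolding sets_tau[OF u] by (auto simp: sets_restrict_space intro!: image_eqI[of _ _ "{0}"])
    then have "AE s in tau u. s \<noteq> 0"
      using u0 by (intro AE_I[of _ _ "{0}"]) auto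
    then have "(\<integral>\<^sup>+s. h (s *\<^sub>R u) \<partial>tau u) = (\<integral>\<^sup>+s. \<integral>\<^sup>+r. ?g s r \<partial>lborel \<partial>tau u)"
    proof (intro nn_integral_cong_AE, elim AE_mp, intro AE_I2 impI)
      fix s assume "s \<in> space (tau u)" "s \<noteq> 0"
      then have s: "s > 0" using space_tau[OF u] by simp
      then have sn: "sgn (s *\<^sub>R u) = u" "norm (s *\<^sub>R u) = s" using u by (auto simp: sgn_div_norm)
      show "h (s *\<^sub>R u) = (\<integral>\<^sup>+r. ?g s r \<partial>lborel)"
        unfolding h_def radial_density_def fst_conv snd_conv sn by (intro nn_integral_cong mult.commute)
    qed
    also have "\<dots> = (\<integral>\<^sup>+r. f (r *\<^sub>R u) * (laplace (tau u) r / ennreal r) * indicator {0<..} r \<partial>lborel)"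
      by (rule nn_integral_laplace_swap[OF u]) measurable
    finally show "(\<integral>\<^sup>+s. h (s *\<^sub>R u) \<partial>tau u) = (\<integral>\<^sup>+r. f (r *\<^sub>R u) * (laplace (tau u) r / ennreal r) * indicator {0<..} r \<partial>lborel)" .
  qed
  then show ?thesis
    using nn_integral_levy_of_thorin[OF f] nn_integral_T[OF h] by (simp add: h_def)
qed

lemma AE_T_nonzero: "emeasure T {0} = 0 \<Longrightarrow> AE x in T. x \<noteq> 0"
  by (intro AE_I[of _ _ "{0}"]) (auto simp: sets_T)

lemma emeasure_levy_of_thorin_origin:
  assumes "emeasure T {0} = 0" shows "emeasure (levy_of_thorin T) {0} = 0"
proof -
  have "emeasure (levy_of_thorin T) {0} = (\<integral>\<^sup>+y. indicator {0} y \<partial>levy_of_thorin T)" by simp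
  also have "\<dots> = (\<integral>\<^sup>+x. \<integral>\<^sup>+r. ennreal (radial_density (x, r)) * indicator {0} (r *\<^sub>R sgn x) \<partial>lborel \<partial>T)"
    by (rule nn_integral_levy_of_thorin) simp
  also have "\<dots> = (\<integral>\<^sup>+x. 0 \<partial>T)"
    using AE_T_nonzero[OF assms]
  proof (intro nn_integral_cong_AE, elim AE_mp, intro AE_I2 impI)
    fix x :: "real ^ 'n" assume "x \<noteq> 0"
    then have "ennreal (radial_density (x, r)) * indicator {0} (r *\<^sub>R sgn x) = 0" for r
      by (auto simp: radial_density_def indicator_def sgn_zero_iff)
    then show "(\<integral>\<^sup>+r. ennreal (radial_density (x, r)) * indicator {0} (r *\<^sub>R sgn x) \<partial>lborel) = 0"
      by (simp only: nn_integral_const mult_zero_left)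
  qed
  finally show ?thesis by simp
qed

text \<open>The left side is the Levy condition; on the right it has become a condition on
  \<open>T\<close> whose integrand is comparable to \<open>radial_bound\<close>.\<close>

lemma nn_integral_levy_of_thorin_truncated:
  assumes "emeasure T {0} = 0"
  shows "(\<integral>\<^sup>+y. ennreal (min ((norm y)\<^sup>2) 1) \<partial>levy_of_thorin T) = (\<integral>\<^sup>+x. levy_radial_integral (norm x) \<partial>T)"
proof -
  have "(\<integral>\<^sup>+y. ennreal (min ((norm y)\<^sup>2) 1) \<partial>levy_of_thorin T)
    = (\<integral>\<^sup>+x. \<integral>\<^sup>+r. ennreal (radial_density (x, r)) * ennreal (min ((norm (r *\<^sub>R sgn x))\<^sup>2) 1) \<partial>lborel \<partial>T)"
    by (rule nn_integral_levy_of_thorin) measurable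
  also have "\<dots> = (\<integral>\<^sup>+x. levy_radial_integral (norm x) \<partial>T)"
    using AE_T_nonzero[OF assms]
  proof (intro nn_integral_cong_AE, elim AE_mp, intro AE_I2 impI)
    fix x :: "real ^ 'n" assume "x \<noteq> 0"
    then show "(\<integral>\<^sup>+r. ennreal (radial_density (x, r)) * ennreal (min ((norm (r *\<^sub>R sgn x))\<^sup>2) 1) \<partial>lborel) = levy_radial_integral (norm x)"
      unfolding levy_radial_integral_def
      by (intro nn_integral_cong) (auto simp: radial_density_def norm_sgn mult.commute simp flip: ennreal_mult)
  qed
  finally show ?thesis .
qed

text \<open>The polar formula determines a measure on Borel sets avoiding the origin, and neither
  measure charges the origin.\<close>

lemma levy_of_thorin_unique:
  assumes T0: "emeasure T {0} = 0" and \<nu>: "sets \<nu> = sets borel" "emeasure \<nu> {0} = 0"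
    and polar: "\<And>B. B \<in> sets borel \<Longrightarrow> 0 \<notin> B \<Longrightarrow> emeasure \<nu> B =
      polar_integral (indicator B)"
  shows "\<nu> = levy_of_thorin T"
proof (rule measure_eqI)
  show "sets \<nu> = sets (levy_of_thorin T)" using \<nu> by simp
  fix B assume "B \<in> sets \<nu>"
  then have B: "B \<in> sets borel" using \<nu> by simp
  have off: "emeasure M B = emeasure M (B - {0})" if "sets M = sets borel" "emeasure M {0} = 0" for M :: "(real ^ 'n) measure"
    using that B by (intro emeasure_Diff_null_set[symmetric]) (auto simp: null_sets_def)
  have "emeasure \<nu> (B - {0}) = emeasure (levy_of_thorin T) (B - {0})"
    using B polar[of "B - {0}"] nn_integral_polar_swap[OF T0, of "indicator (B - {0})"] by simp
  then show "emeasure \<nu> B = emeasure (levy_of_thorin T) B"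
    using off[OF \<nu>] off[OF sets_levy_of_thorin emeasure_levy_of_thorin_origin[OF T0]] by simp
qed

end

section \<open>From the Levy--Khintchine integral to the Thorin integral\<close>

lemma thorin_integrand_measurable: "thorin_integrand z \<in> borel_measurable borel"
proof -
  have "(\<lambda>x. Ln_ii ((z \<bullet> x) / (norm x)\<^sup>2)) \<in> borel_measurable borel"
    by (rule measurable_compose[OF _ Ln_ii_measurable]) measurable
  moreover have "(\<lambda>x. \<i> * complex_of_real ((z \<bullet> x) / (norm x)\<^sup>2 * indicator {x. norm x \<ge> 1} x)) \<in> borel_measurable borel"
    by measurable
  ultimately show ?thesis unfolding thorin_integrand_def[abs_def] by (rule borel_measurable_add)
qed

lemma drift_integrand_measurable: "drift_integrand j \<in> borel_measurable borel"
  unfolding drift_integrand_def[abs_def] by measurable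

text \<open>Along one ray this is the Frullani formula with s = |x| and c = z . sgn x. It also shows
  where the drift comes from: the Levy side truncates at r <= 1, which integrates to (1 - exp (- s))
  / s, while the Thorin side truncates at |x| >= 1, and \<open>drift_integrand\<close> is the
  discrepancy.\<close>

lemma compensated_polar_integral:
  fixes x z :: "real ^ 'n"
  assumes x: "x \<noteq> 0"
  shows "(\<integral>r. radial_density (x, r) *\<^sub>R (iexp (z \<bullet> (r *\<^sub>R sgn x)) - 1
        - \<i> * of_real ((z \<bullet> (r *\<^sub>R sgn x)) * indicator {x. norm x \<le> 1} (r *\<^sub>R sgn x))) \<partial>lborel)
    = - thorin_integrand z x - \<i> * of_real (\<Sum>j\<in>UNIV. z $ j * drift_integrand j x)"
proof -
  define s where "s = norm x"
  define c where "c = z \<bullet> sgn x"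
  have s: "s > 0" using x by (simp add: s_def)
  have "(\<integral>r. radial_density (x, r) *\<^sub>R (iexp (z \<bullet> (r *\<^sub>R sgn x)) - 1
        - \<i> * of_real ((z \<bullet> (r *\<^sub>R sgn x)) * indicator {x. norm x \<le> 1} (r *\<^sub>R sgn x))) \<partial>lborel)
    = (\<integral>r. (iexp (c * r) - 1 - \<i> * of_real (c * r * indicator {..1} r))
      * of_real (if r > 0 then exp (- (s * r)) / r else 0) \<partial>lborel)"
  proof (rule Bochner_Integration.integral_cong[OF refl])
    fix r :: real
    show "radial_density (x, r) *\<^sub>R (iexp (z \<bullet> (r *\<^sub>R sgn x)) - 1
        - \<i> * of_real ((z \<bullet> (r *\<^sub>R sgn x)) * indicator {x. norm x \<le> 1} (r *\<^sub>R sgn x)))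
      = (iexp (c * r) - 1 - \<i> * of_real (c * r * indicator {..1} r))
      * of_real (if r > 0 then exp (- (s * r)) / r else 0)"
    proof (cases "r > 0")
      case True
      then have "indicator {x. norm x \<le> 1} (r *\<^sub>R sgn x) = (indicator {..1} r :: real)"
        using x by (simp add: indicator_def norm_sgn)
      moreover have "z \<bullet> (r *\<^sub>R sgn x) = c * r" by (simp add: c_def)
      moreover have "radial_density (x, r) = exp (- (s * r)) / r" using True by (simp add: radial_density_def s_def)
      ultimately show ?thesis using True by (simp add: scaleR_conv_of_real mult.commute)
    qed (simp add: radial_density_def)
  qed
  also have "\<dots> = - Ln_ii (c / s) - \<i> * of_real (c * (1 - exp (- s)) / s)"
    by (rule integral_compensated_exp[OF s])
  also have "\<dots> = - thorin_integrand z x - \<i> * of_real (\<Sum>j\<in>UNIV. z $ j * drift_integrand j x)"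
  proof -
    have cs: "c / s = (z \<bullet> x) / s\<^sup>2"
      using s by (simp add: c_def s_def sgn_div_norm power2_eq_square divide_inverse mult_ac)
    have "(\<Sum>j\<in>UNIV. z $ j * drift_integrand j x)
      = (z \<bullet> x) * ((1 - exp (- s)) / s\<^sup>2 - 1 / s\<^sup>2 * indicator {x. norm x \<ge> 1} x)"
      by (simp add: drift_integrand_def s_def[symmetric] inner_vec_def sum_distrib_right mult.assoc)
    also have "\<dots> = c * (1 - exp (- s)) / s - c / s * indicator {x. norm x \<ge> 1} x"
    proof -
      have "z \<bullet> x = c * s" using s by (simp add: c_def s_def sgn_div_norm)
      then show ?thesis using s by (simp add: power2_eq_square field_simps)
    qed
    finally have "(\<Sum>j\<in>UNIV. z $ j * drift_integrand j x) = c * (1 - exp (- s)) / s - c / s * indicator {x. norm x \<ge> 1} x" .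
    then show ?thesis
      by (simp only: thorin_integrand_def s_def[symmetric] cs[symmetric]) (simp add: algebra_simps)
  qed
  finally show ?thesis .
qed

context thorin_data begin

context
  assumes T0: "emeasure T {0} = 0" and fin: "(\<integral>\<^sup>+x. levy_radial_integral (norm x) \<partial>T) < \<infinity>"
begin

lemma measurable_T: "measurable T N = measurable borel N"
  by (intro measurable_cong_sets sets_T refl)

lemma sigma_finite_T: "sigma_finite_measure T"
proof (rule sigma_finite_measure_of_nn_integral[OF _ _ fin])
  show "(\<lambda>x. levy_radial_integral (norm x)) \<in> borel_measurable T"
    unfolding measurable_T by measurable
  show "AE x in T. 0 < levy_radial_integral (norm x)"
    using AE_T_nonzero[OF T0]
  proof eventually_elim
    case (elim x)
    then have "0 < ennreal (exp (-1) / 2 * radial_bound (norm x))"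
      using radial_bound_pos[of "norm x"] by simp
    also have "\<dots> \<le> levy_radial_integral (norm x)" using elim by (intro levy_radial_integral_ge) simp
    finally show ?case .
  qed
qed

lemma nn_integral_radial_bound: "(\<integral>\<^sup>+x. ennreal (radial_bound (norm x)) \<partial>T) < \<infinity>"
proof -
  have "(\<integral>\<^sup>+x. ennreal (radial_bound (norm x)) \<partial>T) \<le> (\<integral>\<^sup>+x. ennreal (2 * exp 1) * levy_radial_integral (norm x) \<partial>T)"
    using AE_T_nonzero[OF T0]
  proof (intro nn_integral_mono_AE, eventually_elim)
    case (elim x)
    have "ennreal (radial_bound (norm x)) = ennreal (2 * exp 1) * ennreal (exp (-1) / 2 * radial_bound (norm x))"
      using radial_bound_pos[of "norm x"] elim by (subst ennreal_mult[symmetric]) (auto simp: exp_minus)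
    also have "\<dots> \<le> ennreal (2 * exp 1) * levy_radial_integral (norm x)"
      using elim by (intro mult_left_mono levy_radial_integral_ge) auto
    finally show ?case .
  qed
  also have "\<dots> = ennreal (2 * exp 1) * (\<integral>\<^sup>+x. levy_radial_integral (norm x) \<partial>T)"
    by (intro nn_integral_cmult) (simp add: measurable_T)
  also have "\<dots> < \<infinity>" using fin by (simp add: ennreal_mult_less_top)
  finally show ?thesis .
qed

lemma integrable_radial_bound: "integrable T (\<lambda>x. radial_bound (norm x))"
proof (rule integrableI_bounded)
  show "(\<lambda>x. radial_bound (norm x)) \<in> borel_measurable T" unfolding measurable_T by measurable
  have "(\<integral>\<^sup>+x. ennreal (norm (radial_bound (norm x))) \<partial>T) = (\<integral>\<^sup>+x. ennreal (radial_bound (norm x)) \<partial>T)"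
    using AE_T_nonzero[OF T0]
  proof (intro nn_integral_cong_AE, eventually_elim)
    case (elim x)
    then show ?case using radial_bound_pos[of "norm x"] by simp
  qed
  then show "(\<integral>\<^sup>+x. ennreal (norm (radial_bound (norm x))) \<partial>T) < \<infinity>"
    using nn_integral_radial_bound by simp
qed

lemma integrable_thorin_integrand: "integrable T (thorin_integrand z)"
proof (rule Bochner_Integration.integrable_bound)
  show "integrable T (\<lambda>x. ((norm z)\<^sup>2 + norm z + 5) * radial_bound (norm x))"
    by (intro integrable_mult_right integrable_radial_bound)
  show "thorin_integrand z \<in> borel_measurable T" unfolding measurable_T by (rule thorin_integrand_measurable)
  show "AE x in T. norm (thorin_integrand z x) \<le> norm (((norm z)\<^sup>2 + norm z + 5) * radial_bound (norm x))"
    using AE_T_nonzero[OF T0]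
  proof eventually_elim
    case (elim x)
    then show ?case using cmod_thorin_integrand_le[OF elim order_refl, of z] by (rule_tac order_trans) auto
  qed
qed

lemma integrable_drift_integrand: "integrable T (drift_integrand j)"
proof (rule Bochner_Integration.integrable_bound[OF integrable_radial_bound])
  show "drift_integrand j \<in> borel_measurable T" unfolding measurable_T by (rule drift_integrand_measurable)
  show "AE x in T. norm (drift_integrand j x) \<le> norm (radial_bound (norm x))"
    using AE_T_nonzero[OF T0]
  proof eventually_elim
    case (elim x)
    then show ?case using abs_drift_integrand_le[OF elim, of j] by simp
  qed
qed

text \<open>Along the ray of x the modulus integrates to at most (|z|^2 + 2)
  \<open>levy_radial_integral (norm x)\<close>, which is integrable over \<open>T\<close>. Hence
  Fubini applies, and the values on single rays can be integrated term by term.\<close>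

lemma levy_khintchine_integral:
  "(\<integral>y. iexp (z \<bullet> y) - 1 - \<i> * of_real ((z \<bullet> y) * indicator {x. norm x \<le> 1} y) \<partial>levy_of_thorin T)
    = - (\<integral>x. thorin_integrand z x \<partial>T) - \<i> * of_real (\<Sum>j\<in>UNIV. z $ j * (\<integral>x. drift_integrand j x \<partial>T))"
proof -
  interpret T: sigma_finite_measure T by (rule sigma_finite_T)
  interpret P: pair_sigma_finite T lborel ..
  let ?F = "\<lambda>y. iexp (z \<bullet> y) - 1 - \<i> * complex_of_real ((z \<bullet> y) * indicator {x. norm x \<le> 1} y)"
  let ?D = "density (T \<Otimes>\<^sub>M lborel) (\<lambda>p. ennreal (radial_density p))"
  let ?G = "\<lambda>p. radial_density p *\<^sub>R ?F (snd p *\<^sub>R sgn (fst p))"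
  have F[measurable]: "?F \<in> borel_measurable borel" by measurable
  have map: "(\<lambda>p. snd p *\<^sub>R sgn (fst p)) \<in> borel_measurable (T \<Otimes>\<^sub>M lborel)"
    unfolding measurable_pair_T by measurable
  have Fm: "(\<lambda>p. ?F (snd p *\<^sub>R sgn (fst p))) \<in> borel_measurable (T \<Otimes>\<^sub>M lborel)"
    by (rule measurable_compose[OF map F])
  have dm: "radial_density \<in> borel_measurable (T \<Otimes>\<^sub>M lborel)"
    unfolding measurable_pair_T by measurable
  have Gm: "?G \<in> borel_measurable (T \<Otimes>\<^sub>M lborel)"
    using dm Fm by (rule borel_measurable_scaleR)
  have bound: "norm (?G (x, r)) \<le> ((norm z)\<^sup>2 + 2) * (if r > 0 then min (r\<^sup>2) 1 * (exp (- (norm x * r)) / r) else 0)"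
    if x: "x \<noteq> 0" for x r
  proof (cases "r > 0")
    case True
    have "\<bar>z \<bullet> sgn x\<bar> \<le> norm z" using Cauchy_Schwarz_ineq2[of z "sgn x"] x by (simp add: norm_sgn)
    from cmod_compensated_exp_le[OF this True]
    have "norm (?F (r *\<^sub>R sgn x)) \<le> ((norm z)\<^sup>2 + 2) * min (r\<^sup>2) 1"
      using x True by (simp add: indicator_def norm_sgn mult.commute)
    from mult_left_mono[OF this, of "exp (- (norm x * r)) / r"] True
    have "exp (- (norm x * r)) / r * norm (?F (r *\<^sub>R sgn x)) \<le> exp (- (norm x * r)) / r * (((norm z)\<^sup>2 + 2) * min (r\<^sup>2) 1)"
      by simp
    moreover have "norm (?G (x, r)) = exp (- (norm x * r)) / r * norm (?F (r *\<^sub>R sgn x))"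
      using True by (simp only: norm_scaleR radial_density_def fst_conv snd_conv if_True) simp
    ultimately show ?thesis using True by (simp add: mult_ac)
  qed (simp add: radial_density_def)
  have int: "integrable (T \<Otimes>\<^sub>M lborel) ?G"
  proof (rule integrableI_bounded[OF Gm])
    have "(\<integral>\<^sup>+p. ennreal (norm (?G p)) \<partial>(T \<Otimes>\<^sub>M lborel)) = (\<integral>\<^sup>+x. \<integral>\<^sup>+r. ennreal (norm (?G (x, r))) \<partial>lborel \<partial>T)"
      using Gm by (intro lborel.nn_integral_fst[symmetric]) simp
    also have "\<dots> \<le> (\<integral>\<^sup>+x. ennreal ((norm z)\<^sup>2 + 2) * levy_radial_integral (norm x) \<partial>T)"
      using AE_T_nonzero[OF T0]
    proof (intro nn_integral_mono_AE, eventually_elim)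
      case (elim x)
      have "(\<integral>\<^sup>+r. ennreal (norm (?G (x, r))) \<partial>lborel) \<le> (\<integral>\<^sup>+r. ennreal ((norm z)\<^sup>2 + 2) *
          ennreal (if r > 0 then min (r\<^sup>2) 1 * (exp (- (norm x * r)) / r) else 0) \<partial>lborel)"
      proof (rule nn_integral_mono)
        fix r
        have "ennreal (norm (?G (x, r))) \<le> ennreal (((norm z)\<^sup>2 + 2) * (if r > 0 then min (r\<^sup>2) 1 * (exp (- (norm x * r)) / r) else 0))"
          by (rule ennreal_leI[OF bound[OF elim(2)]])
        also have "\<dots> = ennreal ((norm z)\<^sup>2 + 2) * ennreal (if r > 0 then min (r\<^sup>2) 1 * (exp (- (norm x * r)) / r) else 0)"
          by (rule ennreal_mult) auto
        finally show "ennreal (norm (?G (x, r))) \<le> ennreal ((norm z)\<^sup>2 + 2) *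
          ennreal (if r > 0 then min (r\<^sup>2) 1 * (exp (- (norm x * r)) / r) else 0)" .
      qed
      also have "\<dots> = ennreal ((norm z)\<^sup>2 + 2) * levy_radial_integral (norm x)"
        unfolding levy_radial_integral_def by (rule nn_integral_cmult) measurable
      finally show ?case .
    qed
    also have "\<dots> = ennreal ((norm z)\<^sup>2 + 2) * (\<integral>\<^sup>+x. levy_radial_integral (norm x) \<partial>T)"
      by (intro nn_integral_cmult) (simp add: measurable_T)
    also have "\<dots> < \<infinity>" using fin by (simp add: ennreal_mult_less_top)
    finally show "(\<integral>\<^sup>+p. ennreal (norm (?G p)) \<partial>(T \<Otimes>\<^sub>M lborel)) < \<infinity>" .
  qed
  have "(\<integral>y. ?F y \<partial>levy_of_thorin T) = (\<integral>p. ?F (snd p *\<^sub>R sgn (fst p)) \<partial>?D)"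
    unfolding levy_of_thorin_def using map F by (intro integral_distr) simp_all
  also have "\<dots> = (\<integral>p. ?G p \<partial>(T \<Otimes>\<^sub>M lborel))"
    by (intro integral_density Fm dm AE_I2 radial_density_nonneg)
  also have "\<dots> = (\<integral>x. \<integral>r. ?G (x, r) \<partial>lborel \<partial>T)"
    by (rule P.integral_fst'[OF int, symmetric])
  also have "\<dots> = (\<integral>x. - thorin_integrand z x - \<i> * of_real (\<Sum>j\<in>UNIV. z $ j * drift_integrand j x) \<partial>T)"
  proof (rule integral_cong_AE)
    show "(\<lambda>x. \<integral>r. ?G (x, r) \<partial>lborel) \<in> borel_measurable T"
      by (rule lborel.borel_measurable_lebesgue_integral[unfolded case_prod_beta]) (use Gm in simp)
    have [measurable]: "drift_integrand j \<in> borel_measurable borel" "thorin_integrand z \<in> borel_measurable borel" for j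
      by (rule drift_integrand_measurable thorin_integrand_measurable)+
    show "(\<lambda>x. - thorin_integrand z x - \<i> * of_real (\<Sum>j\<in>UNIV. z $ j * drift_integrand j x)) \<in> borel_measurable T"
      unfolding measurable_T by measurable
    show "AE x in T. (\<integral>r. ?G (x, r) \<partial>lborel) = - thorin_integrand z x - \<i> * of_real (\<Sum>j\<in>UNIV. z $ j * drift_integrand j x)"
      using AE_T_nonzero[OF T0]
    proof eventually_elim
      case (elim x)
      show ?case using compensated_polar_integral[OF elim, of z] by (simp only: fst_conv snd_conv)
    qed
  qed
  also have "\<dots> = - (\<integral>x. thorin_integrand z x \<partial>T) - \<i> * of_real (\<Sum>j\<in>UNIV. z $ j * (\<integral>x. drift_integrand j x \<partial>T))"
  proof -
    have sum: "integrable T (\<lambda>x. \<Sum>j\<in>UNIV. z $ j * drift_integrand j x)"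
      by (intro Bochner_Integration.integrable_sum integrable_mult_right integrable_drift_integrand)
    have "(\<integral>x. (\<Sum>j\<in>UNIV. z $ j * drift_integrand j x) \<partial>T) = (\<Sum>j\<in>UNIV. z $ j * (\<integral>x. drift_integrand j x \<partial>T))"
      by (subst Bochner_Integration.integral_sum) (auto intro!: integrable_mult_right integrable_drift_integrand)
    then show ?thesis
      using sum integrable_thorin_integrand[of z]
      by (subst Bochner_Integration.integral_diff)
         (auto simp only: Bochner_Integration.integral_minus Bochner_Integration.integral_mult_right_zero integral_complex_of_real
           intro!: integrable_mult_right integrable_of_real Bochner_Integration.integrable_minus)
  qed
  finally show ?thesis .
qed

lemma levy_khintchine_levy_of_thorin:
  "levy_khintchine a S (levy_of_thorin T) = thorin_exponent (\<chi> j. a $ j - (\<integral>x. drift_integrand j x \<partial>T)) S T"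
proof
  fix z
  define D where "D = (\<Sum>j\<in>UNIV. z $ j * (\<integral>x. drift_integrand j x \<partial>T))"
  have eq: "z \<bullet> (\<chi> j. a $ j - (\<integral>x. drift_integrand j x \<partial>T)) = z \<bullet> a - D"
    by (simp add: D_def inner_vec_def right_diff_distrib sum_subtractf)
  show "levy_khintchine a S (levy_of_thorin T) z = thorin_exponent (\<chi> j. a $ j - (\<integral>x. drift_integrand j x \<partial>T)) S T z"
    unfolding levy_khintchine_def thorin_exponent_def levy_khintchine_integral D_def[symmetric] eq by (simp add: algebra_simps)
qed

lemma levy_measure_levy_of_thorin: "levy_measure (levy_of_thorin T)"
  using fin nn_integral_levy_of_thorin_truncated[OF T0] emeasure_levy_of_thorin_origin[OF T0]
  by (simp add: levy_measure_def)

end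

end

section \<open>The representation theorem\<close>

text \<open>On an annulus \<open>T\<close> is finite by local finiteness and x / |x|^2 is bounded,
  so the bounded case applies there. The complement contributes at most a constant times the
  integral of \<open>radial_bound\<close> over it, which tends to 0 as the annuli grow, uniformly
  for |z| <= R.\<close>

lemma thorin_part_in_thorin_exponents:
  fixes T :: "(real ^ 'n) measure"
  assumes sets_T: "sets T = sets borel" and nz: "AE x in T. x \<noteq> 0"
    and rb: "integrable T (\<lambda>x. radial_bound (norm x))" and lf: "locally_finite_off_origin T"
    and int: "\<And>z. integrable T (thorin_integrand z)"
  shows "(\<lambda>z. - (\<integral>x. thorin_integrand z x \<partial>T)) \<in> thorin_exponents"
proof (rule thorin_exponents_limit)
  fix R \<epsilon> :: real assume \<epsilon>: "\<epsilon> > 0" and R: "R > 0"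
  define C where "C = R\<^sup>2 + R + 5"
  have C: "C > 0" using R by (simp add: C_def add_pos_pos)
  have meas_T: "measurable T N = measurable borel N" for N :: "'b measure"
    by (intro measurable_cong_sets sets_T refl)
  have sp_T: "space T = UNIV" using sets_eq_imp_space_eq[OF sets_T] by simp
  define A :: "nat \<Rightarrow> (real ^ 'n) set" where "A n = cball 0 (real (Suc n)) - ball 0 (1 / real (Suc n))" for n
  have A_borel[measurable]: "A n \<in> sets borel" for n by (simp add: A_def)
  have lim: "(\<lambda>n. \<integral>x. indicator (- A n) x * radial_bound (norm x) \<partial>T) \<longlonglongrightarrow> (\<integral>x. 0 \<partial>T)"
  proof (rule integral_dominated_convergence[where w="\<lambda>x. \<bar>radial_bound (norm x)\<bar>"])
    show "(\<lambda>x. indicator (- A n) x * radial_bound (norm x)) \<in> borel_measurable T" for n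
      unfolding meas_T by measurable
    show "integrable T (\<lambda>x. \<bar>radial_bound (norm x)\<bar>)" using rb by (rule integrable_abs)
    show "AE x in T. (\<lambda>n. indicator (- A n) x * radial_bound (norm x)) \<longlonglongrightarrow> 0"
      using nz
    proof eventually_elim
      case (elim x)
      obtain m where m: "max (norm x) (1 / norm x) < real m" using reals_Archimedean2 by blast
      have "x \<in> A n" if "n \<ge> m" for n
      proof -
        have *: "norm x < real (Suc n)" "1 / norm x < real (Suc n)" using m that by auto
        then have "1 / real (Suc n) < norm x" using elim by (simp add: field_simps del: of_nat_Suc)
        with * show ?thesis by (simp add: A_def del: of_nat_Suc)
      qed
      then have "\<forall>\<^sub>F n in sequentially. indicator (- A n) x * radial_bound (norm x) = 0"
        by (auto simp: eventually_sequentially indicator_def intro!: exI[of _ m])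
      then show ?case by (rule tendsto_eventually)
    qed
    show "AE x in T. norm (indicator (- A n) x * radial_bound (norm x)) \<le> \<bar>radial_bound (norm x)\<bar>" for n
      by (auto simp: indicator_def)
  qed simp
  have "(\<lambda>n. \<integral>x. indicator (- A n) x * radial_bound (norm x) \<partial>T) \<longlonglongrightarrow> 0" using lim by simp
  from order_tendstoD(2)[OF this divide_pos_pos[OF \<epsilon> C]]
  obtain n where n: "(\<integral>x. indicator (- A n) x * radial_bound (norm x) \<partial>T) < \<epsilon> / C"
    using eventually_happens'[OF sequentially_bot] by blast
  define M where "M = restrict_space T (A n)"
  have An: "A n \<inter> space T \<in> sets T" by (simp add: sp_T sets_T)
  have "compact (A n)" unfolding A_def by (intro compact_diff) auto
  moreover have "0 \<notin> A n" by (simp add: A_def)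
  ultimately have "emeasure T (A n) < \<infinity>" using lf by (simp add: locally_finite_off_origin_def)
  then have M: "finite_measure M"
    unfolding M_def using An by (intro finite_measureI) (simp add: sp_T emeasure_restrict_space space_restrict_space)
  interpret M: finite_measure M by (rule M)
  have meas_M: "h \<in> measurable M N" if "h \<in> measurable borel N" for h and N :: "'b measure"
    unfolding M_def using that by (intro measurable_restrict_space1) (simp add: meas_T)
  define f where "f x = (1 / (norm x)\<^sup>2) *\<^sub>R x" for x :: "real ^ 'n"
  \<comment> \<open>The compensator is linear in z, so over the annulus it integrates to i z . c and
    enters the approximant as the drift - c.\<close>
  define g where "g x = indicator {x. 1 \<le> norm x} x *\<^sub>R f x" for x
  have f_borel[measurable]: "f \<in> borel_measurable borel" unfolding f_def[abs_def] by measurable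
  have g_borel: "g \<in> borel_measurable borel" unfolding g_def[abs_def] by measurable
  have f_le: "norm (f x) \<le> real (Suc n)" if "x \<in> space M" for x
  proof -
    have "1 / real (Suc n) \<le> norm x" using that by (simp add: M_def space_restrict_space A_def del: of_nat_Suc)
    moreover from this have "0 < norm x" by (rule less_le_trans[rotated]) simp
    ultimately show ?thesis by (simp add: f_def field_simps power2_eq_square del: of_nat_Suc zero_less_norm_iff)
  qed
  have g_le: "norm (g x) \<le> real (Suc n)" if "x \<in> space M" for x
    using f_le[OF that] by (simp add: g_def indicator_def)
  have int_g: "integrable M g"
    using g_le by (intro M.integrable_const_bound[of _ "real (Suc n)"] AE_I2 meas_M g_borel)
  define c where "c = (\<integral>x. g x \<partial>M)"
  define \<phi> where "\<phi> = (\<lambda>z. - (\<integral>x. Ln_ii (z \<bullet> f x) \<partial>M) + \<i> * of_real (z \<bullet> (- c)))"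
  have \<phi>_in: "\<phi> \<in> thorin_exponents"
    unfolding \<phi>_def using f_le
    by (intro thorin_exponents_add drift_in_thorin_exponents thorin_integral_in_thorin_exponents[OF M] meas_M f_borel)
  have on_A: "(\<integral>x. indicator (A n) x *\<^sub>R thorin_integrand z x \<partial>T) = - \<phi> z" for z
  proof -
    have Lm: "(\<lambda>x. Ln_ii (z \<bullet> f x)) \<in> borel_measurable borel"
      by (rule measurable_compose[OF _ Ln_ii_measurable]) measurable
    have iL: "integrable M (\<lambda>x. Ln_ii (z \<bullet> f x))"
    proof (rule M.integrable_const_bound[of _ "norm z * real (Suc n)"])
      show "AE x in M. cmod (Ln_ii (z \<bullet> f x)) \<le> norm z * real (Suc n)"
      proof (rule AE_I2)
        fix x assume x: "x \<in> space M"
        have "cmod (Ln_ii (z \<bullet> f x)) \<le> \<bar>z \<bullet> f x\<bar>" by (rule cmod_Ln_ii_le)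
        also have "\<dots> \<le> norm z * norm (f x)" by (rule Cauchy_Schwarz_ineq2)
        also have "\<dots> \<le> norm z * real (Suc n)" using f_le[OF x] by (intro mult_left_mono) auto
        finally show "cmod (Ln_ii (z \<bullet> f x)) \<le> norm z * real (Suc n)" .
      qed
    qed (rule meas_M[OF Lm])
    have ig: "integrable M (\<lambda>x. \<i> * complex_of_real (z \<bullet> g x))"
      using int_g by (intro integrable_mult_right integrable_of_real integrable_inner_right)
    have "(\<integral>x. indicator (A n) x *\<^sub>R thorin_integrand z x \<partial>T) = (\<integral>x. thorin_integrand z x \<partial>M)"
      unfolding M_def by (rule integral_restrict_space[OF An, symmetric])
    also have "\<dots> = (\<integral>x. Ln_ii (z \<bullet> f x) + \<i> * of_real (z \<bullet> g x) \<partial>M)"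
      by (intro Bochner_Integration.integral_cong refl) (simp add: thorin_integrand_def f_def g_def indicator_def)
    also have "\<dots> = (\<integral>x. Ln_ii (z \<bullet> f x) \<partial>M) + (\<integral>x. \<i> * of_real (z \<bullet> g x) \<partial>M)"
      by (rule Bochner_Integration.integral_add[OF iL ig])
    also have "(\<integral>x. \<i> * complex_of_real (z \<bullet> g x) \<partial>M) = \<i> * of_real (z \<bullet> c)"
      unfolding c_def using int_g
      by (simp only: Bochner_Integration.integral_mult_right_zero integral_complex_of_real integral_inner_right)
    finally show ?thesis by (simp add: \<phi>_def)
  qed
  have "cmod (- (\<integral>x. thorin_integrand z x \<partial>T) - \<phi> z) \<le> \<epsilon>" if z: "norm z \<le> R" for z
  proof -
    have i1: "integrable T (\<lambda>x. indicator (A n) x *\<^sub>R thorin_integrand z x)"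
      and i2: "integrable T (\<lambda>x. indicator (- A n) x *\<^sub>R thorin_integrand z x)"
      using int by (intro integrable_mult_indicator; simp add: sets_T)+
    have "(\<integral>x. thorin_integrand z x \<partial>T) = (\<integral>x. indicator (A n) x *\<^sub>R thorin_integrand z x + indicator (- A n) x *\<^sub>R thorin_integrand z x \<partial>T)"
      by (intro Bochner_Integration.integral_cong) (auto simp: indicator_def)
    also have "\<dots> = - \<phi> z + (\<integral>x. indicator (- A n) x *\<^sub>R thorin_integrand z x \<partial>T)"
      using Bochner_Integration.integral_add[OF i1 i2] on_A by simp
    finally have "cmod (- (\<integral>x. thorin_integrand z x \<partial>T) - \<phi> z) = cmod (\<integral>x. indicator (- A n) x *\<^sub>R thorin_integrand z x \<partial>T)"
      by simp
    also have "\<dots> \<le> (\<integral>x. cmod (indicator (- A n) x *\<^sub>R thorin_integrand z x) \<partial>T)" by (rule integral_norm_bound)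
    also have "\<dots> \<le> (\<integral>x. C * (indicator (- A n) x * radial_bound (norm x)) \<partial>T)"
    proof (rule integral_mono_AE)
      show "integrable T (\<lambda>x. cmod (indicator (- A n) x *\<^sub>R thorin_integrand z x))" using i2 by (rule integrable_norm)
      have "integrable T (\<lambda>x. indicator (- A n) x *\<^sub>R radial_bound (norm x))"
        using rb by (intro integrable_mult_indicator) (auto simp: sets_T)
      then show "integrable T (\<lambda>x. C * (indicator (- A n) x * radial_bound (norm x)))"
        by (intro integrable_mult_right) simp
      show "AE x in T. cmod (indicator (- A n) x *\<^sub>R thorin_integrand z x) \<le> C * (indicator (- A n) x * radial_bound (norm x))"
        using nz
      proof eventually_elim
        case (elim x)
        then show ?case using cmod_thorin_integrand_le[OF elim z] by (simp add: indicator_def C_def)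
      qed
    qed
    also have "\<dots> = C * (\<integral>x. indicator (- A n) x * radial_bound (norm x) \<partial>T)"
      by (simp only: Bochner_Integration.integral_mult_right_zero)
    also have "\<dots> \<le> \<epsilon>" using n C by (simp add: field_simps)
    finally show ?thesis .
  qed
  then show "\<exists>\<phi>\<in>thorin_exponents. \<forall>z. norm z \<le> R \<longrightarrow> cmod (- (\<integral>x. thorin_integrand z x \<partial>T) - \<phi> z) \<le> \<epsilon>"
    by (intro bexI[OF _ \<phi>_in] allI impI)
qed

section \<open>Radial measures and the mass at the origin\<close>

context thorin_data begin

lemma laplace_measurable:
  assumes u: "u \<in> sphere 0 1" shows "laplace (tau u) \<in> borel_measurable borel"
proof -
  interpret tau: sigma_finite_measure "tau u" by (rule sigma_finite_tau[OF u])
  have 1: "(\<lambda>p. (fst p, snd p)) \<in> measurable (borel \<Otimes>\<^sub>M tau u) (borel \<Otimes>\<^sub>M borel)"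
    by (intro measurable_Pair measurable_compose[OF measurable_snd tau_ident[OF u]]) simp
  have 2: "(\<lambda>p. ennreal (exp (- (fst p * snd p)))) \<in> borel_measurable (borel \<Otimes>\<^sub>M borel)" by measurable
  have "(\<lambda>p. ennreal (exp (- (fst p * snd p)))) \<in> borel_measurable (borel \<Otimes>\<^sub>M tau u)"
    using measurable_compose[OF 1 2] by simp
  from tau.borel_measurable_nn_integral_fst[OF this] show ?thesis
    by (simp add: laplace_def[abs_def])
qed

text \<open>The density is an abstract w agreeing with the Laplace form for r > 0, so that both k(u,
  r) / r as given and the Laplace transform divided by r are covered.\<close>

lemma radial_measure_density_measurable:
  assumes u: "u \<in> sphere 0 1" and w: "\<And>r. r > 0 \<Longrightarrow> w r = laplace (tau u) r / ennreal r"
  shows "w \<in> borel_measurable (restrict_space lborel {0<..})"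
proof (rule measurable_congI)
  have [measurable]: "laplace (tau u) \<in> borel_measurable borel" by (rule laplace_measurable[OF u])
  show "(\<lambda>r. laplace (tau u) r / ennreal r) \<in> borel_measurable (restrict_space lborel {0<..})"
    by (intro measurable_restrict_space1) measurable
qed (simp add: space_restrict_space w)

lemma nn_integral_radial_measure:
  assumes u: "u \<in> sphere 0 1" and w: "\<And>r. r > 0 \<Longrightarrow> w r = laplace (tau u) r / ennreal r"
    and g: "g \<in> borel_measurable borel"
  shows "(\<integral>\<^sup>+r. g r \<partial>density (restrict_space lborel {0<..}) w)
    = (\<integral>\<^sup>+r. g r * (laplace (tau u) r / ennreal r) * indicator {0<..} r \<partial>lborel)"
proof -
  have gm: "g \<in> borel_measurable (restrict_space lborel {0<..})"
    using g by (intro measurable_restrict_space1) simp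
  have "(\<integral>\<^sup>+r. g r \<partial>density (restrict_space lborel {0<..}) w) = (\<integral>\<^sup>+r. w r * g r \<partial>restrict_space lborel {0<..})"
    by (rule nn_integral_density[OF radial_measure_density_measurable[OF u w] gm])
  also have "\<dots> = (\<integral>\<^sup>+r. w r * g r * indicator {0<..} r \<partial>lborel)"
    by (rule nn_integral_restrict_space) simp
  also have "\<dots> = (\<integral>\<^sup>+r. g r * (laplace (tau u) r / ennreal r) * indicator {0<..} r \<partial>lborel)"
    using w by (intro nn_integral_cong) (auto simp: indicator_def mult.commute)
  finally show ?thesis .
qed

lemma polar_integral_radial_measure:
  assumes B: "B \<in> sets borel" and w: "\<And>u r. u \<in> sphere 0 1 \<Longrightarrow> r > 0 \<Longrightarrow> w u r = laplace (tau u) r / ennreal r"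
  shows "(\<integral>\<^sup>+u. \<integral>\<^sup>+r. indicator B (r *\<^sub>R u) \<partial>density (restrict_space lborel {0<..}) (w u) \<partial>lam)
    = polar_integral (indicator B)"
  using B w by (intro nn_integral_cong nn_integral_radial_measure) (auto simp: space_lam)

text \<open>An atom of tau u at 0 bounds the Laplace transform from below by a constant, so the
  radial density is at least that constant over r on [1, \<infinity>), of infinite mass. But a Levy
  measure is finite outside the unit ball.\<close>

lemma origin_null_of_levy_measure:
  assumes levy: "levy_measure \<nu>"
    and polar: "\<And>B. B \<in> sets borel \<Longrightarrow> 0 \<notin> B \<Longrightarrow> emeasure \<nu> B =
      polar_integral (indicator B)"
  shows "emeasure T {0} = 0"
proof -
  let ?B = "{x :: real ^ 'n. 1 \<le> norm x}"
  have sets_\<nu>: "sets \<nu> = sets borel" using levy by (simp add: levy_measure_def)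
  have B: "?B \<in> sets borel" by measurable
  have top: "(\<integral>\<^sup>+r. ennreal (1 / r) * indicator {1..} r \<partial>lborel) = \<infinity>"
  proof (rule ccontr)
    assume "(\<integral>\<^sup>+r. ennreal (1 / r) * indicator {1..} r \<partial>lborel) \<noteq> \<infinity>"
    then obtain q where q: "q \<ge> 0" "(\<integral>\<^sup>+r. ennreal (1 / r) * indicator {1..} r \<partial>lborel) = ennreal q"
      by (cases "\<integral>\<^sup>+r. ennreal (1 / r) * indicator {1..} r \<partial>lborel") auto
    \<comment> \<open>Cutting at exp (q + 1) already gives q + 1, more than the supposed total
      q.\<close>
    have "ennreal (ln (exp (q + 1))) = (\<integral>\<^sup>+r. ennreal (1 / r) * indicator {1..exp (q + 1)} r \<partial>lborel)"
      using q by (intro nn_integral_inverse_Icc[symmetric]) simp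
    also have "\<dots> \<le> (\<integral>\<^sup>+r. ennreal (1 / r) * indicator {1..} r \<partial>lborel)"
      by (intro nn_integral_mono) (auto simp: indicator_def)
    finally show False using q by (simp add: ennreal_le_iff)
  qed
  \<comment> \<open>In the extended reals \<infinity> * 0 is 0 and \<infinity> times anything
    positive is \<infinity>, so a finite bound on this product forces the mass to vanish.\<close>
  have "\<infinity> * emeasure T {0} = (\<integral>\<^sup>+u. \<infinity> * emeasure (tau u) {0} \<partial>lam)"
    unfolding emeasure_T_origin by (rule nn_integral_cmult[OF tau_origin_measurable, symmetric])
  also have "\<dots> \<le> polar_integral (indicator ?B)"
  proof (rule nn_integral_mono)
    fix u assume "u \<in> space lam"
    then have u: "u \<in> sphere 0 1" by (simp add: space_lam)
    have "{0} \<in> sets (tau u)"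
      unfolding sets_tau[OF u] by (auto simp: sets_restrict_space intro!: image_eqI[of _ _ "{0}"])
    then have "emeasure (tau u) {0} = (\<integral>\<^sup>+s. indicator {0} s \<partial>tau u)" by simp
    also have "\<dots> \<le> laplace (tau u) r" for r
      unfolding laplace_def by (intro nn_integral_mono) (simp add: indicator_def)
    finally have lap: "emeasure (tau u) {0} \<le> laplace (tau u) r" for r .
    have "\<infinity> * emeasure (tau u) {0} = (\<integral>\<^sup>+r. ennreal (1 / r) * indicator {1..} r * emeasure (tau u) {0} \<partial>lborel)"
      unfolding top[symmetric] by (intro nn_integral_multc[symmetric]) measurable
    also have "\<dots> \<le> (\<integral>\<^sup>+r. indicator ?B (r *\<^sub>R u) * (laplace (tau u) r / ennreal r) * indicator {0<..} r \<partial>lborel)"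
    proof (rule nn_integral_mono)
      fix r :: real
      show "ennreal (1 / r) * indicator {1..} r * emeasure (tau u) {0}
        \<le> indicator ?B (r *\<^sub>R u) * (laplace (tau u) r / ennreal r) * indicator {0<..} r"
      proof (cases "r \<ge> 1")
        case True
        have "ennreal (1 / r) = 1 / ennreal r" using True by (simp add: divide_ennreal[symmetric])
        then have "ennreal (1 / r) * emeasure (tau u) {0} \<le> laplace (tau u) r / ennreal r"
          using mult_right_mono[OF lap[of r], of "inverse (ennreal r)"] by (simp add: divide_ennreal_def mult.commute)
        then show ?thesis using True u by (simp add: indicator_def)
      qed simp
    qed
    finally show "\<infinity> * emeasure (tau u) {0} \<le> (\<integral>\<^sup>+r. indicator ?B (r *\<^sub>R u) * (laplace (tau u) r / ennreal r) * indicator {0<..} r \<partial>lborel)" .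
  qed
  also have "\<dots> = emeasure \<nu> ?B" by (rule polar[OF B, symmetric]) simp
  also have "\<dots> = (\<integral>\<^sup>+x. indicator ?B x \<partial>\<nu>)" using B sets_\<nu> by simp
  also have "\<dots> \<le> (\<integral>\<^sup>+x. ennreal (min ((norm x)\<^sup>2) 1) \<partial>\<nu>)"
    by (intro nn_integral_mono) (auto simp: indicator_def min_absorb2)
  also have "\<dots> < \<infinity>" using levy by (simp add: levy_measure_def)
  finally show ?thesis by (auto simp: ennreal_top_mult split: if_splits)
qed

lemma thorin_integrable_of_radial_bound:
  assumes "emeasure T {0} = 0" "(\<integral>\<^sup>+x. ennreal (radial_bound (norm x)) \<partial>T) < \<infinity>"
  shows "thorin_integrable T"
proof -
  have "(\<integral>\<^sup>+x. thorin_weight x \<partial>T) \<le> (\<integral>\<^sup>+x. ennreal (radial_bound (norm x)) \<partial>T)"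
    using AE_T_nonzero[OF assms(1)] by (intro nn_integral_mono_AE, eventually_elim) (rule thorin_weight_le_radial_bound)
  then show ?thesis using assms(2) by (simp add: thorin_integrable_def)
qed

lemma origin_null_of_thorin_integrable:
  assumes "thorin_integrable T" shows "emeasure T {0} = 0"
proof -
  have "\<infinity> * emeasure T {0} = (\<integral>\<^sup>+x. \<infinity> * indicator {0} x \<partial>T)"
    by (subst nn_integral_cmult_indicator) (auto simp: sets_T)
  also have "\<dots> \<le> (\<integral>\<^sup>+x. thorin_weight x \<partial>T)"
    by (intro nn_integral_mono) (simp add: indicator_def thorin_weight_def)
  also have "\<dots> < \<infinity>" using assms by (simp add: thorin_integrable_def)
  finally show ?thesis by (auto simp: ennreal_top_mult split: if_splits)
qed

text \<open>The factor 6 combines 2 from the upper estimate of the radial integral with 3 from the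
  comparison with the weight. The leftover indicator belongs to a compact shell off the origin,
  whose mass is finite by local finiteness.\<close>

lemma levy_radial_integral_finite:
  assumes ti: "thorin_integrable T" and lf: "locally_finite_off_origin T"
  shows "(\<integral>\<^sup>+x. levy_radial_integral (norm x) \<partial>T) < \<infinity>"
proof -
  let ?A = "{x :: real ^ 'n. norm x \<in> {1/2..2}}"
  have tw: "thorin_weight \<in> borel_measurable T"
    unfolding thorin_weight_def[abs_def] measurable_cong_sets[OF sets_T refl] by measurable
  have A: "?A \<in> sets T" unfolding sets_T by measurable
  have "?A = cball 0 2 - ball 0 (1/2)" by auto
  then have "compact ?A" by (simp add: compact_diff)
  then have "emeasure T ?A < \<infinity>" using lf by (simp add: locally_finite_off_origin_def)
  have "(\<integral>\<^sup>+x. levy_radial_integral (norm x) \<partial>T) \<le> (\<integral>\<^sup>+x. 6 * (thorin_weight x + indicator ?A x) \<partial>T)"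
    using AE_T_nonzero[OF origin_null_of_thorin_integrable[OF ti]]
  proof (intro nn_integral_mono_AE, eventually_elim)
    case (elim x)
    have "levy_radial_integral (norm x) \<le> ennreal (2 * radial_bound (norm x))"
      using elim by (intro levy_radial_integral_le) simp
    also have "\<dots> = 2 * ennreal (radial_bound (norm x))"
      by (simp add: ennreal_mult')
    also have "\<dots> \<le> 2 * (3 * (thorin_weight x + indicator ?A x))"
      using elim by (intro mult_left_mono radial_bound_le_thorin_weight) auto
    also have "\<dots> = 6 * (thorin_weight x + indicator ?A x)" by (simp add: mult.assoc[symmetric])
    finally show ?case .
  qed
  also have "\<dots> = 6 * ((\<integral>\<^sup>+x. thorin_weight x \<partial>T) + emeasure T ?A)"
    using tw A by (simp add: nn_integral_cmult nn_integral_add)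
  also have "\<dots> < \<infinity>"
    using ti \<open>emeasure T ?A < \<infinity>\<close> by (simp add: thorin_integrable_def ennreal_mult_less_top)
  finally show ?thesis .
qed

lemma polar_representation_levy_of_thorin:
  assumes T0: "emeasure T {0} = 0"
  shows "polar_representation (levy_of_thorin T) lam
    (\<lambda>u. density (restrict_space lborel {0<..}) (\<lambda>r. laplace (tau u) r / ennreal r))"
    (is "polar_representation _ _ ?m")
  unfolding polar_representation_def
proof (intro conjI ballI impI lam)
  have sets_m: "sets (?m u) = sets (restrict_space borel {0<..})" for u
    by (simp add: sets_restrict_space_cong[OF sets_lborel])
  show "measurable_family {0<..} ?m"
    unfolding measurable_family_def
  proof (intro conjI ballI sets_m)
    fix B :: "real set" assume B: "B \<in> sets (restrict_space borel {0<..})"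
    then have B_borel: "B \<in> sets borel" by (auto simp: sets_restrict_space)
    \<comment> \<open>Exchanging the integrals rewrites the mass of B as the integral of the fixed
      function H against tau u, which is measurable in u.\<close>
    define H where "H s = (\<integral>\<^sup>+r. indicator B r * ennreal (if r > 0 then exp (- (s * r)) / r else 0) \<partial>lborel)" for s :: real
    have H: "H \<in> borel_measurable borel"
      unfolding H_def using B_borel by measurable
    have "(\<lambda>p. H (snd p)) \<in> borel_measurable (borel \<Otimes>\<^sub>M borel)"
      by (rule measurable_compose[OF measurable_snd H])
    from tau_integral_measurable[OF this] have "(\<lambda>u. \<integral>\<^sup>+s. H s \<partial>tau u) \<in> borel_measurable lam" by simp
    then have "(\<lambda>u. emeasure (?m u) B) \<in> borel_measurable lam"
    proof (rule measurable_congI)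
      fix u assume "u \<in> space lam"
      then have u: "u \<in> sphere 0 1" by (simp add: space_lam)
      have "emeasure (?m u) B = (\<integral>\<^sup>+r. indicator B r \<partial>?m u)" using B sets_m by simp
      also have "\<dots> = (\<integral>\<^sup>+r. indicator B r * (laplace (tau u) r / ennreal r) * indicator {0<..} r \<partial>lborel)"
        using B_borel by (intro nn_integral_radial_measure[OF u]) auto
      also have "\<dots> = (\<integral>\<^sup>+s. H s \<partial>tau u)"
        unfolding H_def using B_borel by (intro nn_integral_laplace_swap[OF u, symmetric]) simp
      finally show "(\<integral>\<^sup>+s. H s \<partial>tau u) = emeasure (?m u) B" by simp
    qed
    then show "(\<lambda>u. emeasure (?m u) B) \<in> borel_measurable (restrict_space borel (sphere 0 1))"
      using measurable_cong_sets[OF sets_lam refl] by blast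
  qed
next
  fix u :: "real ^ 'n" assume u: "u \<in> sphere 0 1"
  interpret L: sigma_finite_measure "restrict_space lborel {0<..} :: real measure"
    by (intro sigma_finite_measure_restrict_space sigma_finite_lborel) simp
  show "sigma_finite_measure (?m u)"
  proof (subst L.sigma_finite_iff_density_finite)
    show "(\<lambda>r. laplace (tau u) r / ennreal r) \<in> borel_measurable (restrict_space lborel {0<..})"
      by (rule radial_measure_density_measurable[OF u refl])
    show "AE r in restrict_space lborel {0<..}. laplace (tau u) r / ennreal r \<noteq> \<infinity>"
    proof (rule AE_I2)
      fix r :: real assume "r \<in> space (restrict_space lborel {0<..})"
      then have "r > 0" by (simp add: space_restrict_space)
      then show "laplace (tau u) r / ennreal r \<noteq> \<infinity>"
        using laplace_finite[OF u, of r] by (simp add: ennreal_divide_eq_top_iff less_top)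
    qed
  qed
next
  fix B :: "(real ^ 'n) set" assume B: "B \<in> sets borel"
  have "emeasure (levy_of_thorin T) B = (\<integral>\<^sup>+x. indicator B x \<partial>levy_of_thorin T)" using B by simp
  also have "\<dots> = polar_integral (indicator B)"
    using B by (intro nn_integral_polar_swap T0) simp
  also have "\<dots> = (\<integral>\<^sup>+u. \<integral>\<^sup>+r. indicator B (r *\<^sub>R u) \<partial>?m u \<partial>lam)"
    by (rule polar_integral_radial_measure[OF B refl, symmetric])
  finally show "emeasure (levy_of_thorin T) B = (\<integral>\<^sup>+u. \<integral>\<^sup>+r. indicator B (r *\<^sub>R u) \<partial>?m u \<partial>lam)" .
qed

end

text \<open>Once the origin is known to be null, the polar formula forces \<nu> to be
  \<open>levy_of_thorin T\<close>. The Levy condition then becomes integrability over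
  \<open>T\<close>, and the given exponent is rewritten without any change of law.\<close>

lemma thorin_representation_direct:
  fixes \<mu> :: "(real ^ 'n) measure"
  assumes triplet: "has_levy_triplet \<mu> a S \<nu>" and polar: "polar_representation \<nu> lam m"
    and m: "\<forall>u\<in>sphere 0 1. m u = density (restrict_space lborel {0<..}) (\<lambda>r. ennreal (k u r / r))"
    and tau: "measurable_family {0..} tau"
    and k: "\<forall>u\<in>sphere 0 1. \<forall>r>0. 0 \<le> k u r \<and> ennreal (k u r) = laplace (tau u) r"
    and T: "thorin_measure T lam tau"
  shows "thorin_integrable T \<and> (\<forall>z. integrable T (thorin_integrand z)) \<and>
    (\<forall>j. integrable T (drift_integrand j)) \<and>
    is_char_exponent \<mu> (thorin_exponent (\<chi> j. a $ j - (\<integral>x. drift_integrand j x \<partial>T)) S T)"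
proof -
  interpret thorin_data lam tau T
  proof
    show "laplace (tau u) r < \<infinity>" if "u \<in> sphere 0 1" "r > 0" for u r
      using k that by (metis ennreal_less_top infinity_ennreal_def)
  qed (use polar tau T in \<open>auto simp: polar_representation_def\<close>)
  have levy: "levy_measure \<nu>" using triplet by (simp add: has_levy_triplet_def)
  have polar': "emeasure \<nu> B = polar_integral (indicator B)"
    if B: "B \<in> sets borel" "0 \<notin> B" for B
  proof -
    have "emeasure \<nu> B = (\<integral>\<^sup>+u. \<integral>\<^sup>+r. indicator B (r *\<^sub>R u) \<partial>m u \<partial>lam)"
      using polar B by (simp add: polar_representation_def)
    also have "\<dots> = (\<integral>\<^sup>+u. \<integral>\<^sup>+r. indicator B (r *\<^sub>R u) \<partial>density (restrict_space lborel {0<..}) (\<lambda>r. ennreal (k u r / r)) \<partial>lam)"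
      using m by (intro nn_integral_cong) (simp add: space_lam)
    also have "\<dots> = polar_integral (indicator B)"
    proof (rule polar_integral_radial_measure[OF B(1)])
      fix u :: "real ^ 'n" and r :: real assume "u \<in> sphere 0 1" "r > 0"
      then show "ennreal (k u r / r) = laplace (tau u) r / ennreal r"
        using k by (metis divide_ennreal)
    qed
    finally show ?thesis .
  qed
  have T0: "emeasure T {0} = 0"
    by (rule origin_null_of_levy_measure[OF levy polar'])
  have \<nu>: "\<nu> = levy_of_thorin T"
    using levy by (intro levy_of_thorin_unique[OF T0 _ _ polar']) (auto simp: levy_measure_def)
  have fin: "(\<integral>\<^sup>+x. levy_radial_integral (norm x) \<partial>T) < \<infinity>"
    using levy nn_integral_levy_of_thorin_truncated[OF T0] by (simp add: levy_measure_def \<nu>)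
  show ?thesis
    using triplet thorin_integrable_of_radial_bound[OF T0 nn_integral_radial_bound[OF T0 fin]]
      integrable_thorin_integrand[OF T0 fin] integrable_drift_integrand[OF T0 fin]
    by (simp add: has_levy_triplet_def \<nu> levy_khintchine_levy_of_thorin[OF T0 fin])
qed

text \<open>The exponent is a sum of drift, Gaussian part and Thorin integral, each in the closed
  class. The drift equation is solved for a directly, its integral depending on \<open>T\<close>
  alone; reading the exponent identity backwards gives the Levy triplet.\<close>

lemma thorin_representation_converse:
  fixes b :: "real ^ 'n"
  assumes S: "symmetric_nonneg_def S" and lam: "finite_sphere_measure lam" and tau: "measurable_family {0..} tau"
    and laplace: "\<forall>u\<in>sphere 0 1. \<forall>r>0. laplace (tau u) r < \<infinity>"
    and T: "thorin_measure T lam tau" and lf: "locally_finite_off_origin T" and ti: "thorin_integrable T"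
  shows "(\<forall>z. integrable T (thorin_integrand z)) \<and> (\<forall>j. integrable T (drift_integrand j)) \<and>
    (\<exists>\<mu>\<in>thorin_class. \<exists>a \<nu>. is_char_exponent \<mu> (thorin_exponent b S T) \<and> has_levy_triplet \<mu> a S \<nu> \<and>
      (\<forall>j. b $ j = a $ j - (\<integral>x. drift_integrand j x \<partial>T)) \<and>
      polar_representation \<nu> lam (\<lambda>u. density (restrict_space lborel {0<..}) (\<lambda>r. laplace (tau u) r / ennreal r)))"
proof -
  interpret thorin_data lam tau T
    using lam tau laplace T by unfold_locales auto
  have T0: "emeasure T {0} = 0" by (rule origin_null_of_thorin_integrable[OF ti])
  have fin: "(\<integral>\<^sup>+x. levy_radial_integral (norm x) \<partial>T) < \<infinity>" by (rule levy_radial_integral_finite[OF ti lf])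
  define a where "a = (\<chi> j. b $ j + (\<integral>x. drift_integrand j x \<partial>T))"
  have b: "b = (\<chi> j. a $ j - (\<integral>x. drift_integrand j x \<partial>T))" by (simp add: a_def vec_eq_iff)
  have "(\<lambda>z. (\<i> * of_real (z \<bullet> b) + - (of_real ((S *v z) \<bullet> z) / 2)) + - (\<integral>x. thorin_integrand z x \<partial>T)) \<in> thorin_exponents"
    by (intro thorin_exponents_add drift_in_thorin_exponents gaussian_in_thorin_exponents S
        thorin_part_in_thorin_exponents sets_T AE_T_nonzero T0 lf integrable_radial_bound[OF T0 fin]
        integrable_thorin_integrand[OF T0 fin])
  then have "thorin_exponent b S T \<in> thorin_exponents"
    by (simp add: thorin_exponent_def[abs_def])
  then obtain \<mu> where \<mu>: "\<mu> \<in> thorin_class" "is_char_exponent \<mu> (thorin_exponent b S T)"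
    using thorin_exponents_imp_thorin_class by blast
  have "has_levy_triplet \<mu> a S (levy_of_thorin T)"
    unfolding has_levy_triplet_def levy_khintchine_levy_of_thorin[OF T0 fin] b[symmetric]
    using \<mu> S levy_measure_levy_of_thorin[OF T0 fin] by (simp add: thorin_class_def)
  moreover have "\<forall>j. b $ j = a $ j - (\<integral>x. drift_integrand j x \<partial>T)" by (simp add: a_def)
  ultimately show ?thesis
    using \<mu> polar_representation_levy_of_thorin[OF T0]
      integrable_thorin_integrand[OF T0 fin] integrable_drift_integrand[OF T0 fin] by blast
qed

theorem theorem2:
  shows
    "(\<forall>(\<mu> :: (real ^ 'n) measure) a S \<nu> lam m k tau T.
        \<mu> \<in> thorin_class \<longrightarrow>
        has_levy_triplet \<mu> a S \<nu> \<longrightarrow>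
        polar_representation \<nu> lam m \<longrightarrow>
        (\<forall>u\<in>sphere 0 1. m u = density (restrict_space lborel {0<..}) (\<lambda>r. ennreal (k u r / r))) \<longrightarrow>
        measurable_family {0..} tau \<longrightarrow>
        (\<forall>u\<in>sphere 0 1. \<forall>r>0. 0 \<le> k u r \<and> ennreal (k u r) = laplace (tau u) r) \<longrightarrow>
        thorin_measure T lam tau \<longrightarrow>
          thorin_integrable T \<and>
          (\<forall>z. integrable T (thorin_integrand z)) \<and>
          (\<forall>j. integrable T (drift_integrand j)) \<and>
          is_char_exponent \<mu>
            (thorin_exponent (\<chi> j. a $ j - (\<integral>x. drift_integrand j x \<partial>T)) S T))
     \<and>
     (\<forall>(b :: real ^ 'n) S lam tau T.
        symmetric_nonneg_def S \<longrightarrow>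
        finite_sphere_measure lam \<longrightarrow>
        measurable_family {0..} tau \<longrightarrow>
        (\<forall>u\<in>sphere 0 1. sigma_finite_measure (tau u)) \<longrightarrow>
        (\<forall>u\<in>sphere 0 1. \<forall>r>0. laplace (tau u) r < \<infinity>) \<longrightarrow>
        thorin_measure T lam tau \<longrightarrow>
        locally_finite_off_origin T \<longrightarrow>
        thorin_integrable T \<longrightarrow>
          (\<forall>z. integrable T (thorin_integrand z)) \<and>
          (\<forall>j. integrable T (drift_integrand j)) \<and>
          (\<exists>\<mu>\<in>thorin_class. \<exists>a \<nu>.
             is_char_exponent \<mu> (thorin_exponent b S T) \<and>
             has_levy_triplet \<mu> a S \<nu> \<and>
             (\<forall>j. b $ j = a $ j - (\<integral>x. drift_integrand j x \<partial>T)) \<and>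
             polar_representation \<nu> lam
               (\<lambda>u. density (restrict_space lborel {0<..}) (\<lambda>r. laplace (tau u) r / ennreal r))))"
  by (rule conjI; intro allI impI;
      rule thorin_representation_direct thorin_representation_converse; assumption)

end
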